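(* Let $\Gamma$ be a semigroup with identity $e$ and let $\rho:\Gamma\to\mathrm{End}(G)$ be an endomorphism action with $\rho(e)=\mathrm{Id}$ on a solenoid $G$. Then $(G,\rho)$ is expansive if and only if both of the following hold: (a) $\widehat G$ is finitely generated as a $\mathbb{Z}[\Gamma]$-module, i.e. there is a finite set $F\subset\widehat G$ such that the set $\{\chi\circ\rho(\gamma):\chi\in F,\gamma\in\Gamma\}$ generates $\widehat G$ as an abelian group; (b) for every non-zero $p\in L(G)$, the orbit $\{\rho_e(\gamma)(p):\gamma\in\Gamma\}$ is unbounded in $L(G)$.
   Context: A solenoid is a compact connected finite-dimensional metrizable abelian group; equivalently its Pontryagin dual $\widehat G$ is a (countable) torsion-free discrete abelian group of finite rank. $L(G)$ denotes the real vector space of all group homomorphisms $\widehat G\to\mathbb R$ (pointwise operations); it is finite-dimensional. The induced action on $\widehat G$ is $\widehat\rho(\gamma)(\chi)=\chi\circ\rho(\gamma)$, and the induced action on $L(G)$ is $\rho_e(\gamma)(p)(\chi)=p(\chi\circ\rho(\gamma))$ for $p\in L(G)$, $\chi\in\widehat G$. An endomorphism action $\rho$ of $\Gamma$ on a metrizable topological group $X$ is expansive if there is a neighborhood $U$ of the identity with $\bigcap_{\gamma\in\Gamma}\rho(\gamma)^{-1}(U)=\{e\}$. *)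

theory Defs
  imports "HOL-Analysis.Analysis"
begin

text \<open>The group G is the whole of a type 'g of class topological_ab_group_add
  (additive notation). The circle group is the unit circle in the complex plane.\<close>

definition is_character :: "('g::topological_ab_group_add \<Rightarrow> complex) \<Rightarrow> bool" where
  "is_character ch \<longleftrightarrow> continuous_on UNIV ch \<and> (\<forall>x. cmod (ch x) = 1)
     \<and> (\<forall>x y. ch (x + y) = ch x * ch y)"

definition dual_group :: "('g::topological_ab_group_add \<Rightarrow> complex) set" where
  "dual_group = {ch. is_character ch}"

inductive_set gen_subgroup :: "('g \<Rightarrow> complex) set \<Rightarrow> ('g \<Rightarrow> complex) set"
  for S where
  gen_one: "(\<lambda>_. 1) \<in> gen_subgroup S"
| gen_base: "s \<in> S \<Longrightarrow> s \<in> gen_subgroup S"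
| gen_mult: "a \<in> gen_subgroup S \<Longrightarrow> b \<in> gen_subgroup S \<Longrightarrow> (\<lambda>x. a x * b x) \<in> gen_subgroup S"
| gen_inv: "a \<in> gen_subgroup S \<Longrightarrow> (\<lambda>x. inverse (a x)) \<in> gen_subgroup S"

definition dual_finite_rank :: "'g::topological_ab_group_add itself \<Rightarrow> bool" where
  "dual_finite_rank _ \<longleftrightarrow> (\<exists>S. finite S \<and> S \<subseteq> (dual_group :: ('g \<Rightarrow> complex) set) \<and>
     (\<forall>ch\<in>(dual_group :: ('g \<Rightarrow> complex) set). \<exists>n::nat. n > 0 \<and> (\<lambda>x. ch x ^ n) \<in> gen_subgroup S))"

text \<open>Solenoid: compact connected finite-dimensional metrizable abelian group.
  Finite-dimensionality is expressed (as in the context) by finite rank of the dual.\<close>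
definition solenoid :: "'g::topological_ab_group_add itself \<Rightarrow> bool" where
  "solenoid T \<longleftrightarrow> compact (UNIV :: 'g set) \<and> connected (UNIV :: 'g set)
     \<and> metrizable_space (euclidean :: 'g topology) \<and> dual_finite_rank T"

definition endo_action :: "('m::monoid_mult \<Rightarrow> 'g::topological_ab_group_add \<Rightarrow> 'g) \<Rightarrow> bool" where
  "endo_action \<rho> \<longleftrightarrow> (\<forall>\<gamma>. continuous_on UNIV (\<rho> \<gamma>) \<and> (\<forall>x y. \<rho> \<gamma> (x + y) = \<rho> \<gamma> x + \<rho> \<gamma> y))
     \<and> (\<forall>\<gamma> \<delta>. \<rho> (\<gamma> * \<delta>) = \<rho> \<gamma> \<circ> \<rho> \<delta>) \<and> \<rho> 1 = id"

definition expansive :: "('m \<Rightarrow> 'g::topological_ab_group_add \<Rightarrow> 'g) \<Rightarrow> bool" where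
  "expansive \<rho> \<longleftrightarrow> (\<exists>U. open U \<and> 0 \<in> U \<and> (\<Inter>\<gamma>. \<rho> \<gamma> -` U) = {0})"

definition LG :: "(('g::topological_ab_group_add \<Rightarrow> complex) \<Rightarrow> real) set" where
  "LG = {p. (\<forall>ch1\<in>dual_group. \<forall>ch2\<in>dual_group. p (\<lambda>x. ch1 x * ch2 x) = p ch1 + p ch2)
            \<and> (\<forall>ch. ch \<notin> dual_group \<longrightarrow> p ch = 0)}"

definition rho_e :: "('m \<Rightarrow> 'g::topological_ab_group_add \<Rightarrow> 'g) \<Rightarrow> 'm
     \<Rightarrow> (('g \<Rightarrow> complex) \<Rightarrow> real) \<Rightarrow> (('g \<Rightarrow> complex) \<Rightarrow> real)" where
  "rho_e \<rho> \<gamma> p = (\<lambda>ch. if ch \<in> dual_group then p (ch \<circ> \<rho> \<gamma>) else 0)"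

text \<open>Boundedness in the finite-dimensional space L(G) (unique Hausdorff vector
  topology = topology of pointwise convergence): pointwise boundedness.\<close>
definition bounded_in_LG :: "(('g::topological_ab_group_add \<Rightarrow> complex) \<Rightarrow> real) set \<Rightarrow> bool" where
  "bounded_in_LG A \<longleftrightarrow> (\<forall>ch\<in>dual_group. \<exists>B. \<forall>p\<in>A. \<bar>p ch\<bar> \<le> B)"

end

theory Submission
  imports Defs
begin

text \<open>Both directions rest on Pontryagin duality for \<open>G\<close>. The invariant mean of a continuous function
  is the limit of averages over finite families of translates. For a continuous \<open>h \<noteq> 0\<close>, convolution
  with the autocorrelation of \<open>h\<close>, acting on normalised positive definite functions, attains its top
  eigenvalue on a compact face (Tychonoff and equicontinuity), whose extreme points are characters not
  orthogonal to \<open>h\<close>. Hence characters separate points, and concentration of powers of products of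
  \<open>(1 + Re c) / 2\<close> shows that separating subgroups exhaust the dual and that homomorphisms from the
  dual to the circle are evaluations.

  Given expansiveness with neighbourhood \<open>U\<close>, finitely many characters cut out \<open>U\<close> and their orbit
  separates points, which gives (a); a non-zero \<open>p\<close> with bounded orbit would give points
  \<open>exp (i t p)\<close> of \<open>G\<close> whose orbit stays in \<open>U\<close>, which gives (b). Conversely, points \<open>y \<noteq> 0\<close> with orbits in
  ever smaller neighbourhoods, with arguments \<open>Arg (c y)\<close> rescaled to size one, accumulate at
  a non-zero \<open>p\<close> with bounded orbit. Finite generation is what makes the rescaled functions additive
  and bounded in the limit.\<close>

subsection \<open>Averages over finitely many translates\<close>

text \<open>Everything hinges on the existence of enough characters. Compact self-adjoint operators
  on a Hilbert space would give them; positive definite functions replace that space, because the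
  inequalities about them are pointwise and survive limits, and the normalised ones lie in a product
  of discs. The obstacle is that continuity is lost in pointwise limits. Convolution with
  \<open>h\<close> repairs this: the modulus of continuity of \<open>conv2 h v\<close> is controlled
  by \<open>h\<close> alone once \<open>v\<close> is bounded by 1.

  In the converse, the obstacle is that \<open>Arg\<close> is additive only near 1, while there are
  infinitely many characters. Each character is a word in orbit elements of the finite set
  \<open>F\<close>, so along the whole orbit of \<open>y k\<close> its distance to 1 is at most a
  constant times \<open>1/(k+1)\<close>. Additivity therefore holds eventually for each pair of
  characters, uniformly in the acting element, and the same words bound the rescaled arguments.
  Normalising by a nearly maximal argument, and starting from the orbit point where it occurs, keeps
  the limit from vanishing.\<close>

definition avg :: "'g::ab_group_add list \<Rightarrow> ('g \<Rightarrow> 'a::real_vector) \<Rightarrow> 'g \<Rightarrow> 'a" where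
  "avg A f x = (\<Sum>a\<leftarrow>A. f (x + a)) /\<^sub>R real (length A)"

text \<open>Lists rather than finite sets: repeated sums must count with multiplicity, so that
  averaging over the sumset is exactly the composite of two averages.\<close>

definition sumset_list :: "'g::ab_group_add list \<Rightarrow> 'g list \<Rightarrow> 'g list" where
  "sumset_list A B = concat (map (\<lambda>a. map (\<lambda>b. a + b) B) A)"

lemma length_sumset_list: "length (sumset_list A B) = length A * length B"
  by (induction A) (auto simp: sumset_list_def)

lemma sumset_list_Nil_iff: "sumset_list A B = [] \<longleftrightarrow> A = [] \<or> B = []"
  by (auto simp: sumset_list_def concat_eq_Nil_conv)

lemma sum_list_scaleR_right: "(\<Sum>a\<leftarrow>A. c *\<^sub>R f a) = c *\<^sub>R (\<Sum>a\<leftarrow>A. f a)"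
  for f :: "'b \<Rightarrow> 'a::real_vector"
  by (induction A) (auto simp: scaleR_add_right)

lemma avg_sumset_list: "avg (sumset_list A B) f = avg A (avg B f)"
proof
  fix x
  have "(\<Sum>c\<leftarrow>sumset_list A B. f (x + c)) = (\<Sum>a\<leftarrow>A. \<Sum>b\<leftarrow>B. f (x + a + b))"
    by (induction A) (auto simp: sumset_list_def o_def add.assoc)
  then show "avg (sumset_list A B) f x = avg A (avg B f) x"
    by (simp add: avg_def length_sumset_list sum_list_scaleR_right)
qed

text \<open>Commutativity of the group enters here. It lets two families of translates be compared
  through their common refinement, which makes the mean unique.\<close>

lemma avg_commute: "avg A (avg B f) = avg B (avg A f)"
proof
  fix x
  have "(\<Sum>a\<leftarrow>A. \<Sum>b\<leftarrow>B. f (x + a + b)) = (\<Sum>b\<leftarrow>B. \<Sum>a\<leftarrow>A. f (x + b + a))"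
  proof (induction A)
    case (Cons a A)
    then show ?case by (simp add: sum_list_addf add.assoc add.commute add.left_commute)
  qed simp
  then show "avg A (avg B f) x = avg B (avg A f) x"
    by (simp add: avg_def sum_list_scaleR_right mult.commute)
qed

lemma avg_add: "avg A (\<lambda>x. f x + g x) x = avg A f x + avg A g x"
  by (simp add: avg_def sum_list_addf scaleR_add_right)

lemma avg_const: "A \<noteq> [] \<Longrightarrow> avg A (\<lambda>_. c) x = c"
proof -
  assume "A \<noteq> []"
  moreover have "(\<Sum>a\<leftarrow>A. c) = real (length A) *\<^sub>R c"
    by (induction A) (auto simp: scaleR_add_left)
  ultimately show ?thesis by (simp add: avg_def)
qed

lemma avg_linear: "linear l \<Longrightarrow> avg A (\<lambda>x. l (f x)) x = l (avg A f x)"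
proof -
  assume l: "linear l"
  have "(\<Sum>a\<leftarrow>A. l (f (x + a))) = l (\<Sum>a\<leftarrow>A. f (x + a))"
    by (induction A) (auto simp: linear_0[OF l] linear_add[OF l])
  then show ?thesis by (simp add: avg_def linear_scale[OF l])
qed

lemma avg_diff: "avg A (\<lambda>x. f x - g x) x = avg A f x - avg A g x"
proof -
  have "(\<Sum>a\<leftarrow>A. f (x + a) - g (x + a)) = (\<Sum>a\<leftarrow>A. f (x + a)) - (\<Sum>a\<leftarrow>A. g (x + a))"
    by (induction A) auto
  then show ?thesis by (simp add: avg_def scaleR_diff_right)
qed

lemma avg_shift: "avg A (\<lambda>x. f (x + s)) x = avg A f (x + s)"
  by (simp add: avg_def add.assoc add.commute add.left_commute)

lemma norm_avg_le:
  fixes f :: "'g::ab_group_add \<Rightarrow> 'a::real_normed_vector"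
  assumes "A \<noteq> []" "\<And>a. a \<in> set A \<Longrightarrow> norm (f (x + a)) \<le> B"
  shows "norm (avg A f x) \<le> B"
proof -
  have "norm (\<Sum>a\<leftarrow>A. f (x + a)) \<le> real (length A) * B"
    using assms(2)
  proof (induction A)
    case (Cons a A)
    have "norm (f (x + a) + (\<Sum>a\<leftarrow>A. f (x + a))) \<le> B + real (length A) * B"
      using Cons by (intro norm_triangle_le add_mono) auto
    then show ?case by (simp add: distrib_right)
  qed simp
  then show ?thesis using assms(1) by (simp add: avg_def field_simps)
qed

lemma norm_avg_diff_le:
  fixes f :: "'g::ab_group_add \<Rightarrow> 'a::real_normed_vector"
  assumes "A \<noteq> []" "\<And>x. norm (f x - c) \<le> B"
  shows "norm (avg A f x - c) \<le> B"
proof -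
  have "norm (avg A (\<lambda>x. f x - c) x) \<le> B" using assms by (intro norm_avg_le) auto
  then show ?thesis using assms(1) by (simp add: avg_diff avg_const)
qed

lemma avg_ge:
  fixes f :: "'g::ab_group_add \<Rightarrow> real"
  assumes "A \<noteq> []" "\<And>x. b \<le> f x"
  shows "b \<le> avg A f x"
proof -
  have "real (length A) * b \<le> (\<Sum>a\<leftarrow>A. f (x + a))"
    by (induction A) (use assms(2) in \<open>auto simp: distrib_right intro: add_mono\<close>)
  then show ?thesis using assms(1) by (simp add: avg_def field_simps)
qed

lemma avg_le_if_one_small:
  fixes f :: "'g::ab_group_add \<Rightarrow> real"
  assumes "\<And>x. f x \<le> B" "a \<in> set A" "f (x + a) \<le> B - d"
  shows "avg A f x \<le> B - d / real (length A)"
proof -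
  obtain xs ys where A: "A = xs @ a # ys" using assms(2) by (meson split_list)
  have le: "(\<Sum>a\<leftarrow>zs. f (x + a)) \<le> real (length zs) * B" for zs
    by (induction zs) (use assms(1) in \<open>auto simp: distrib_right intro: add_mono\<close>)
  have "(\<Sum>a\<leftarrow>A. f (x + a)) \<le> real (length A) * B - d"
    using le[of xs] le[of ys] assms(3) by (simp add: A algebra_simps)
  moreover have "length A > 0" using A by simp
  ultimately show ?thesis by (simp add: avg_def field_simps)
qed

text \<open>The minimum of \<open>f\<close> is nearly attained on a translate of \<open>V\<close>, and among the translates of
  every point by \<open>L\<close> there is one hitting it; this is why averaging over \<open>L\<close> contracts the
  oscillation by a factor depending on \<open>L\<close> only.\<close>
lemma oscillation_avg_cover:
  fixes f :: "'g::ab_group_add \<Rightarrow> real"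
  assumes L: "\<And>z. \<exists>a\<in>set L. z + a \<in> V"
    and V: "\<And>x y. x - y \<in> V \<Longrightarrow> \<bar>f x - f y\<bar> \<le> d / 4"
    and d: "d > 0" and osc: "\<And>x y. f x - f y \<le> d"
  shows "avg L f x - avg L f y \<le> d * (1 - 1 / (2 * real (length L)))"
proof -
  define m where "m = Inf (range f)"
  have bdd: "bdd_below (range f)"
    using osc[of x] by (intro bdd_belowI[of _ "f x - d"]) (auto simp: algebra_simps)
  have m: "m \<le> f z" for z unfolding m_def using bdd by (intro cInf_lower) auto
  have up: "f z \<le> m + d" for z
  proof -
    have "f z - d \<le> m" unfolding m_def using osc[of z] by (intro cInf_greatest) (auto simp: algebra_simps)
    then show ?thesis by simp
  qed
  have "\<exists>p. f p < m + d / 4"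
    using cInf_lessD[of "range f" "m + d / 4"] d by (auto simp: m_def)
  then obtain p where p: "f p < m + d / 4" by blast
  \<comment> \<open>Since \<open>x - p + a\<close> equals \<open>(x + a) - p\<close>, the value at
    \<open>x + a\<close> is within \<open>d / 4\<close> of \<open>f p\<close>, hence below
    \<open>m + d / 2\<close>: one of the \<open>length L\<close> terms of the average gains half of
    the oscillation.\<close>
  obtain a where a: "a \<in> set L" "x - p + a \<in> V" using L by blast
  have "f (x + a) \<le> (m + d) - d / 2"
    using V[of "x + a" p] a(2) p by (simp add: algebra_simps abs_if split: if_splits)
  then have "avg L f x \<le> m + d - (d / 2) / real (length L)"
    using avg_le_if_one_small[of f "m + d" a L] up a(1) by blast
  moreover have "L \<noteq> []" using a by auto
  then have "m \<le> avg L f y" by (intro avg_ge m)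
  ultimately show ?thesis by (simp add: algebra_simps)
qed

subsection \<open>Uniformly equicontinuous families\<close>

text \<open>Neighbourhoods of \<open>0\<close> serve as moduli of uniform continuity. Whole families
  are needed because one averaging list must work for all translates of an integrand at
  once.\<close>

definition equicont :: "('g::topological_ab_group_add \<Rightarrow> 'a::real_normed_vector) set \<Rightarrow> bool" where
  "equicont Fs \<longleftrightarrow> (\<exists>B. \<forall>f\<in>Fs. \<forall>x. norm (f x) \<le> B) \<and>
     (\<forall>e>0. \<exists>V. open V \<and> 0 \<in> V \<and> (\<forall>f\<in>Fs. \<forall>x y. x - y \<in> V \<longrightarrow> norm (f x - f y) \<le> e))"

lemma equicont_subset: "equicont Fs \<Longrightarrow> Gs \<subseteq> Fs \<Longrightarrow> equicont Gs"
  unfolding equicont_def by (meson subsetD)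

lemma equicont_Un:
  assumes "equicont Fs" "equicont Gs" shows "equicont (Fs \<union> Gs)"
  unfolding equicont_def
proof (intro conjI allI impI)
  obtain B C where "\<forall>f\<in>Fs. \<forall>x. norm (f x) \<le> B" "\<forall>f\<in>Gs. \<forall>x. norm (f x) \<le> C"
    using assms unfolding equicont_def by blast
  then show "\<exists>B. \<forall>f\<in>Fs \<union> Gs. \<forall>x. norm (f x) \<le> B"
    by (intro exI[of _ "max B C"]) (auto simp: le_max_iff_disj)
next
  fix e :: real assume "e > 0"
  then obtain V W where "open V \<and> 0 \<in> V \<and> (\<forall>f\<in>Fs. \<forall>x y. x - y \<in> V \<longrightarrow> norm (f x - f y) \<le> e)"
    "open W \<and> 0 \<in> W \<and> (\<forall>f\<in>Gs. \<forall>x y. x - y \<in> W \<longrightarrow> norm (f x - f y) \<le> e)"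
    using assms unfolding equicont_def by meson
  then show "\<exists>V. open V \<and> 0 \<in> V \<and> (\<forall>f\<in>Fs \<union> Gs. \<forall>x y. x - y \<in> V \<longrightarrow> norm (f x - f y) \<le> e)"
    by (intro exI[of _ "V \<inter> W"]) auto
qed

lemma equicont_linear_image:
  fixes Fs :: "('g::topological_ab_group_add \<Rightarrow> 'a::real_normed_vector) set" and l :: "'a \<Rightarrow> 'b::real_normed_vector"
  assumes "equicont Fs" "\<And>z. norm (l z) \<le> norm z" "linear l"
  shows "equicont ((\<lambda>f x. l (f x)) ` Fs)"
  unfolding equicont_def
proof (intro conjI allI impI)
  obtain B where B: "\<forall>f\<in>Fs. \<forall>x. norm (f x) \<le> B"
    using assms unfolding equicont_def by blast
  then show "\<exists>B. \<forall>f\<in>(\<lambda>f x. l (f x)) ` Fs. \<forall>x. norm (f x) \<le> B"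
    using assms(2) by (intro exI[of _ B]) (auto intro: order_trans)
next
  fix e :: real assume "e > 0"
  then obtain V where "open V \<and> 0 \<in> V \<and> (\<forall>f\<in>Fs. \<forall>x y. x - y \<in> V \<longrightarrow> norm (f x - f y) \<le> e)"
    using assms unfolding equicont_def by meson
  moreover have "norm (l (f x) - l (f y)) \<le> e" if "norm (f x - f y) \<le> e" for f :: "'g \<Rightarrow> 'a" and x y
    using that assms(2)[of "f x - f y"] by (simp add: linear_diff[OF assms(3)])
  ultimately show "\<exists>V. open V \<and> 0 \<in> V \<and> (\<forall>f\<in>(\<lambda>f x. l (f x)) ` Fs. \<forall>x y. x - y \<in> V \<longrightarrow> norm (f x - f y) \<le> e)"
    by (intro exI[of _ V]) auto
qed

lemma equicont_continuous:
  fixes f :: "'g::topological_ab_group_add \<Rightarrow> 'a::real_normed_vector"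
  assumes "equicont Fs" "f \<in> Fs"
  shows "continuous_on UNIV f"
proof -
  have "(f \<longlongrightarrow> f y) (at y)" for y
  proof (rule tendstoI)
    fix e :: real assume "e > 0"
    then obtain V where V: "open V" "0 \<in> V" "\<And>x y. x - y \<in> V \<Longrightarrow> norm (f x - f y) \<le> e / 2"
      using assms unfolding equicont_def by (meson half_gt_zero)
    have "open ((\<lambda>x. x - y) -` V)"
      by (intro open_vimage V continuous_intros)
    moreover have "y \<in> (\<lambda>x. x - y) -` V" using V by simp
    moreover have "\<forall>x\<in>(\<lambda>x. x - y) -` V. dist (f x) (f y) < e"
      using V(3) \<open>e > 0\<close> by (fastforce simp: dist_norm)
    ultimately show "\<forall>\<^sub>F x in at y. dist (f x) (f y) < e"
      unfolding eventually_at_topological by blast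
  qed
  then show ?thesis by (simp add: continuous_on_def)
qed

locale compact_ab_group =
  fixes T :: "'g::topological_ab_group_add itself"
  assumes compact_UNIV: "compact (UNIV :: 'g set)"
begin

lemma finite_translate_cover:
  fixes V :: "'g set"
  assumes "open V" "0 \<in> V"
  obtains L where "L \<noteq> []" "\<And>z. \<exists>a\<in>set L. z + a \<in> V"
proof -
  have "open ((\<lambda>z. z + a) -` V)" for a
    by (intro open_vimage assms continuous_intros)
  moreover have "UNIV \<subseteq> (\<Union>a\<in>UNIV. (\<lambda>z. z + a) -` V)"
  proof
    fix z show "z \<in> (\<Union>a\<in>UNIV. (\<lambda>z. z + a) -` V)"
      using assms(2) by (auto intro!: exI[of _ "- z"])
  qed
  ultimately obtain D where D: "finite D" "UNIV \<subseteq> (\<Union>a\<in>D. (\<lambda>z. z + a) -` V)"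
    by (meson compactE_image[OF compact_UNIV])
  obtain L where "set L = D" using D(1) finite_list by blast
  then show ?thesis using D(2) by (intro that[of L]) auto
qed

text \<open>The tube lemma around \<open>{0} \<times> UNIV\<close>, applied to the open set of pairs
  \<open>(v, x)\<close> where translating by \<open>v\<close> changes \<open>f x\<close> by less
  than \<open>e\<close>.\<close>

lemma uniformly_continuous_translate:
  fixes f :: "'g \<Rightarrow> 'a::real_normed_vector"
  assumes "continuous_on UNIV f" "e > 0"
  obtains V where "open V" "0 \<in> V" "\<And>x y. x - y \<in> V \<Longrightarrow> norm (f x - f y) \<le> e"
proof -
  define W where "W = (\<lambda>(v, x). norm (f (x + v) - f x)) -` {..<e}"
  have cf: "continuous_on UNIV (\<lambda>(v, x). norm (f (x + v) - f x))"
    unfolding case_prod_beta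
    by (intro continuous_intros continuous_on_compose2[OF assms(1)]) auto
  have W: "open W" unfolding W_def by (intro open_vimage cf) auto
  have "{0} \<times> UNIV \<subseteq> W" using assms(2) by (auto simp: W_def)
  from Elementary_Topology.tube_lemma[OF compact_UNIV W this]
  obtain V where "0 \<in> V" "open V" "V \<times> UNIV \<subseteq> W" by blast
  then have "norm (f x - f y) \<le> e" if "x - y \<in> V" for x y
    using that by (auto simp: W_def dest!: subsetD[of _ _ "(x - y, y)"])
  then show ?thesis using that \<open>0 \<in> V\<close> \<open>open V\<close> by blast
qed

lemma bounded_continuous:
  fixes f :: "'g \<Rightarrow> 'a::real_normed_vector"
  assumes "continuous_on UNIV f"
  obtains B where "B \<ge> 0" "\<And>x. norm (f x) \<le> B"
proof -
  have "bounded (range f)"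
    using compact_continuous_image[OF assms compact_UNIV] by (rule compact_imp_bounded)
  then obtain B where "\<And>x. norm (f x) \<le> B" by (auto simp: bounded_iff)
  then show ?thesis using that[of B] norm_ge_zero order_trans by blast
qed

lemma equicont_singleton: "continuous_on UNIV f \<Longrightarrow> equicont {f :: 'g \<Rightarrow> 'a::real_normed_vector}"
  unfolding equicont_def Ball_def singleton_iff
proof (intro conjI allI impI)
  assume f: "continuous_on UNIV f"
  show "\<exists>B. \<forall>g. g = f \<longrightarrow> (\<forall>x. norm (g x) \<le> B)"
    using bounded_continuous[OF f] by metis
  fix e :: real assume "e > 0"
  from uniformly_continuous_translate[OF f this] obtain V where
    "open V" "0 \<in> V" "\<And>x y. x - y \<in> V \<Longrightarrow> norm (f x - f y) \<le> e" by blast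
  then show "\<exists>V. open V \<and> 0 \<in> V \<and> (\<forall>g. g = f \<longrightarrow> (\<forall>x y. x - y \<in> V \<longrightarrow> norm (g x - g y) \<le> e))"
    by blast
qed

text \<open>Averaging preserves the modulus of continuity, so the same \<open>V\<close> and
  \<open>L\<close> serve at every iteration and the oscillation shrinks by the fixed factor
  \<open>r\<close>, for the whole family simultaneously.\<close>

lemma oscillation_small_real:
  fixes Fs :: "('g \<Rightarrow> real) set"
  assumes "equicont Fs" "e > 0"
  obtains A where "A \<noteq> []" "\<And>f x y. f \<in> Fs \<Longrightarrow> avg A f x - avg A f y \<le> e"
proof -
  obtain B where B: "\<And>f x. f \<in> Fs \<Longrightarrow> \<bar>f x\<bar> \<le> B" and B0: "B \<ge> 0"
  proof -
    obtain B where "\<forall>f\<in>Fs. \<forall>x. norm (f x) \<le> B" using assms unfolding equicont_def by blast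
    then show ?thesis using that[of "max B 0"] by (auto simp: le_max_iff_disj)
  qed
  obtain V where V: "open V" "0 \<in> V" "\<And>f x y. f \<in> Fs \<Longrightarrow> x - y \<in> V \<Longrightarrow> norm (f x - f y) \<le> e / 4"
    using assms unfolding equicont_def by (meson divide_pos_pos zero_less_numeral)
  obtain L where L: "L \<noteq> []" "\<And>z. \<exists>a\<in>set L. z + a \<in> V"
    using finite_translate_cover V by blast
  define r where "r = 1 - 1 / (2 * real (length L))"
  have "1 \<le> real (length L)" using L(1) by (cases L) auto
  then have "2 * real (length L) \<ge> 1" "2 * real (length L) > 0" by auto
  then have r: "0 \<le> r" "r < 1" by (auto simp: r_def)
  have ex: "\<exists>A. A \<noteq> [] \<and> (\<forall>f\<in>Fs. \<forall>x y. avg A f x - avg A f y \<le> max e (2 * B * r ^ k))" for k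
  proof (induction k)
    case 0
    have "f x - f y \<le> 2 * B" if "f \<in> Fs" for f x y
      using B[OF that, of x] B[OF that, of y] by (auto simp: abs_le_iff)
    then show ?case by (intro exI[of _ "[0]"]) (auto simp: avg_def le_max_iff_disj)
  next
    case (Suc k)
    then obtain A where A: "A \<noteq> []" "\<forall>f\<in>Fs. \<forall>x y. avg A f x - avg A f y \<le> max e (2 * B * r ^ k)"
      by blast
    have "avg (sumset_list L A) f x - avg (sumset_list L A) f y \<le> max e (2 * B * r ^ Suc k)"
      if f: "f \<in> Fs" for f x y
    proof -
      \<comment> \<open>The bound is not allowed below \<open>e\<close>: \<open>V\<close> controls
        differences only up to \<open>e / 4\<close>, which is at most \<open>d / 4\<close> just when
        \<open>d \<ge> e\<close>. Hence the maximum in the induction claim.\<close>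
      define d where "d = max e (2 * B * r ^ k)"
      have d: "d > 0" "d \<ge> e" using assms(2) by (auto simp: d_def)
      have "\<bar>avg A f x - avg A f y\<bar> \<le> d / 4" if "x - y \<in> V" for x y
      proof -
        have "norm (avg A (\<lambda>z. f (z + x) - f (z + y)) 0) \<le> e / 4"
          using V(3)[OF f] A(1) that by (intro norm_avg_le) (auto simp: algebra_simps)
        then show ?thesis using d by (simp add: avg_diff avg_shift)
      qed
      then have "avg L (avg A f) x - avg L (avg A f) y \<le> d * r"
        unfolding r_def using L A(2) f d
        by (intro oscillation_avg_cover[where V = V]) (auto simp: d_def)
      also have "\<dots> \<le> max e (2 * B * r ^ Suc k)"
      proof (cases "e \<le> 2 * B * r ^ k")
        case False
        then have "d * r \<le> e" using r assms(2) by (simp add: d_def mult_left_le)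
        then show ?thesis by simp
      qed (simp add: d_def mult_ac)
      finally show ?thesis by (simp add: avg_sumset_list)
    qed
    then show ?case using A(1) L(1) by (intro exI[of _ "sumset_list L A"]) (auto simp: sumset_list_Nil_iff)
  qed
  have "(\<lambda>k. 2 * B * r ^ k) \<longlonglongrightarrow> 2 * B * 0"
    using r by (intro tendsto_intros LIMSEQ_realpow_zero) auto
  then have "\<forall>\<^sub>F k in sequentially. 2 * B * r ^ k < e"
    using assms(2) by (intro order_tendstoD) auto
  then obtain k where "2 * B * r ^ k < e" by (auto simp: eventually_sequentially)
  then show ?thesis using ex[of k] that by (auto simp: max_def)
qed

lemma oscillation_small:
  fixes Fs :: "('g \<Rightarrow> complex) set"
  assumes "equicont Fs" "e > 0"
  obtains A where "A \<noteq> []" "\<And>f x y. f \<in> Fs \<Longrightarrow> cmod (avg A f x - avg A f y) \<le> e"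
proof -
  have lin: "linear Re" "linear Im"
    by (auto intro: linearI)
  have "equicont (((\<lambda>f x. Re (f x)) ` Fs) \<union> ((\<lambda>f x. Im (f x)) ` Fs))"
    using assms(1) lin by (intro equicont_Un equicont_linear_image) (auto simp: abs_Re_le_cmod abs_Im_le_cmod)
  from oscillation_small_real[OF this, of "e / 2"] assms(2)
  obtain A where A: "A \<noteq> []" "\<And>f x y. f \<in> ((\<lambda>f x. Re (f x)) ` Fs) \<union> ((\<lambda>f x. Im (f x)) ` Fs)
    \<Longrightarrow> avg A f x - avg A f y \<le> e / 2" by auto
  have "cmod (avg A f x - avg A f y) \<le> e" if "f \<in> Fs" for f x y
  proof -
    have "\<bar>Re (avg A f x - avg A f y)\<bar> \<le> e / 2" "\<bar>Im (avg A f x - avg A f y)\<bar> \<le> e / 2"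
      using A(2)[of "\<lambda>x. Re (f x)" x y] A(2)[of "\<lambda>x. Re (f x)" y x]
        A(2)[of "\<lambda>x. Im (f x)" x y] A(2)[of "\<lambda>x. Im (f x)" y x] that
      unfolding abs_le_iff by (simp_all add: avg_linear[OF lin(1)] avg_linear[OF lin(2)])
    then show ?thesis using cmod_le[of "avg A f x - avg A f y"] by linarith
  qed
  then show ?thesis using that A(1) by blast
qed

end

subsection \<open>The invariant mean of a continuous function\<close>

text \<open>Von Neumann's description of the integral against normalised Haar measure: the constant
  uniformly approximated by averages of translates.\<close>

definition is_mean :: "('g::ab_group_add \<Rightarrow> complex) \<Rightarrow> complex \<Rightarrow> bool" where
  "is_mean f c \<longleftrightarrow> (\<forall>e>0. \<exists>A. A \<noteq> [] \<and> (\<forall>x. cmod (avg A f x - c) \<le> e))"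

definition mean :: "('g::ab_group_add \<Rightarrow> complex) \<Rightarrow> complex" where
  "mean f = (THE c. is_mean f c)"

text \<open>Averaging again keeps an approximation of a constant intact, so \<open>c\<close> and
  \<open>c'\<close> are both close to the same function \<open>avg A (avg B f)\<close>.\<close>

lemma avg_approx_unique:
  fixes f :: "'g::ab_group_add \<Rightarrow> complex"
  assumes "A \<noteq> []" "\<And>x. cmod (avg A f x - c) \<le> e" "B \<noteq> []" "\<And>x. cmod (avg B f x - c') \<le> e'"
  shows "cmod (c - c') \<le> e + e'"
proof -
  have "cmod (avg B (avg A f) 0 - c) \<le> e" by (intro norm_avg_diff_le assms)
  moreover have "cmod (avg A (avg B f) 0 - c') \<le> e'" by (intro norm_avg_diff_le assms)
  ultimately show ?thesis
    using norm_triangle_ineq4[of "avg A (avg B f) 0 - c'" "avg A (avg B f) 0 - c"]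
    by (simp add: avg_commute[of B A])
qed

lemma is_mean_unique: "is_mean f c \<Longrightarrow> is_mean f c' \<Longrightarrow> c = c'"
proof (rule ccontr)
  assume a: "is_mean f c" "is_mean f c'" "c \<noteq> c'"
  define e where "e = cmod (c - c') / 3"
  have "e > 0" using a by (simp add: e_def)
  then obtain A B where "A \<noteq> []" "\<And>x. cmod (avg A f x - c) \<le> e" "B \<noteq> []" "\<And>x. cmod (avg B f x - c') \<le> e"
    using a unfolding is_mean_def by meson
  from avg_approx_unique[OF this] show False using \<open>e > 0\<close> by (simp add: e_def)
qed

lemma mean_eqI: "is_mean f c \<Longrightarrow> mean f = c"
  unfolding mean_def using is_mean_unique by blast

context compact_ab_group
begin

text \<open>Averages with shrinking oscillation form a Cauchy sequence, since any two of them are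
  comparable by \<open>avg_approx_unique\<close>; this gives the mean of each member. The list
  returned depends only on the family, not on the member.\<close>

lemma mean_uniform:
  fixes Fs :: "('g \<Rightarrow> complex) set"
  assumes "equicont Fs" "e > 0"
  obtains A where "A \<noteq> []" "\<And>f x. f \<in> Fs \<Longrightarrow> cmod (avg A f x - mean f) \<le> e"
proof -
  have "\<exists>A. A \<noteq> [] \<and> (\<forall>f x y. f \<in> Fs \<longrightarrow> cmod (avg A f x - avg A f y) \<le> inverse (real (Suc k)))" for k
    using oscillation_small[OF assms(1), of "inverse (real (Suc k))"] by (metis inverse_positive_iff_positive of_nat_0_less_iff zero_less_Suc)
  then obtain A where A: "\<And>k. A k \<noteq> []"
    "\<And>k f x y. f \<in> Fs \<Longrightarrow> cmod (avg (A k) f x - avg (A k) f y) \<le> inverse (real (Suc k))"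
    by metis
  have ex: "is_mean f (mean f)" if f: "f \<in> Fs" for f
  proof -
    define c where "c k = avg (A k) f 0" for k
    have Acs: "cmod (avg (A k) f x - c k) \<le> inverse (real (Suc k))" for k x
      using A(2) f by (simp add: c_def)
    have diff: "cmod (c k - c j) \<le> inverse (real (Suc k)) + inverse (real (Suc j))" for k j
      using avg_approx_unique[OF A(1) Acs A(1) Acs] .
    have inv0: "(\<lambda>k. inverse (real (Suc k))) \<longlonglongrightarrow> 0" by (rule LIMSEQ_inverse_real_of_nat)
    have "Cauchy c"
    proof (rule metric_CauchyI)
      fix e :: real assume "e > 0"
      then have "\<forall>\<^sub>F k in sequentially. inverse (real (Suc k)) < e / 2"
        by (intro order_tendstoD[OF inv0]) auto
      then obtain M where M: "\<And>k. k \<ge> M \<Longrightarrow> inverse (real (Suc k)) < e / 2"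
        by (auto simp: eventually_sequentially)
      have "dist (c m) (c n) < e" if "m \<ge> M" "n \<ge> M" for m n
        using diff[of m n] M[OF that(1)] M[OF that(2)] unfolding dist_norm by linarith
      then show "\<exists>M. \<forall>m\<ge>M. \<forall>n\<ge>M. dist (c m) (c n) < e" by blast
    qed
    then obtain l where l: "c \<longlonglongrightarrow> l" using Cauchy_convergent convergent_def by blast
    have "is_mean f l" unfolding is_mean_def
    proof (intro allI impI)
      fix e :: real assume "e > 0"
      then have "\<forall>\<^sub>F k in sequentially. inverse (real (Suc k)) < e / 2 \<and> dist (c k) l < e / 2"
        by (intro eventually_conj order_tendstoD[OF inv0] tendstoD[OF l]) auto
      then obtain k where k: "inverse (real (Suc k)) < e / 2" "dist (c k) l < e / 2"
        by (auto simp: eventually_sequentially)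
      have "cmod (avg (A k) f x - l) \<le> e" for x
        using norm_triangle_ineq[of "avg (A k) f x - c k" "c k - l"] k Acs[of k x]
        by (simp add: dist_norm)
      then show "\<exists>A. A \<noteq> [] \<and> (\<forall>x. cmod (avg A f x - l) \<le> e)" using A(1) by blast
    qed
    then show ?thesis using mean_eqI by metis
  qed
  obtain B where B: "B \<noteq> []" "\<And>f x y. f \<in> Fs \<Longrightarrow> cmod (avg B f x - avg B f y) \<le> e / 2"
    using oscillation_small[OF assms(1), of "e / 2"] assms(2) by auto
  have "cmod (avg B f x - mean f) \<le> e" if f: "f \<in> Fs" for f x
  proof -
    \<comment> \<open>\<open>B\<close> approximates the constant \<open>avg B f x\<close> within
      \<open>e / 2\<close>, and some list approximates \<open>mean f\<close> within
      \<open>d\<close>; uniqueness compares the two constants.\<close>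
    have "cmod (avg B f x - mean f) \<le> e / 2 + d" if "d > 0" for d
      using ex[OF f] that avg_approx_unique[OF B(1) B(2)[OF f, of _ x]]
      unfolding is_mean_def by meson
    from this[of "e / 2"] show ?thesis using assms(2) by simp
  qed
  then show ?thesis using that B(1) by blast
qed

lemma is_mean_mean:
  fixes f :: "'g \<Rightarrow> complex"
  assumes "continuous_on UNIV f" shows "is_mean f (mean f)"
  unfolding is_mean_def
  using mean_uniform[OF equicont_singleton[OF assms]] by (metis insertI1)

lemma mean_add:
  fixes f g :: "'g \<Rightarrow> complex"
  assumes "continuous_on UNIV f" "continuous_on UNIV g"
  shows "mean (\<lambda>x. f x + g x) = mean f + mean g"
proof (rule mean_eqI, unfold is_mean_def, intro allI impI)
  fix e :: real assume "e > 0"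
  have "equicont {f, g}"
    using equicont_Un[OF equicont_singleton[OF assms(1)] equicont_singleton[OF assms(2)]] by (simp add: insert_commute)
  from mean_uniform[OF this, of "e / 2"] \<open>e > 0\<close>
  obtain A where A: "A \<noteq> []" "\<And>x. cmod (avg A f x - mean f) \<le> e / 2" "\<And>x. cmod (avg A g x - mean g) \<le> e / 2"
    by (metis half_gt_zero insertCI)
  have "cmod (avg A (\<lambda>x. f x + g x) x - (mean f + mean g)) \<le> e" for x
    using norm_triangle_mono[OF A(2)[of x] A(3)[of x]] by (simp add: avg_add algebra_simps)
  then show "\<exists>A. A \<noteq> [] \<and> (\<forall>x. cmod (avg A (\<lambda>x. f x + g x) x - (mean f + mean g)) \<le> e)" using A by blast
qed

text \<open>Real linearity is enough here, so complex multiples and conjugation are both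
  instances.\<close>

lemma mean_linear:
  fixes f :: "'g \<Rightarrow> complex"
  assumes "continuous_on UNIV f" and l: "bounded_linear l"
  shows "mean (\<lambda>x. l (f x)) = l (mean f)"
proof (rule mean_eqI, unfold is_mean_def, intro allI impI)
  fix e :: real assume "e > 0"
  obtain K where K: "K > 0" "\<And>z. norm (l z) \<le> norm z * K"
    using bounded_linear.pos_bounded[OF l] by blast
  obtain A where A: "A \<noteq> []" "\<And>x. cmod (avg A f x - mean f) \<le> e / K"
    using is_mean_mean[OF assms(1)] \<open>e > 0\<close> K unfolding is_mean_def by (meson divide_pos_pos)
  have "cmod (avg A (\<lambda>x. l (f x)) x - l (mean f)) \<le> e" for x
  proof -
    have "cmod (l (avg A f x - mean f)) \<le> (e / K) * K"
      using K A by (meson less_imp_le mult_right_mono order_trans)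
    then show ?thesis using K
      by (simp add: avg_linear[OF bounded_linear.linear[OF l]] linear_diff[OF bounded_linear.linear[OF l]])
  qed
  then show "\<exists>A. A \<noteq> [] \<and> (\<forall>x. cmod (avg A (\<lambda>x. l (f x)) x - l (mean f)) \<le> e)" using A by blast
qed

lemma mean_cmult:
  fixes f :: "'g \<Rightarrow> complex"
  shows "continuous_on UNIV f \<Longrightarrow> mean (\<lambda>x. c * f x) = c * mean f"
  by (intro mean_linear bounded_linear_mult_right)

lemma mean_cnj:
  fixes f :: "'g \<Rightarrow> complex"
  shows "continuous_on UNIV f \<Longrightarrow> mean (\<lambda>x. cnj (f x)) = cnj (mean f)"
  by (intro mean_linear bounded_linear_cnj)

lemma mean_diff:
  fixes f g :: "'g \<Rightarrow> complex"
  assumes "continuous_on UNIV f" "continuous_on UNIV g"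
  shows "mean (\<lambda>x. f x - g x) = mean f - mean g"
proof -
  have "continuous_on UNIV (\<lambda>x. (-1) * g x)" by (intro continuous_intros assms)
  from mean_add[OF assms(1) this] mean_cmult[OF assms(2), of "-1"] show ?thesis by simp
qed

lemma mean_const: "mean (\<lambda>_::'g. c) = c"
  by (rule mean_eqI) (auto simp: is_mean_def avg_const intro!: exI[of _ "[0]"])

lemma mean_shift:
  fixes f :: "'g \<Rightarrow> complex"
  assumes "continuous_on UNIV f"
  shows "mean (\<lambda>x. f (x + s)) = mean f"
proof (rule mean_eqI, unfold is_mean_def, intro allI impI)
  fix e :: real assume "e > 0"
  then obtain A where "A \<noteq> []" "\<And>x. cmod (avg A f x - mean f) \<le> e"
    using is_mean_mean[OF assms] unfolding is_mean_def by blast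
  then show "\<exists>A. A \<noteq> [] \<and> (\<forall>x. cmod (avg A (\<lambda>x. f (x + s)) x - mean f) \<le> e)"
    by (auto simp: avg_shift)
qed

lemma mean_norm_le:
  fixes f :: "'g \<Rightarrow> complex"
  assumes f: "continuous_on UNIV f" and B: "\<And>x. cmod (f x) \<le> B"
  shows "cmod (mean f) \<le> B"
proof (rule field_le_epsilon)
  fix e :: real assume "e > 0"
  then obtain A where A: "A \<noteq> []" "cmod (avg A f 0 - mean f) \<le> e"
    using is_mean_mean[OF f] unfolding is_mean_def by meson
  moreover have "cmod (avg A f 0) \<le> B" using A B by (intro norm_avg_le) auto
  ultimately show "cmod (mean f) \<le> B + e"
    using norm_triangle_ineq4[of "avg A f 0" "avg A f 0 - mean f"] by simp
qed

lemma mean_ge: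
  fixes f :: "'g \<Rightarrow> complex"
  assumes f: "continuous_on UNIV f" and b: "\<And>x. b \<le> Re (f x)"
  shows "b \<le> Re (mean f)"
proof (rule field_le_epsilon)
  fix e :: real assume "e > 0"
  then obtain A where A: "A \<noteq> []" "cmod (avg A f 0 - mean f) \<le> e"
    using is_mean_mean[OF f] unfolding is_mean_def by meson
  have lin: "linear Re" by (auto intro: linearI)
  have "b \<le> Re (avg A f 0)" using avg_ge[OF A(1), of b "\<lambda>x. Re (f x)" 0] b
    by (simp add: avg_linear[OF lin])
  moreover have "Re (avg A f 0) - Re (mean f) \<le> e" using A(2) complex_Re_le_cmod[of "avg A f 0 - mean f"] by simp
  ultimately show "b \<le> Re (mean f) + e" by simp
qed

lemma mean_sum_list:
  fixes f :: "'b \<Rightarrow> 'g \<Rightarrow> complex"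
  assumes "\<And>a. continuous_on UNIV (f a)"
  shows "mean (\<lambda>x. \<Sum>a\<leftarrow>A. f a x) = (\<Sum>a\<leftarrow>A. mean (f a)) \<and> continuous_on UNIV (\<lambda>x. \<Sum>a\<leftarrow>A. f a x)"
proof (induction A)
  case (Cons a A)
  then have "continuous_on UNIV (\<lambda>x. f a x + (\<Sum>a\<leftarrow>A. f a x))"
    by (intro continuous_intros assms) simp
  then show ?case using Cons mean_add[OF assms, of "\<lambda>x. \<Sum>a\<leftarrow>A. f a x" a] by simp
qed (simp add: mean_const)

text \<open>Here \<open>m\<close> plays the role of a positive lower bound for the Haar measure of
  \<open>V\<close>: if \<open>n\<close> translates of \<open>V\<close> cover the group,
  \<open>1/n\<close> works. It does not depend on \<open>f\<close>, which matters when the bound is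
  applied to all powers of a function.\<close>

lemma mean_lower_bound:
  fixes V :: "'g set"
  assumes "open V" "p \<in> V"
  obtains m where "m > 0" "\<And>f c. continuous_on UNIV f \<Longrightarrow> (\<And>x. 0 \<le> Re (f x)) \<Longrightarrow> c \<ge> 0 \<Longrightarrow>
    (\<And>x. x \<in> V \<Longrightarrow> c \<le> Re (f x)) \<Longrightarrow> m * c \<le> Re (mean f)"
proof -
  have "open ((\<lambda>x. x + p) -` V)" by (intro open_vimage assms continuous_intros)
  moreover have "0 \<in> (\<lambda>x. x + p) -` V" using assms by simp
  ultimately obtain L where L: "L \<noteq> []" "\<And>z. \<exists>a\<in>set L. z + a \<in> (\<lambda>x. x + p) -` V"
    using finite_translate_cover by blast
  have "inverse (real (length L)) * c \<le> Re (mean f)"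
    if f: "continuous_on UNIV f" "\<And>x. 0 \<le> Re (f x)" "c \<ge> 0" "\<And>x. x \<in> V \<Longrightarrow> c \<le> Re (f x)" for f c
  proof -
    have cs: "continuous_on UNIV (\<lambda>x. f (x + a))" for a
      by (intro continuous_on_compose2[OF f(1)] continuous_intros) auto
    have "c \<le> Re (\<Sum>a\<leftarrow>L. f (x + a))" for x
    proof -
      obtain a where a: "a \<in> set L" "x - p + a + p \<in> V" using L(2)[of "x - p"] by auto
      then obtain xs ys where Leq: "L = xs @ a # ys" by (meson split_list)
      have nn: "0 \<le> Re (\<Sum>a\<leftarrow>zs. f (x + a))" for zs
        by (induction zs) (use f(2) in auto)
      show ?thesis using nn[of xs] nn[of ys] f(4)[OF a(2)] by (simp add: Leq)
    qed
    then have "c \<le> Re (mean (\<lambda>x. \<Sum>a\<leftarrow>L. f (x + a)))"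
      using mean_sum_list[of "\<lambda>a x. f (x + a)" L] cs by (intro mean_ge) auto
    also have "mean (\<lambda>x. \<Sum>a\<leftarrow>L. f (x + a)) = (\<Sum>a\<leftarrow>L. mean f)"
      using mean_sum_list[of "\<lambda>a x. f (x + a)" L] cs mean_shift[OF f(1)] by simp
    also have "Re \<dots> = real (length L) * Re (mean f)"
      by (induction L) (auto simp: distrib_right)
    finally show ?thesis using L(1) by (simp add: field_simps)
  qed
  then show ?thesis using that[of "inverse (real (length L))"] L(1) by auto
qed

lemma mean_pos:
  fixes f :: "'g \<Rightarrow> complex"
  assumes f: "continuous_on UNIV f" "\<And>x. 0 \<le> Re (f x)" and p: "Re (f p) > 0"
  shows "Re (mean f) > 0"
proof -
  define V where "V = (\<lambda>x. Re (f x)) -` {Re (f p) / 2<..}"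
  have "open V" unfolding V_def using f by (intro open_vimage continuous_intros) auto
  moreover have "p \<in> V" using p by (simp add: V_def)
  ultimately obtain m where m: "m > 0" "\<And>f c. continuous_on UNIV f \<Longrightarrow> (\<And>x. 0 \<le> Re (f x)) \<Longrightarrow> c \<ge> 0 \<Longrightarrow>
    (\<And>x. x \<in> V \<Longrightarrow> c \<le> Re (f x)) \<Longrightarrow> m * c \<le> Re (mean f)"
    using mean_lower_bound by blast
  have "m * (Re (f p) / 2) \<le> Re (mean f)" using f p by (intro m(2)) (auto simp: V_def)
  then show ?thesis using m(1) p by (smt (verit) divide_pos_pos mult_pos_pos)
qed

end

subsection \<open>Positive definite functions\<close>

text \<open>A list of pairs \<open>(c, a)\<close> encodes the finitely supported measure \<open>\<Sum> c \<delta>\<^bsub>-a\<^esub>\<close>, and \<open>act\<close> is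
  convolution with it.\<close>
definition act :: "(complex \<times> 'g::ab_group_add) list \<Rightarrow> ('g \<Rightarrow> complex) \<Rightarrow> 'g \<Rightarrow> complex" where
  "act \<mu> v x = (\<Sum>(c, a)\<leftarrow>\<mu>. c * v (x + a))"

definition adj :: "(complex \<times> 'g::ab_group_add) list \<Rightarrow> (complex \<times> 'g) list" where
  "adj \<mu> = map (\<lambda>(c, a). (cnj c, - a)) \<mu>"

text \<open>Convolution product of the two finitely supported measures; together with the involution
  \<open>adj\<close> it makes the lists behave like a group algebra.\<close>

definition pmul :: "(complex \<times> 'g::ab_group_add) list \<Rightarrow> (complex \<times> 'g) list \<Rightarrow> (complex \<times> 'g) list" where
  "pmul \<mu> \<nu> = concat (map (\<lambda>(c, a). map (\<lambda>(d, b). (c * d, a + b)) \<nu>) \<mu>)"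

text \<open>With \<open>c_i, a_i\<close> the entries of the list, the value at 0 is the usual form:
  the sum over \<open>i, j\<close> of \<open>cnj c_i * c_j * v (a_j - a_i)\<close>.\<close>

definition posdef :: "('g::ab_group_add \<Rightarrow> complex) \<Rightarrow> bool" where
  "posdef v \<longleftrightarrow> (\<forall>\<mu>. act (adj \<mu>) (act \<mu> v) 0 \<in> \<real>\<^sub>\<ge>\<^sub>0)"

lemma act_simps [simp]:
  "act [] v x = 0"
  "act ((c, a) # \<mu>) v x = c * v (x + a) + act \<mu> v x"
  by (simp_all add: act_def)

lemma act_append: "act (\<mu> @ \<nu>) v x = act \<mu> v x + act \<nu> v x"
  by (simp add: act_def)

lemma adj_simps [simp]:
  "adj [] = []"
  "adj ((c, a) # \<mu>) = (cnj c, - a) # adj \<mu>"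
  "adj (\<mu> @ \<nu>) = adj \<mu> @ adj \<nu>"
  by (simp_all add: adj_def)

lemma adj_adj [simp]: "adj (adj \<mu>) = \<mu>"
  by (induction \<mu>) auto

lemma act_lincomb: "act \<mu> (\<lambda>x. c * u x + d * w x) x = c * act \<mu> u x + d * act \<mu> w x"
  by (induction \<mu>) (auto simp: algebra_simps)

lemma act_diff: "act \<mu> (\<lambda>x. u x - w x) x = act \<mu> u x - act \<mu> w x"
  using act_lincomb[of \<mu> 1 u "-1" w x] by simp

lemma act_shift: "act \<mu> (\<lambda>x. v (x + s)) x = act \<mu> v (x + s)"
  by (induction \<mu>) (auto simp: algebra_simps)

lemma act_commute: "act \<mu> (act \<nu> v) = act \<nu> (act \<mu> v)"
proof
  fix x show "act \<mu> (act \<nu> v) x = act \<nu> (act \<mu> v) x"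
  proof (induction \<mu>)
    case Nil
    have "act \<nu> (\<lambda>_. 0) x = 0" using act_lincomb[of \<nu> 0 v 0 v x] by simp
    then show ?case by (simp add: act_def)
  next
    case (Cons p \<mu>)
    obtain c a where p: "p = (c, a)" by force
    have "act \<nu> (act (p # \<mu>) v) x = act \<nu> (\<lambda>x. c * v (x + a) + 1 * act \<mu> v x) x"
      unfolding p by (rule arg_cong[where f = "\<lambda>f. act \<nu> f x"]) auto
    then show ?case using Cons by (simp only: act_lincomb act_shift) (simp add: p)
  qed
qed

lemma act_pmul: "act (pmul \<mu> \<nu>) v = act \<mu> (act \<nu> v)"
proof
  fix x
  have *: "act (map (\<lambda>(d, b). (c * d, a + b)) \<nu>) v x = c * act \<nu> v (x + a)" for c a
    by (induction \<nu>) (auto simp: algebra_simps)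
  show "act (pmul \<mu> \<nu>) v x = act \<mu> (act \<nu> v) x"
    by (induction \<mu>) (auto simp: pmul_def act_append *)
qed

lemma adj_pmul: "adj (pmul \<mu> \<nu>) = pmul (adj \<mu>) (adj \<nu>)"
proof (induction \<mu>)
  case (Cons p \<mu>)
  have *: "adj (map (\<lambda>(d, b). (c * d, a + b)) \<nu>) = map (\<lambda>(d, b). (cnj c * d, - a + b)) (adj \<nu>)" for c a
    by (induction \<nu>) auto
  show ?case using Cons by (cases p) (auto simp: pmul_def *)
qed (simp add: pmul_def)

lemma continuous_on_act:
  fixes v :: "'g::topological_ab_group_add \<Rightarrow> complex"
  assumes "continuous_on UNIV v" shows "continuous_on UNIV (act \<mu> v)"
proof (induction \<mu>)
  case (Cons p \<mu>)
  obtain c a where p: "p = (c, a)" by force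
  have "continuous_on UNIV (\<lambda>x. c * v (x + a) + act \<mu> v x)"
    using Cons by (intro continuous_intros continuous_on_compose2[OF assms]) auto
  then show ?case by (simp add: p)
qed (simp add: act_def)

lemma tendsto_act:
  assumes "\<And>x. ((\<lambda>n. w n x) \<longlongrightarrow> v x) F"
  shows "((\<lambda>n. act \<mu> (w n) x) \<longlongrightarrow> act \<mu> v x) F"
  by (induction \<mu>) (auto intro!: tendsto_intros assms)

text \<open>The quadratic form of the new function at \<open>\<mu>\<close> is the form of
  \<open>v\<close> at \<open>pmul \<mu> \<nu>\<close>.\<close>

lemma posdef_act: "posdef v \<Longrightarrow> posdef (act (adj \<nu>) (act \<nu> v))"
  unfolding posdef_def
proof
  fix \<mu>
  assume "\<forall>\<mu>. act (adj \<mu>) (act \<mu> v) 0 \<in> \<real>\<^sub>\<ge>\<^sub>0"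
  then have "act (adj (pmul \<mu> \<nu>)) (act (pmul \<mu> \<nu>) v) 0 \<in> \<real>\<^sub>\<ge>\<^sub>0" by blast
  then show "act (adj \<mu>) (act \<mu> (act (adj \<nu>) (act \<nu> v))) 0 \<in> \<real>\<^sub>\<ge>\<^sub>0"
    by (simp add: act_pmul adj_pmul act_commute[of \<mu> "adj \<nu>"])
qed

lemma posdef_tendsto:
  assumes "\<And>x. (\<lambda>n. w n x) \<longlonglongrightarrow> v x" "\<And>n. posdef (w n)"
  shows "posdef v"
  unfolding posdef_def
proof
  fix \<mu>
  have "(\<lambda>n. act (adj \<mu>) (act \<mu> (w n)) 0) \<longlonglongrightarrow> act (adj \<mu>) (act \<mu> v) 0"
    by (intro tendsto_act assms)
  then show "act (adj \<mu>) (act \<mu> v) 0 \<in> \<real>\<^sub>\<ge>\<^sub>0"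
    using assms(2) closed_sequentially[OF closed_nonneg_Reals_complex] by (force simp: posdef_def)
qed

lemma closed_posdef: "closed {v :: 'g::ab_group_add \<Rightarrow> complex. posdef v}"
proof -
  have c: "continuous_on UNIV (\<lambda>v. act \<mu> (k v) x)"
    if "\<And>x. continuous_on UNIV (\<lambda>v :: 'g \<Rightarrow> complex. k v x :: complex)" for \<mu> k and x :: 'g
    by (induction \<mu>) (use that in \<open>auto intro!: continuous_intros\<close>)
  have "closed ((\<lambda>v :: 'g \<Rightarrow> complex. act (adj \<mu>) (act \<mu> v) 0) -` \<real>\<^sub>\<ge>\<^sub>0)" for \<mu>
    by (intro closed_vimage closed_nonneg_Reals_complex c) auto
  moreover have "{v :: 'g \<Rightarrow> complex. posdef v} = (\<Inter>\<mu>. (\<lambda>v. act (adj \<mu>) (act \<mu> v) 0) -` \<real>\<^sub>\<ge>\<^sub>0)"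
    by (auto simp: posdef_def)
  ultimately show ?thesis by auto
qed

lemma posdef_0: "posdef v \<Longrightarrow> v 0 \<in> \<real>\<^sub>\<ge>\<^sub>0"
  unfolding posdef_def by (drule spec[of _ "[(1, 0)]"]) simp

lemma posdef_scale:
  assumes "posdef v" "r \<ge> 0" shows "posdef (\<lambda>x. of_real r * v x)"
  unfolding posdef_def
proof
  fix \<mu>
  have "act (adj \<mu>) (act \<mu> (\<lambda>x. of_real r * v x)) 0 = of_real r * act (adj \<mu>) (act \<mu> v) 0"
  proof -
    have "act \<nu> (\<lambda>x. of_real r * u x) = (\<lambda>x. of_real r * act \<nu> u x)" for \<nu> :: "(complex \<times> 'a) list" and u
      using act_lincomb[of \<nu> "of_real r" u 0] by (simp add: fun_eq_iff)
    then show ?thesis by simp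
  qed
  then show "act (adj \<mu>) (act \<mu> (\<lambda>x. of_real r * v x)) 0 \<in> \<real>\<^sub>\<ge>\<^sub>0"
    using assms by (simp add: posdef_def nonneg_Reals_mult_I)
qed

text \<open>Positivity is tested on \<open>\<mu>\<close> with an extra atom of free weight
  \<open>t\<close> at \<open>- x\<close>. The result is a polynomial in \<open>t\<close> and
  \<open>cnj t\<close>; its reality at \<open>t = 1\<close> and \<open>t = \<i>\<close> gives the
  symmetry, and its nonnegativity along \<open>t = - s * b\<close> gives the Cauchy-Schwarz
  inequality.\<close>

lemma posdef_quadratic:
  assumes "posdef v"
  shows "act (adj \<mu>) v (- x) = cnj (act \<mu> v x)"
    and "(cmod (act \<mu> v x))\<^sup>2 \<le> Re (v 0) * Re (act (adj \<mu>) (act \<mu> v) 0)"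
proof -
  define b b' D where "b = act \<mu> v x" and "b' = act (adj \<mu>) v (- x)" and "D = act (adj \<mu>) (act \<mu> v) 0"
  have D: "D \<in> \<real>\<^sub>\<ge>\<^sub>0" and v0: "v 0 \<in> \<real>\<^sub>\<ge>\<^sub>0"
    using assms posdef_0 by (auto simp: D_def posdef_def)
  have main: "cnj t * t * v 0 + cnj t * b + t * b' + D \<in> \<real>\<^sub>\<ge>\<^sub>0" for t
  proof -
    define \<nu> where "\<nu> = (t, - x) # \<mu>"
    have eq: "act \<nu> v = (\<lambda>z. t * v (z + - x) + 1 * act \<mu> v z)" by (auto simp: \<nu>_def)
    have "act (adj \<mu>) (act \<nu> v) 0 = t * b' + D"
      unfolding eq act_lincomb act_shift by (simp add: b'_def D_def)
    then have "act (adj \<nu>) (act \<nu> v) 0 = cnj t * t * v 0 + cnj t * b + t * b' + D"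
      by (simp add: \<nu>_def b_def algebra_simps)
    then show ?thesis using assms by (simp add: posdef_def flip: \<open>act (adj \<nu>) (act \<nu> v) 0 = _\<close>)
  qed
  have im: "Im (v 0) = 0" "Im D = 0" "Re (v 0) \<ge> 0" "Re D \<ge> 0"
    using D v0 by (auto simp: complex_nonneg_Reals_iff)
  have b': "b' = cnj b"
    using main[of 1] main[of \<i>] im by (auto simp: complex_nonneg_Reals_iff complex_eq_iff)
  then show "act (adj \<mu>) v (- x) = cnj (act \<mu> v x)" by (simp add: b_def b'_def)
  have q: "0 \<le> s\<^sup>2 * (cmod b)\<^sup>2 * Re (v 0) - 2 * s * (cmod b)\<^sup>2 + Re D" for s
  proof -
    have "Re (cnj t * t * v 0 + cnj t * b + t * cnj b + D) \<ge> 0" for t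
      using main[of t] b' by (auto simp: complex_nonneg_Reals_iff)
    from this[of "- of_real s * b"] im
    show ?thesis unfolding cmod_power2 by (simp add: power2_eq_square algebra_simps)
  qed
  have "(cmod b)\<^sup>2 \<le> Re (v 0) * Re D"
  \<comment> \<open>If \<open>v 0\<close> vanishes, the expression in \<open>s\<close> is affine and
    a large \<open>s\<close> makes it negative unless \<open>b = 0\<close>. Otherwise
    \<open>s = 1 / Re (v 0)\<close> is the minimiser, and its value is the discriminant
    condition.\<close>
  proof (cases "Re (v 0) = 0")
    case True
    have "b = 0"
    proof (rule ccontr)
      assume "b \<noteq> 0"
      then show False using q[of "(Re D + 1) / (2 * (cmod b)\<^sup>2)"] True by (simp add: field_simps)
    qed
    then show ?thesis using True by simp
  next
    case False
    then have "Re (v 0) > 0" using im by simp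
    then show ?thesis using q[of "1 / Re (v 0)"] by (simp add: field_simps power2_eq_square)
  qed
  then show "(cmod (act \<mu> v x))\<^sup>2 \<le> Re (v 0) * Re (act (adj \<mu>) (act \<mu> v) 0)"
    by (simp add: b_def D_def)
qed

lemma posdef_uminus: "posdef v \<Longrightarrow> v (- x) = cnj (v x)"
  using posdef_quadratic(1)[of v "[(1, 0)]" x] by simp

lemma posdef_norm_le: "posdef v \<Longrightarrow> cmod (v x) \<le> Re (v 0)"
proof -
  assume v: "posdef v"
  have "(cmod (v x))\<^sup>2 \<le> (Re (v 0))\<^sup>2"
    using posdef_quadratic(2)[OF v, of "[(1, 0)]" x] by (simp add: power2_eq_square)
  moreover have "Re (v 0) \<ge> 0" using posdef_0[OF v] by (simp add: complex_nonneg_Reals_iff)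
  ultimately show ?thesis by (rule power2_le_imp_le)
qed

subsection \<open>Convolution operators\<close>

definition conv :: "('g::ab_group_add \<Rightarrow> complex) \<Rightarrow> ('g \<Rightarrow> complex) \<Rightarrow> 'g \<Rightarrow> complex" where
  "conv h v x = mean (\<lambda>y. h y * v (x + y))"

definition coconv :: "('g::ab_group_add \<Rightarrow> complex) \<Rightarrow> ('g \<Rightarrow> complex) \<Rightarrow> 'g \<Rightarrow> complex" where
  "coconv h v x = mean (\<lambda>y. cnj (h y) * v (x - y))"

text \<open>The positive operator \<open>T* T\<close> for \<open>T = conv h\<close>; the outer
  factor \<open>coconv h\<close> is the adjoint.\<close>

definition conv2 :: "('g::ab_group_add \<Rightarrow> complex) \<Rightarrow> ('g \<Rightarrow> complex) \<Rightarrow> 'g \<Rightarrow> complex" where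
  "conv2 h v = coconv h (conv h v)"

text \<open>The Riemann-sum measure of \<open>h\<close> on the points of \<open>A\<close>: acting
  with it approximates \<open>conv h\<close>, and acting with its \<open>adj\<close> approximates
  \<open>coconv h\<close>.\<close>

definition weights :: "('g::ab_group_add \<Rightarrow> complex) \<Rightarrow> 'g list \<Rightarrow> (complex \<times> 'g) list" where
  "weights h A = map (\<lambda>a. (h a / of_nat (length A), a)) A"

definition autocorr :: "('g::ab_group_add \<Rightarrow> complex) \<Rightarrow> 'g \<Rightarrow> complex" where
  "autocorr f x = mean (\<lambda>s. f (x + s) * cnj (f s))"

lemma coconv_eq: "coconv h v x = conv (\<lambda>y. cnj (h y)) (\<lambda>z. v (- z)) (- x)"
  by (simp add: conv_def coconv_def)

lemma act_weights: "act (weights h A) v x = avg A (\<lambda>y. h y * v (x + y)) 0"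
proof -
  have "act (map (\<lambda>a. (h a / k, a)) B) v x = (\<Sum>a\<leftarrow>B. h a * v (x + a)) / k" for k B
    by (induction B) (auto simp: add_divide_distrib)
  from this[of "of_nat (length A)" A] show ?thesis
    by (simp add: weights_def avg_def scaleR_conv_of_real divide_inverse mult.commute)
qed

lemma act_adj_weights: "act (adj (weights h A)) v x = avg A (\<lambda>y. cnj (h y) * v (x - y)) 0"
proof -
  have "act (adj (map (\<lambda>a. (h a / of_nat k, a)) B)) v x = (\<Sum>a\<leftarrow>B. cnj (h a) * v (x - a)) / of_nat k" for k B
    by (induction B) (auto simp: add_divide_distrib)
  from this[of "of_nat (length A)" A] show ?thesis
    by (simp add: weights_def avg_def scaleR_conv_of_real divide_inverse mult.commute)
qed

section \<open>Convolution operators as uniform limits of finitely supported measures\<close>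

context compact_ab_group
begin

lemma continuous_translate:
  assumes "continuous_on UNIV (v :: 'g \<Rightarrow> complex)"
  shows "continuous_on UNIV (\<lambda>y. v (x + y))" "continuous_on UNIV (\<lambda>y. v (y + x))"
    "continuous_on UNIV (\<lambda>y. v (x - y))" "continuous_on UNIV (\<lambda>y. v (- y))"
  by (rule continuous_on_compose2[OF assms]; auto intro!: continuous_intros)+

text \<open>These are the integrands of \<open>conv h v x\<close> for all \<open>x\<close>. Their
  equicontinuity makes the Riemann sums for \<open>conv h v\<close> converge uniformly in
  \<open>x\<close>.\<close>

lemma equicont_mult_translates:
  fixes h v :: "'g \<Rightarrow> complex"
  assumes h: "continuous_on UNIV h" and v: "continuous_on UNIV v"
  shows "equicont (range (\<lambda>x y. h y * v (x + y)))"
proof -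
  obtain B where B: "B \<ge> 0" "\<And>x. cmod (h x) \<le> B" using bounded_continuous[OF h] by blast
  obtain C where C: "C \<ge> 0" "\<And>x. cmod (v x) \<le> C" using bounded_continuous[OF v] by blast
  show ?thesis unfolding equicont_def
  proof (intro conjI allI impI)
    show "\<exists>D. \<forall>f\<in>range (\<lambda>x y. h y * v (x + y)). \<forall>x. cmod (f x) \<le> D"
      using B C by (intro exI[of _ "B * C"]) (auto simp: norm_mult intro: mult_mono)
    fix e :: real assume e: "e > 0"
    define d where "d = e / (B + C + 1)"
    have d: "d > 0" using e B C by (simp add: d_def)
    obtain V where V: "open V" "0 \<in> V" "\<And>x y. x - y \<in> V \<Longrightarrow> cmod (h x - h y) \<le> d"
      using uniformly_continuous_translate[OF h d] by blast
    obtain W where W: "open W" "0 \<in> W" "\<And>x y. x - y \<in> W \<Longrightarrow> cmod (v x - v y) \<le> d"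
      using uniformly_continuous_translate[OF v d] by blast
    have "cmod (h y * v (x + y) - h z * v (x + z)) \<le> e" if yz: "y - z \<in> V \<inter> W" for x y z
    proof -
      have 1: "cmod (h y - h z) \<le> d" using V(3) yz by blast
      have "(x + y) - (x + z) = y - z" by simp
      then have 2: "cmod (v (x + y) - v (x + z)) \<le> d" using W(3)[of "x + y" "x + z"] yz by simp
      have "h y * v (x + y) - h z * v (x + z) = (h y - h z) * v (x + y) + h z * (v (x + y) - v (x + z))"
        by (simp add: algebra_simps)
      also have "cmod \<dots> \<le> d * C + B * d"
        using B C 1 2 d by (intro norm_triangle_mono) (auto simp: norm_mult intro!: mult_mono)
      also have "\<dots> \<le> d * (B + C + 1)" using d by (simp add: algebra_simps)
      also have "\<dots> = e" using B C by (simp add: d_def)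
      finally show ?thesis .
    qed
    then show "\<exists>V. open V \<and> 0 \<in> V \<and>
      (\<forall>f\<in>range (\<lambda>x y. h y * v (x + y)). \<forall>y z. y - z \<in> V \<longrightarrow> cmod (f y - f z) \<le> e)"
      using V W by (intro exI[of _ "V \<inter> W"]) auto
  qed
qed

lemma continuous_conv:
  fixes h v :: "'g \<Rightarrow> complex"
  assumes h: "continuous_on UNIV h" and v: "continuous_on UNIV v"
  shows "continuous_on UNIV (conv h v)"
proof -
  obtain B where B: "B \<ge> 0" "\<And>x. cmod (h x) \<le> B" using bounded_continuous[OF h] by blast
  have cs: "continuous_on UNIV (\<lambda>y. h y * v (x + y))" for x
    by (intro continuous_intros h continuous_translate v)
  have bd: "cmod (conv h v x) \<le> B * C" if "\<And>x. cmod (v x) \<le> C" for C x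
    unfolding conv_def using B that by (intro mean_norm_le cs) (auto simp: norm_mult intro!: mult_mono)
  have "equicont {conv h v}" unfolding equicont_def
  proof (intro conjI allI impI)
    obtain C where "\<And>x. cmod (v x) \<le> C" using bounded_continuous[OF v] by blast
    then show "\<exists>B. \<forall>f\<in>{conv h v}. \<forall>x. cmod (f x) \<le> B" using bd by blast
    fix e :: real assume e: "e > 0"
    define d where "d = e / (B + 1)"
    have d: "d > 0" using e B by (simp add: d_def)
    obtain W where W: "open W" "0 \<in> W" "\<And>x y. x - y \<in> W \<Longrightarrow> cmod (v x - v y) \<le> d"
      using uniformly_continuous_translate[OF v d] by blast
    have "cmod (conv h v x - conv h v y) \<le> e" if xy: "x - y \<in> W" for x y
    proof -
      have "conv h v x - conv h v y = mean (\<lambda>z. h z * v (x + z) - h z * v (y + z))"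
        unfolding conv_def by (rule mean_diff[symmetric]) (rule cs)+
      also have "cmod \<dots> \<le> B * d"
      proof (rule mean_norm_le)
        fix z
        have "(x + z) - (y + z) = x - y" by simp
        then have "cmod (v (x + z) - v (y + z)) \<le> d" using W(3)[of "x + z" "y + z"] xy by simp
        then show "cmod (h z * v (x + z) - h z * v (y + z)) \<le> B * d"
          unfolding right_diff_distrib[symmetric] norm_mult using B by (intro mult_mono) auto
      qed (intro continuous_intros cs)
      also have "\<dots> \<le> (B + 1) * d" using d by simp
      also have "\<dots> = e" using B by (simp add: d_def)
      finally show ?thesis .
    qed
    then show "\<exists>V. open V \<and> 0 \<in> V \<and> (\<forall>f\<in>{conv h v}. \<forall>x y. x - y \<in> V \<longrightarrow> cmod (f x - f y) \<le> e)"
      using W by blast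
  qed
  then show ?thesis by (rule equicont_continuous) simp
qed

lemma continuous_coconv:
  fixes h v :: "'g \<Rightarrow> complex"
  assumes h: "continuous_on UNIV h" and v: "continuous_on UNIV v"
  shows "continuous_on UNIV (coconv h v)"
proof -
  have "continuous_on UNIV (conv (\<lambda>y. cnj (h y)) (\<lambda>z. v (- z)))"
    by (intro continuous_conv continuous_intros h continuous_translate v)
  then show ?thesis unfolding coconv_eq by (rule continuous_translate)
qed

lemma continuous_conv2:
  fixes h v :: "'g \<Rightarrow> complex"
  shows "continuous_on UNIV h \<Longrightarrow> continuous_on UNIV v \<Longrightarrow> continuous_on UNIV (conv2 h v)"
  unfolding conv2_def by (intro continuous_conv continuous_coconv)

lemma norm_conv_le:
  fixes h v :: "'g \<Rightarrow> complex"
  assumes h: "continuous_on UNIV h" and v: "continuous_on UNIV v"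
    and "\<And>x. cmod (h x) \<le> B" "\<And>x. cmod (v x) \<le> C"
  shows "cmod (conv h v x) \<le> B * C" "cmod (coconv h v x) \<le> B * C"
proof -
  have B: "B \<ge> 0" using assms(3)[of 0] norm_ge_zero order_trans by blast
  show "cmod (conv h v x) \<le> B * C" unfolding conv_def
    using assms B by (intro mean_norm_le) (auto simp: norm_mult intro!: mult_mono continuous_intros continuous_translate)
  show "cmod (coconv h v x) \<le> B * C" unfolding coconv_def
    using assms B by (intro mean_norm_le) (auto simp: norm_mult intro!: mult_mono continuous_intros continuous_translate)
qed

lemma conv_lincomb:
  fixes h u v :: "'g \<Rightarrow> complex"
  assumes h: "continuous_on UNIV h" and u: "continuous_on UNIV u" and v: "continuous_on UNIV v"
  shows "conv h (\<lambda>x. c * u x + d * v x) x = c * conv h u x + d * conv h v x"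
    and "coconv h (\<lambda>x. c * u x + d * v x) x = c * coconv h u x + d * coconv h v x"
proof -
  have "mean (\<lambda>y. k y * (c * u (q y) + d * v (q y))) = c * mean (\<lambda>y. k y * u (q y)) + d * mean (\<lambda>y. k y * v (q y))"
    if k: "continuous_on UNIV k" and q: "continuous_on UNIV q" for k and q :: "'g \<Rightarrow> 'g"
  proof -
    have cs: "continuous_on UNIV (\<lambda>y. k y * u (q y))" "continuous_on UNIV (\<lambda>y. k y * v (q y))"
      by (intro continuous_intros k continuous_on_compose2[OF u q] continuous_on_compose2[OF v q]; simp)+
    have "mean (\<lambda>y. c * (k y * u (q y)) + d * (k y * v (q y))) = c * mean (\<lambda>y. k y * u (q y)) + d * mean (\<lambda>y. k y * v (q y))"
      using cs by (subst mean_add) (auto simp: mean_cmult intro!: continuous_intros)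
    then show ?thesis by (simp add: algebra_simps)
  qed
  then show "conv h (\<lambda>x. c * u x + d * v x) x = c * conv h u x + d * conv h v x"
    "coconv h (\<lambda>x. c * u x + d * v x) x = c * coconv h u x + d * coconv h v x"
    unfolding conv_def coconv_def using h by (simp_all add: continuous_intros)
qed

lemma conv2_lincomb:
  fixes h u v :: "'g \<Rightarrow> complex"
  assumes "continuous_on UNIV h" "continuous_on UNIV u" "continuous_on UNIV v"
  shows "conv2 h (\<lambda>x. c * u x + d * v x) x = c * conv2 h u x + d * conv2 h v x"
proof -
  have "conv h (\<lambda>x. c * u x + d * v x) = (\<lambda>x. c * conv h u x + d * conv h v x)"
    using conv_lincomb(1)[OF assms] by blast
  then show ?thesis unfolding conv2_def
    using conv_lincomb(2)[OF assms(1) continuous_conv continuous_conv] assms by simp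
qed

lemma weights_approx:
  fixes S :: "('g \<Rightarrow> complex) set"
  assumes "finite S" "\<And>v. v \<in> S \<Longrightarrow> continuous_on UNIV v" and h: "continuous_on UNIV h" and e: "e > 0"
  obtains A where "A \<noteq> []"
    "\<And>v x. v \<in> S \<Longrightarrow> cmod (act (weights h A) v x - conv h v x) \<le> e"
    "\<And>v x. v \<in> S \<Longrightarrow> cmod (act (adj (weights h A)) v x - coconv h v x) \<le> e"
proof -
  define fam where "fam v = range (\<lambda>x y. h y * v (x + y)) \<union> range (\<lambda>x y. cnj (h y) * v (x - y))" for v
  have "equicont (fam v)" if "v \<in> S" for v
  proof -
    have v: "continuous_on UNIV v" using assms(2) that by blast
    have "equicont (range (\<lambda>x y. cnj (h y) * v (- (x + y))))"
      by (intro equicont_mult_translates continuous_intros h continuous_translate v)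
    moreover have "range (\<lambda>x y. cnj (h y) * v (x - y)) \<subseteq> range (\<lambda>x y. cnj (h y) * v (- (x + y)))"
    proof clarify
      fix x show "(\<lambda>y. cnj (h y) * v (x - y)) \<in> range (\<lambda>x y. cnj (h y) * v (- (x + y)))"
        by (intro image_eqI[of _ _ "- x"]) auto
    qed
    ultimately show ?thesis unfolding fam_def
      using equicont_Un equicont_mult_translates[OF h v] equicont_subset by blast
  qed
  then have "equicont (\<Union>v\<in>S. fam v)"
    using assms(1)
  proof (induction S rule: infinite_finite_induct)
    case empty show ?case by (auto simp: equicont_def)
  next
    case (insert v S) then show ?case using equicont_Un[of "fam v"] by simp
  qed simp
  from mean_uniform[OF this e] obtain A where A: "A \<noteq> []"
    "\<And>f x. f \<in> (\<Union>v\<in>S. fam v) \<Longrightarrow> cmod (avg A f x - mean f) \<le> e" by blast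
  show ?thesis
  proof (rule that[OF A(1)])
    fix v x assume v: "v \<in> S"
    show "cmod (act (weights h A) v x - conv h v x) \<le> e"
      unfolding act_weights conv_def using v by (intro A(2)) (auto simp: fam_def)
    show "cmod (act (adj (weights h A)) v x - coconv h v x) \<le> e"
      unfolding act_adj_weights coconv_def using v by (intro A(2)) (auto simp: fam_def)
  qed
qed

lemma norm_act_weights_le:
  assumes "A \<noteq> []" "\<And>x. cmod (h x) \<le> B" "\<And>x. cmod (v x) \<le> C" "B \<ge> 0"
  shows "cmod (act (weights h A) v x) \<le> B * C" "cmod (act (adj (weights h A)) v x) \<le> B * C"
  unfolding act_weights act_adj_weights
  by (intro norm_avg_le assms(1); use assms in \<open>simp add: norm_mult mult_mono\<close>)+

text \<open>One sequence of finite measures realises \<open>conv2 h\<close> and its square on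
  \<open>v\<close>, so that the algebraic positivity statements about \<open>act\<close> pass to the
  limit. The spare function \<open>g\<close> lets the inner operator \<open>conv h\<close> be
  followed along the same sequence.\<close>

lemma conv2_approx:
  fixes h v g :: "'g \<Rightarrow> complex"
  assumes h: "continuous_on UNIV h" and v: "continuous_on UNIV v" and g: "continuous_on UNIV g"
  obtains w :: "nat \<Rightarrow> (complex \<times> 'g) list" where
    "\<And>x. (\<lambda>n. act (adj (w n)) (act (w n) v) x) \<longlonglongrightarrow> conv2 h v x"
    "\<And>x. (\<lambda>n. act (adj (w n)) (act (w n) (act (adj (w n)) (act (w n) v))) x) \<longlonglongrightarrow> conv2 h (conv2 h v) x"
    "\<And>n x. cmod (act (w n) g x - conv h g x) \<le> inverse (real (Suc n))"
proof -
  obtain B where B: "B \<ge> 0" "\<And>x. cmod (h x) \<le> B" using bounded_continuous[OF h] by blast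
  \<comment> \<open>All functions to which an approximated operator is applied: \<open>v\<close>,
    \<open>conv2 h v\<close> and \<open>g\<close> at the inner stage, \<open>conv h v\<close> and
    \<open>conv h (conv2 h v)\<close> at the adjoint stage.\<close>
  define S where "S = {v, conv2 h v, g, conv h v, conv h (conv2 h v)}"
  have cS: "continuous_on UNIV u" if "u \<in> S" for u
    using that by (auto simp: S_def intro!: h v g continuous_conv2 continuous_conv)
  have "\<exists>A. A \<noteq> [] \<and> (\<forall>v\<in>S. \<forall>x. cmod (act (weights h A) v x - conv h v x) \<le> inverse (real (Suc n))
     \<and> cmod (act (adj (weights h A)) v x - coconv h v x) \<le> inverse (real (Suc n)))" for n
    using weights_approx[of S h "inverse (real (Suc n))"] cS h by (metis S_def finite.emptyI finite.insertI
      inverse_positive_iff_positive of_nat_0_less_iff zero_less_Suc)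
  then obtain A where A: "\<And>n. A n \<noteq> []"
    "\<And>n v x. v \<in> S \<Longrightarrow> cmod (act (weights h (A n)) v x - conv h v x) \<le> inverse (real (Suc n))"
    "\<And>n v x. v \<in> S \<Longrightarrow> cmod (act (adj (weights h (A n))) v x - coconv h v x) \<le> inverse (real (Suc n))"
    by metis
  define w where "w n = weights h (A n)" for n
  define q where "q n u = act (adj (w n)) (act (w n) u)" for n u
  have one: "cmod (q n u x - conv2 h u x) \<le> (B + 1) * inverse (real (Suc n))" if "u \<in> {v, conv2 h v}" for u n x
  proof -
    have "cmod (act (adj (w n)) (\<lambda>x. act (w n) u x - conv h u x) x) \<le> B * inverse (real (Suc n))"
      unfolding w_def using A B that by (intro norm_act_weights_le) (auto simp: S_def)
    moreover have "cmod (act (adj (w n)) (conv h u) x - coconv h (conv h u) x) \<le> inverse (real (Suc n))"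
      unfolding w_def using that by (intro A) (auto simp: S_def)
    ultimately have "cmod ((act (adj (w n)) (act (w n) u) x - act (adj (w n)) (conv h u) x) +
      (act (adj (w n)) (conv h u) x - coconv h (conv h u) x)) \<le> B * inverse (real (Suc n)) + inverse (real (Suc n))"
      unfolding act_diff by (rule norm_triangle_mono)
    then show ?thesis by (simp add: q_def conv2_def algebra_simps)
  qed
  have two: "cmod (q n (q n v) x - conv2 h (conv2 h v) x) \<le> (B * B * (B + 1) + (B + 1)) * inverse (real (Suc n))" for n x
  proof -
    have "cmod (q n (\<lambda>x. q n v x - conv2 h v x) x) \<le> B * (B * ((B + 1) * inverse (real (Suc n))))"
      unfolding q_def w_def using A B one
      by (intro norm_act_weights_le) (auto simp: q_def w_def)
    moreover have "q n (\<lambda>x. q n v x - conv2 h v x) x = q n (q n v) x - q n (conv2 h v) x"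
      unfolding q_def act_diff[abs_def] by (simp add: act_diff)
    ultimately have "cmod ((q n (q n v) x - q n (conv2 h v) x) + (q n (conv2 h v) x - conv2 h (conv2 h v) x))
       \<le> B * (B * ((B + 1) * inverse (real (Suc n)))) + (B + 1) * inverse (real (Suc n))"
      using one[of "conv2 h v"] by (intro norm_triangle_mono) auto
    then show ?thesis by (simp add: algebra_simps)
  qed
  have lim: "f \<longlonglongrightarrow> l" if "\<And>n. cmod (f n - l) \<le> K * inverse (real (Suc n))" for f l K
  proof (rule LIM_zero_cancel, rule Lim_null_comparison)
    show "\<forall>\<^sub>F n in sequentially. cmod (f n - l) \<le> K * inverse (real (Suc n))" using that by simp
    show "(\<lambda>n. K * inverse (real (Suc n))) \<longlonglongrightarrow> 0"
      using tendsto_mult[OF tendsto_const LIMSEQ_inverse_real_of_nat, of K] by simp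
  qed
  show ?thesis
  proof (rule that[of w])
    show "(\<lambda>n. act (adj (w n)) (act (w n) v) x) \<longlonglongrightarrow> conv2 h v x" for x
      using lim[OF one[of v]] by (simp add: q_def)
    show "(\<lambda>n. act (adj (w n)) (act (w n) (act (adj (w n)) (act (w n) v))) x) \<longlonglongrightarrow> conv2 h (conv2 h v) x" for x
      using lim[OF two] by (simp add: q_def)
    show "cmod (act (w n) g x - conv h g x) \<le> inverse (real (Suc n))" for n x
      unfolding w_def by (intro A) (auto simp: S_def)
  qed
qed

lemma posdef_conv2:
  fixes h v :: "'g \<Rightarrow> complex"
  assumes h: "continuous_on UNIV h" and v: "continuous_on UNIV v" and pd: "posdef v"
  shows "posdef (conv2 h v)"
proof -
  obtain w where w: "\<And>x. (\<lambda>n. act (adj (w n)) (act (w n) v) x) \<longlonglongrightarrow> conv2 h v x"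
    and "\<And>x. (\<lambda>n. act (adj (w n)) (act (w n) (act (adj (w n)) (act (w n) v))) x) \<longlonglongrightarrow> conv2 h (conv2 h v) x"
    and "\<And>n x. cmod (act (w n) v x - conv h v x) \<le> inverse (real (Suc n))"
    by (rule conv2_approx[OF h v v]) (rule that)
  show ?thesis by (rule posdef_tendsto[OF w]) (rule posdef_act[OF pd])
qed

text \<open>With \<open>T = conv2 h\<close>, the right-hand side is \<open>v 0\<close> times the
  value at 0 of \<open>(T - l)^2 v\<close>. For the approximants this is
  \<open>posdef_quadratic\<close> applied to the self-adjoint measure of \<open>T - l\<close>, an
  atom of weight \<open>- l\<close> at \<open>0\<close> being added. The choice \<open>l = 0\<close>
  yields monotonicity, and the maximal \<open>l\<close> yields the eigenvalue equation.\<close>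

lemma conv2_cauchy_schwarz:
  fixes h v :: "'g \<Rightarrow> complex" and l :: real
  assumes h: "continuous_on UNIV h" and v: "continuous_on UNIV v" and pd: "posdef v"
  shows "(cmod (conv2 h v x - l * v x))\<^sup>2
    \<le> Re (v 0) * (Re (conv2 h (conv2 h v) 0) - 2 * l * Re (conv2 h v 0) + l\<^sup>2 * Re (v 0))"
proof -
  obtain w where w: "\<And>x. (\<lambda>n. act (adj (w n)) (act (w n) v) x) \<longlonglongrightarrow> conv2 h v x"
    "\<And>x. (\<lambda>n. act (adj (w n)) (act (w n) (act (adj (w n)) (act (w n) v))) x) \<longlonglongrightarrow> conv2 h (conv2 h v) x"
    and "\<And>n x. cmod (act (w n) v x - conv h v x) \<le> inverse (real (Suc n))"
    by (rule conv2_approx[OF h v v]) (rule that)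
  define q where "q n u = act (adj (w n)) (act (w n) u)" for n u
  have "(cmod (q n v x - l * v x))\<^sup>2 \<le> Re (v 0) * (Re (q n (q n v) 0) - 2 * l * Re (q n v 0) + l\<^sup>2 * Re (v 0))" for n
  proof -
    define \<mu> where "\<mu> = (- complex_of_real l, 0) # pmul (adj (w n)) (w n)"
    have a: "act \<mu> u = (\<lambda>x. q n u x - l * u x)" for u :: "'g \<Rightarrow> complex"
      by (auto simp: \<mu>_def act_pmul q_def)
    have b: "act (adj \<mu>) u x = q n u x - l * u x" for u :: "'g \<Rightarrow> complex" and x
      by (simp add: \<mu>_def act_pmul q_def adj_pmul act_commute[of "w n"])
    have lin: "q n (\<lambda>x. u x - l * u' x) x = q n u x - l * q n u' x" for u u' :: "'g \<Rightarrow> complex" and x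
    proof -
      have "act (w n) (\<lambda>x. u x - l * u' x) = (\<lambda>x. 1 * act (w n) u x + (- l) * act (w n) u' x)"
        using act_lincomb[of "w n" 1 u "- l" u'] by (simp add: fun_eq_iff)
      then show ?thesis unfolding q_def by (simp only: act_lincomb) simp
    qed
    have "act (adj \<mu>) (act \<mu> v) 0 = q n (\<lambda>x. q n v x - l * v x) 0 - l * (q n v 0 - l * v 0)"
      by (simp add: b) (simp add: a)
    then have "Re (act (adj \<mu>) (act \<mu> v) 0) = Re (q n (q n v) 0) - 2 * l * Re (q n v 0) + l\<^sup>2 * Re (v 0)"
      by (simp only: lin) (simp add: power2_eq_square right_diff_distrib)
    then show ?thesis using posdef_quadratic(2)[OF pd, of \<mu> x] by (simp add: a)
  qed
  moreover have "(\<lambda>n. (cmod (q n v x - l * v x))\<^sup>2) \<longlonglongrightarrow> (cmod (conv2 h v x - l * v x))\<^sup>2"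
    unfolding q_def by (intro tendsto_intros w)
  moreover have "(\<lambda>n. Re (v 0) * (Re (q n (q n v) 0) - 2 * l * Re (q n v 0) + l\<^sup>2 * Re (v 0)))
    \<longlonglongrightarrow> Re (v 0) * (Re (conv2 h (conv2 h v) 0) - 2 * l * Re (conv2 h v 0) + l\<^sup>2 * Re (v 0))"
    unfolding q_def by (intro tendsto_intros w)
  ultimately show ?thesis by (intro LIMSEQ_le) auto
qed

text \<open>\<open>autocorr f\<close> is the matrix coefficient of the translations at
  \<open>f\<close>. Pulling \<open>act\<close> under the mean and moving \<open>adj\<close> to the
  other factor by translation invariance turns its quadratic form into a squared norm.\<close>

lemma act_autocorr:
  fixes f :: "'g \<Rightarrow> complex"
  assumes f: "continuous_on UNIV f"
  shows "act (adj \<mu>) (act \<mu> (autocorr f)) 0 = mean (\<lambda>s. of_real ((cmod (act \<mu> f s))\<^sup>2))"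
proof -
  have ca: "continuous_on UNIV (\<lambda>s. act \<nu> f (x + s))" for \<nu> x
    by (intro continuous_translate continuous_on_act f)
  have 1: "act \<nu> (\<lambda>x. mean (\<lambda>s. g (x + s) * cnj (f s))) x = mean (\<lambda>s. act \<nu> g (x + s) * cnj (f s))"
    if g: "continuous_on UNIV g" for \<nu> g x
  proof (induction \<nu>)
    case (Cons p \<nu>)
    obtain c a where p: "p = (c, a)" by force
    have 2: "continuous_on UNIV (\<lambda>s. g (y + s) * cnj (f s))" for y
      by (intro continuous_intros f continuous_translate g)
    have 3: "continuous_on UNIV (\<lambda>s. act \<nu> g (x + s) * cnj (f s))"
      by (intro continuous_intros f continuous_translate continuous_on_act g)
    have "(\<lambda>s. act (p # \<nu>) g (x + s) * cnj (f s)) = (\<lambda>s. c * (g (x + a + s) * cnj (f s)) + act \<nu> g (x + s) * cnj (f s))"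
      by (auto simp: p algebra_simps)
    then show ?case using Cons 2 3
      by (simp add: p mean_add mean_cmult continuous_on_mult_left)
  qed (simp add: mean_const)
  have 2: "mean (\<lambda>s. act (adj \<nu>) g s * cnj (f s)) = mean (\<lambda>s. g s * cnj (act \<nu> f s))"
    if g: "continuous_on UNIV g" for \<nu> g
  proof (induction \<nu>)
    case (Cons p \<nu>)
    obtain c a where p: "p = (c, a)" by force
    have k1: "continuous_on UNIV (\<lambda>s. cnj c * (g (s + - a) * cnj (f s)))"
      and k2: "continuous_on UNIV (\<lambda>s. cnj c * (g s * cnj (f (s + a))))"
      by (intro continuous_intros f continuous_translate g)+
    have k3: "continuous_on UNIV (\<lambda>s. act (adj \<nu>) g s * cnj (f s))" "continuous_on UNIV (\<lambda>s. g s * cnj (act \<nu> f s))"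
      by (intro continuous_intros f continuous_on_act g)+
    have "mean (\<lambda>s. cnj c * (g s * cnj (f (s + a)))) = mean (\<lambda>s. cnj c * (g (s + - a) * cnj (f (s + - a + a))))"
      using mean_shift[OF k2, of "- a"] by simp
    also have "\<dots> = mean (\<lambda>s. cnj c * (g (s + - a) * cnj (f s)))" by simp
    finally have *: "mean (\<lambda>s. cnj c * (g s * cnj (f (s + a)))) = mean (\<lambda>s. cnj c * (g (s + - a) * cnj (f s)))" .
    have e1: "(\<lambda>s. act (adj (p # \<nu>)) g s * cnj (f s)) = (\<lambda>s. cnj c * (g (s + - a) * cnj (f s)) + act (adj \<nu>) g s * cnj (f s))"
      and e2: "(\<lambda>s. g s * cnj (act (p # \<nu>) f s)) = (\<lambda>s. cnj c * (g s * cnj (f (s + a))) + g s * cnj (act \<nu> f s))"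
      by (auto simp: p algebra_simps)
    show ?case unfolding e1 e2 mean_add[OF k1 k3(1)] mean_add[OF k2 k3(2)] * Cons ..
  qed (simp add: mean_const)
  have "act \<mu> (autocorr f) = (\<lambda>x. mean (\<lambda>s. act \<mu> f (x + s) * cnj (f s)))"
    using 1[OF f] by (simp add: autocorr_def[abs_def] fun_eq_iff)
  then have "act (adj \<mu>) (act \<mu> (autocorr f)) 0 = mean (\<lambda>s. act (adj \<mu>) (act \<mu> f) s * cnj (f s))"
    using 1[OF continuous_on_act[OF f], of "adj \<mu>" \<mu> 0] by simp
  also have "\<dots> = mean (\<lambda>s. act \<mu> f s * cnj (act \<mu> f s))"
    by (rule 2[OF continuous_on_act[OF f]])
  finally show ?thesis by (simp only: complex_norm_square)
qed

lemma mean_nonneg_real: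
  fixes f :: "'g \<Rightarrow> real"
  assumes "continuous_on UNIV f" "\<And>x. f x \<ge> 0"
  shows "mean (\<lambda>x. complex_of_real (f x)) \<in> \<real>\<^sub>\<ge>\<^sub>0"
proof -
  have c: "continuous_on UNIV (\<lambda>x. complex_of_real (f x))" by (intro continuous_intros assms)
  have "cnj (mean (\<lambda>x. complex_of_real (f x))) = mean (\<lambda>x. complex_of_real (f x))"
    using mean_cnj[OF c] by simp
  moreover have "0 \<le> Re (mean (\<lambda>x. complex_of_real (f x)))" by (rule mean_ge[OF c]) (simp add: assms)
  ultimately show ?thesis by (simp add: complex_nonneg_Reals_iff complex_eq_iff)
qed

lemma posdef_autocorr:
  fixes f :: "'g \<Rightarrow> complex"
  assumes f: "continuous_on UNIV f"
  shows "posdef (autocorr f)"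
  unfolding posdef_def act_autocorr[OF f]
  by (intro allI mean_nonneg_real continuous_intros continuous_on_act f) auto

lemma continuous_autocorr:
  fixes f :: "'g \<Rightarrow> complex"
  assumes f: "continuous_on UNIV f"
  shows "continuous_on UNIV (autocorr f)"
proof -
  have "autocorr f = conv (\<lambda>s. cnj (f s)) f" by (simp add: autocorr_def[abs_def] conv_def[abs_def] mult.commute)
  then show ?thesis by (simp add: continuous_conv f continuous_on_cnj)
qed

text \<open>This supplies the starting point of the maximisation. The forms approximating
  \<open>conv2 h K 0\<close> are means of squares of functions tending to \<open>conv h f\<close>,
  with \<open>f\<close> the conjugate of \<open>h\<close>; that limit is not zero, since its value
  at \<open>0\<close> is the mean of the squared modulus of \<open>h\<close>.\<close>

lemma conv2_autocorr_pos:
  fixes h :: "'g \<Rightarrow> complex"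
  assumes h: "continuous_on UNIV h" and p: "h p \<noteq> 0"
  defines "K \<equiv> autocorr (\<lambda>x. cnj (h x))"
  shows "Re (K 0) > 0" "Re (conv2 h K 0) > 0"
proof -
  define f where "f = (\<lambda>x. cnj (h x))"
  have f: "continuous_on UNIV f" unfolding f_def by (intro continuous_intros h)
  have K: "continuous_on UNIV K" unfolding K_def f_def[symmetric] by (rule continuous_autocorr[OF f])
  have ch: "continuous_on UNIV (\<lambda>s. h s * cnj (h s))" by (intro continuous_intros h)
  have "Re (h p * cnj (h p)) > 0" "\<And>x. 0 \<le> Re (h x * cnj (h x))"
    using p by (auto simp: complex_norm_square[symmetric] complex_mult_cnj
       simp flip: of_real_power)
  then have pos: "Re (mean (\<lambda>s. h s * cnj (h s))) > 0" using mean_pos[OF ch] by blast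
  show "Re (K 0) > 0" using pos by (simp add: K_def autocorr_def mult.commute)
  define q where "q = conv h f"
  have q: "continuous_on UNIV q" unfolding q_def by (intro continuous_conv h f)
  have "q 0 \<noteq> 0" using pos by (auto simp: q_def conv_def f_def)
  define m where "m = Re (mean (\<lambda>s. complex_of_real ((cmod (q s))\<^sup>2)))"
  have cq: "continuous_on UNIV (\<lambda>s. complex_of_real ((cmod (q s))\<^sup>2))" by (intro continuous_intros q)
  have m: "m > 0" unfolding m_def by (rule mean_pos[OF cq, of 0]) (use \<open>q 0 \<noteq> 0\<close> in auto)
  obtain w where w: "\<And>x. (\<lambda>n. act (adj (w n)) (act (w n) K) x) \<longlonglongrightarrow> conv2 h K x"
    and "\<And>x. (\<lambda>n. act (adj (w n)) (act (w n) (act (adj (w n)) (act (w n) K))) x) \<longlonglongrightarrow> conv2 h (conv2 h K) x"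
    and w': "\<And>n x. cmod (act (w n) f x - conv h f x) \<le> inverse (real (Suc n))"
    by (rule conv2_approx[OF h K f]) (rule that)
  \<comment> \<open>Half of \<open>m\<close> is lost through the inequality
    \<open>(a + b)^2 \<le> 2 a^2 + 2 b^2\<close>; a positive lower bound is all that is
    wanted.\<close>
  have "m / 2 - (inverse (real (Suc n)))\<^sup>2 \<le> Re (act (adj (w n)) (act (w n) K) 0)" for n
  proof -
    define g where "g = act (w n) f"
    have g: "continuous_on UNIV g" unfolding g_def by (intro continuous_on_act f)
    define i where "i = inverse (real (Suc n))"
    have pt: "- (i\<^sup>2) \<le> (cmod (g s))\<^sup>2 - (cmod (q s))\<^sup>2 / 2" for s
    proof -
      have "cmod (q s) \<le> cmod (g s) + i"
        using w'[of n s] norm_triangle_ineq3[of "g s" "q s"] by (simp add: g_def q_def i_def)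
      then have "(cmod (q s))\<^sup>2 \<le> (cmod (g s) + i)\<^sup>2" by (intro power_mono) auto
      also have "\<dots> \<le> 2 * (cmod (g s))\<^sup>2 + 2 * i\<^sup>2"
        using zero_le_power2[of "cmod (g s) - i"] by (simp add: power2_eq_square algebra_simps)
      finally show ?thesis by simp
    qed
    have cg: "continuous_on UNIV (\<lambda>s. complex_of_real ((cmod (g s))\<^sup>2))" by (intro continuous_intros g)
    have ch: "continuous_on UNIV (\<lambda>s. (1/2) * complex_of_real ((cmod (q s))\<^sup>2))" by (intro continuous_intros q)
    have "- (i\<^sup>2) \<le> Re (mean (\<lambda>s. complex_of_real ((cmod (g s))\<^sup>2) - (1/2) * complex_of_real ((cmod (q s))\<^sup>2)))"
      by (intro mean_ge continuous_intros cg ch) (use pt in simp)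
    also have "\<dots> = Re (mean (\<lambda>s. complex_of_real ((cmod (g s))\<^sup>2))) - m / 2"
      unfolding mean_diff[OF cg ch] mean_cmult[OF cq] by (simp add: m_def)
    also have "mean (\<lambda>s. complex_of_real ((cmod (g s))\<^sup>2)) = act (adj (w n)) (act (w n) K) 0"
      unfolding K_def f_def[symmetric] act_autocorr[OF f] g_def ..
    finally show ?thesis by (simp add: i_def)
  qed
  moreover have "(\<lambda>n. m / 2 - (inverse (real (Suc n)))\<^sup>2) \<longlonglongrightarrow> m / 2 - 0\<^sup>2"
    by (intro tendsto_intros LIMSEQ_inverse_real_of_nat)
  moreover have "(\<lambda>n. Re (act (adj (w n)) (act (w n) K) 0)) \<longlonglongrightarrow> Re (conv2 h K 0)"
    by (intro tendsto_intros w)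
  ultimately have "m / 2 \<le> Re (conv2 h K 0)" by (intro LIMSEQ_le[of _ "m / 2"]) auto
  then show "Re (conv2 h K 0) > 0" using m by simp
qed

text \<open>The smoothing property: after a shift of the mean the variable \<open>x\<close> sits in
  \<open>h\<close> instead of \<open>v\<close>, so translates of \<open>h\<close> alone control the
  modulus, and the outer convolution contributes the factor \<open>B\<close>.\<close>

lemma conv2_modulus:
  fixes h v :: "'g \<Rightarrow> complex"
  assumes h: "continuous_on UNIV h" and v: "continuous_on UNIV v"
    and B: "\<And>x. cmod (h x) \<le> B" and v1: "\<And>x. cmod (v x) \<le> 1"
    and D: "\<And>z. cmod (h (z - x) - h (z - x')) \<le> D"
  shows "cmod (conv2 h v x - conv2 h v x') \<le> B * D"
proof -
  have B0: "B \<ge> 0" using B[of 0] norm_ge_zero order_trans by blast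
  have cs: "continuous_on UNIV (\<lambda>y. h y * v (x + y))" for x
    by (intro continuous_intros h continuous_translate v)
  have cs2: "continuous_on UNIV (\<lambda>y. h (y - x) * v y)" for x
    by (intro continuous_intros continuous_on_compose2[OF h] v) auto
  have eq: "conv h v x = mean (\<lambda>y. h (y - x) * v y)" for x
    using mean_shift[OF cs[of x], of "- x"] by (simp add: conv_def)
  have H: "cmod (conv h v a - conv h v b) \<le> D" if "\<And>z. cmod (h (z - a) - h (z - b)) \<le> D" for a b
  proof -
    have "D \<ge> 0" using that[of 0] norm_ge_zero order_trans by blast
    then show ?thesis unfolding eq mean_diff[OF cs2 cs2, symmetric]
      using mult_mono[OF that v1, of] 
      by (intro mean_norm_le continuous_intros cs2) (auto simp: norm_mult simp flip: left_diff_distrib)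
  qed
  have cc: "continuous_on UNIV (\<lambda>y. cnj (h y) * conv h v (x - y))" for x
    by (intro continuous_intros h continuous_translate continuous_conv v)
  have "cmod (conv h v (x - y) - conv h v (x' - y)) \<le> D" for y
  proof (rule H)
    fix z show "cmod (h (z - (x - y)) - h (z - (x' - y))) \<le> D" using D[of "z + y"] by (simp add: algebra_simps)
  qed
  then show ?thesis unfolding conv2_def coconv_def mean_diff[OF cc cc, symmetric]
    using B B0
    by (intro mean_norm_le continuous_intros cc) (auto simp: norm_mult intro!: mult_mono simp flip: right_diff_distrib)
qed

end

subsection \<open>Existence of characters\<close>

lemma compact_product:
  fixes S :: "'i \<Rightarrow> 'a::topological_space set"
  assumes "\<And>i. compact (S i)"
  shows "compact {f. \<forall>i. f i \<in> S i}"
proof -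
  have "compactin (product_topology (\<lambda>i. euclidean) UNIV) (PiE UNIV S)"
    using assms by (simp add: compactin_PiE)
  moreover have "PiE UNIV S = {f. \<forall>i. f i \<in> S i}" by (auto simp: PiE_def)
  ultimately show ?thesis by (simp add: euclidean_product_topology)
qed

definition normalized_posdef :: "('g::topological_ab_group_add \<Rightarrow> complex) \<Rightarrow> bool" where
  "normalized_posdef v \<longleftrightarrow> continuous_on UNIV v \<and> posdef v \<and> v 0 = 1"

lemma normalized_posdef_norm_le: "normalized_posdef v \<Longrightarrow> cmod (v x) \<le> 1"
  unfolding normalized_posdef_def using posdef_norm_le[of v x] by simp

section \<open>The top eigenvalue of \<open>conv2 h\<close> and characters among its
  eigenfunctions\<close>

context compact_ab_group
begin

text \<open>On an equicontinuous set, pointwise convergence is already uniform, so a functional that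
  is Lipschitz in the sup norm is continuous for the product topology, where compactness comes from
  Tychonoff.\<close>

lemma continuous_on_equicont:
  fixes \<Phi> :: "('g \<Rightarrow> complex) \<Rightarrow> real"
  assumes S: "equicont S" and C: "C > 0"
    and \<Phi>: "\<And>u v e. u \<in> S \<Longrightarrow> v \<in> S \<Longrightarrow> (\<And>x. cmod (u x - v x) \<le> e) \<Longrightarrow> \<bar>\<Phi> u - \<Phi> v\<bar> \<le> C * e"
  shows "continuous_on S \<Phi>"
  unfolding continuous_on_def
proof (intro ballI tendstoI)
  fix v and e :: real assume v: "v \<in> S" and e: "e > 0"
  define d where "d = e / (4 * C)"
  have d: "d > 0" using e C by (simp add: d_def)
  obtain V where V: "open V" "0 \<in> V" "\<And>f x y. f \<in> S \<Longrightarrow> x - y \<in> V \<Longrightarrow> norm (f x - f y) \<le> d"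
    using S d unfolding equicont_def by meson
  obtain L where L: "L \<noteq> []" "\<And>z. \<exists>a\<in>set L. z + a \<in> V"
    using finite_translate_cover V by blast
  \<comment> \<open>Closeness is tested only at the finitely many points \<open>- a\<close>. Every
    \<open>x\<close> lies in a \<open>V\<close>-translate of one of them, so closeness spreads to
    all \<open>x\<close> at the price of \<open>3 * d\<close>, and \<open>d = e / (4 * C)\<close>
    leaves room.\<close>
  define U where "U = (\<Inter>a\<in>set L. (\<lambda>u. u (- a)) -` ball (v (- a)) d)"
  have "open U" unfolding U_def
    by (intro open_INT open_vimage ballI finite_set open_ball) auto
  moreover have "v \<in> U" using d by (auto simp: U_def)
  moreover have "dist (\<Phi> u) (\<Phi> v) < e" if u: "u \<in> U" "u \<in> S" for u
  proof -
    have "cmod (u x - v x) \<le> 3 * d" for x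
    proof -
      obtain a where a: "a \<in> set L" "x - - a \<in> V" using L(2)[of x] by auto
      have "cmod (u x - u (- a)) \<le> d" "cmod (v x - v (- a)) \<le> d"
        using V(3) a(2) u(2) v by blast+
      moreover have "cmod (u (- a) - v (- a)) < d"
        using u(1) a(1) by (auto simp: U_def dist_norm norm_minus_commute)
      moreover have "cmod (u x - v x) \<le> cmod (u x - u (- a)) + cmod (u (- a) - v (- a)) + cmod (v (- a) - v x)"
        by (metis add.commute diff_add_cancel norm_diff_triangle_le norm_triangle_ineq order_refl)
      ultimately show ?thesis by (simp add: norm_minus_commute)
    qed
    then have "\<bar>\<Phi> u - \<Phi> v\<bar> \<le> C * (3 * d)" using \<Phi> u v by blast
    also have "\<dots> < e" using C e by (simp add: d_def field_simps)
    finally show ?thesis by (simp add: dist_real_def)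
  qed
  ultimately show "\<forall>\<^sub>F u in at v within S. dist (\<Phi> u) (\<Phi> v) < e"
    unfolding eventually_at_topological by blast
qed

lemma conv2_diff_le:
  fixes h u v :: "'g \<Rightarrow> complex"
  assumes h: "continuous_on UNIV h" and u: "continuous_on UNIV u" and v: "continuous_on UNIV v"
    and B: "\<And>x. cmod (h x) \<le> B" and e: "\<And>x. cmod (u x - v x) \<le> e"
  shows "cmod (conv2 h u x - conv2 h v x) \<le> B * (B * e)"
proof -
  have uv: "continuous_on UNIV (\<lambda>x. u x - v x)" by (intro continuous_intros u v)
  have "conv2 h u x - conv2 h v x = conv2 h (\<lambda>x. u x - v x) x"
    using conv2_lincomb[OF h u v, of 1 "-1" x] by simp
  also have "cmod \<dots> \<le> B * (B * e)" unfolding conv2_def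
    by (intro norm_conv_le continuous_conv h uv B e)
  finally show ?thesis .
qed

text \<open>The functional \<open>Re (conv2 h v 0)\<close> is maximised over normalised positive
  definite functions. At the maximum, Cauchy-Schwarz becomes an equality, which forces the
  eigenvalue equation; dividing \<open>conv2 h v\<close> by \<open>l\<close> then shows that all
  maximisers share one modulus of continuity.\<close>

lemma conv2_top_face:
  fixes h :: "'g \<Rightarrow> complex"
  assumes h: "continuous_on UNIV h" and p: "h p \<noteq> 0"
  obtains l where "l > 0" "\<And>v. normalized_posdef v \<Longrightarrow> Re (conv2 h v 0) \<le> l"
    "{v. normalized_posdef v \<and> Re (conv2 h v 0) = l} \<noteq> {}"
    "compact {v. normalized_posdef v \<and> Re (conv2 h v 0) = l}" "equicont {v. normalized_posdef v \<and> Re (conv2 h v 0) = l}"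
    "\<And>v x. normalized_posdef v \<Longrightarrow> Re (conv2 h v 0) = l \<Longrightarrow> conv2 h v x = l * v x"
proof -
  obtain B where B: "B > 0" "\<And>x. cmod (h x) \<le> B"
  proof -
    obtain B where "B \<ge> 0" "\<And>x. cmod (h x) \<le> B" using bounded_continuous[OF h] by blast
    moreover have "cmod (h p) > 0" using p by simp
    ultimately show ?thesis using that[of B] by (meson less_le_trans)
  qed
  define L where "L v = Re (conv2 h v 0)" for v
  have L_scale: "conv2 h (\<lambda>x. of_real r * v x) y = of_real r * conv2 h v y" if "continuous_on UNIV v" for r v y
    using conv2_lincomb[OF h that that, of "of_real r" 0] by simp
  have L_pos: "conv2 h v 0 = of_real (L v)" if "normalized_posdef v" for v
    using posdef_0[OF posdef_conv2[OF h]] that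
    by (auto simp: normalized_posdef_def L_def complex_nonneg_Reals_iff complex_eq_iff)
  have normalized_posdef_scale: "normalized_posdef (\<lambda>x. of_real (1 / Re (v 0)) * v x)" if "continuous_on UNIV v" "posdef v" "Re (v 0) > 0" for v
    unfolding normalized_posdef_def
  proof (intro conjI continuous_intros that posdef_scale)
    show "of_real (1 / Re (v 0)) * v 0 = 1"
      using that posdef_0[OF that(2)] by (auto simp: complex_nonneg_Reals_iff complex_eq_iff)
  qed (use that in auto)
  define K where "K = autocorr (\<lambda>x. cnj (h x))"
  define v0 where "v0 = (\<lambda>x. of_real (1 / Re (K 0)) * K x)"
  define l0 where "l0 = L v0"
  have K: "continuous_on UNIV K" "posdef K" "Re (K 0) > 0" "Re (conv2 h K 0) > 0"
    unfolding K_def using conv2_autocorr_pos[OF h p]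
    by (auto intro!: continuous_autocorr posdef_autocorr continuous_intros h)
  have v0: "normalized_posdef v0" unfolding v0_def by (intro normalized_posdef_scale K)
  have l0: "l0 > 0" using K unfolding l0_def L_def v0_def L_scale[OF K(1)] by simp
  \<comment> \<open>Continuity is not a closed condition in the product topology; an explicit
    modulus is. The constant is the one that \<open>conv2 h v / L v\<close> satisfies by
    \<open>conv2_modulus\<close> whenever \<open>L v \<ge> l0\<close>.\<close>
  define KK where "KK = {v. posdef v \<and> v 0 = 1 \<and> (\<forall>x x' D. (\<forall>z. cmod (h (z - x) - h (z - x')) \<le> D) \<longrightarrow> cmod (v x - v x') \<le> B * D / l0)}"
  have KKbd: "cmod (v x) \<le> 1" if "v \<in> KK" for v x
    using that posdef_norm_le[of v x] by (simp add: KK_def)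
  have eq: "equicont KK" unfolding equicont_def
  proof (intro conjI allI impI)
    show "\<exists>B. \<forall>f\<in>KK. \<forall>x. cmod (f x) \<le> B" using KKbd by blast
    fix e :: real assume "e > 0"
    then have "e * l0 / B > 0" using B l0 by simp
    then obtain V where V: "open V" "0 \<in> V" "\<And>x y. x - y \<in> V \<Longrightarrow> cmod (h x - h y) \<le> e * l0 / B"
      using uniformly_continuous_translate[OF h] by metis
    have "cmod (f x - f y) \<le> e" if f: "f \<in> KK" and xy: "x - y \<in> V" for f x y
    proof -
      have "cmod (h (z - x) - h (z - y)) \<le> e * l0 / B" for z
        using V(3)[of "z - y" "z - x"] xy by (simp add: norm_minus_commute)
      then have "cmod (f x - f y) \<le> B * (e * l0 / B) / l0" using f unfolding KK_def by blast
      then show ?thesis using B l0 by simp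
    qed
    then show "\<exists>V. open V \<and> 0 \<in> V \<and> (\<forall>f\<in>KK. \<forall>x y. x - y \<in> V \<longrightarrow> cmod (f x - f y) \<le> e)"
      using V by blast
  qed
  have KKnpd: "normalized_posdef v" if "v \<in> KK" for v
    using that equicont_continuous[OF eq that] by (simp add: KK_def normalized_posdef_def)
  have "closed KK" unfolding KK_def
    by (intro closed_Collect_conj closed_posdef closed_Collect_all closed_Collect_imp closed_Collect_le
      closed_Collect_eq continuous_intros) auto
  moreover have "compact {v :: 'g \<Rightarrow> complex. \<forall>x. v x \<in> cball 0 1}" by (intro compact_product) simp
  moreover have "KK \<subseteq> {v. \<forall>x. v x \<in> cball 0 1}" using KKbd by auto
  ultimately have cKK: "compact KK" by (metis compact_Int_closed inf.absorb2)
  have cL: "continuous_on KK L"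
  proof (rule continuous_on_equicont[OF eq, of "B * B"])
    fix u v and e :: real assume uv: "u \<in> KK" "v \<in> KK" "\<And>x. cmod (u x - v x) \<le> e"
    have "cmod (conv2 h u 0 - conv2 h v 0) \<le> B * (B * e)"
      using uv KKnpd unfolding normalized_posdef_def by (intro conv2_diff_le h B) auto
    then show "\<bar>L u - L v\<bar> \<le> B * B * e"
      unfolding L_def using abs_Re_le_cmod[of "conv2 h u 0 - conv2 h v 0"] by simp
  qed (use B in simp)
  text \<open>Applying \<open>conv2 h\<close> and normalising does not decrease \<open>L\<close>, by Cauchy--Schwarz, and lands in the
    compact set \<open>KK\<close>; hence the maximum of \<open>L\<close> over \<open>KK\<close> is a maximum over all normalised
    positive definite functions.\<close>
  have improve: "\<exists>u\<in>KK. L v \<le> L u \<and> L u = Re (conv2 h (conv2 h v) 0) / L v" if v: "normalized_posdef v" "L v \<ge> l0" for v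
  proof -
    define u where "u = (\<lambda>x. of_real (1 / L v) * conv2 h v x)"
    have Lv: "L v > 0" using v l0 by simp
    have cv: "continuous_on UNIV v" "posdef v" "v 0 = 1" using v by (auto simp: normalized_posdef_def)
    have ct: "continuous_on UNIV (conv2 h v)" by (intro continuous_conv2 h cv)
    have "normalized_posdef u"
      using normalized_posdef_scale[OF ct posdef_conv2[OF h cv(1,2)]] Lv by (simp add: u_def L_def)
    moreover have "cmod (u x - u x') \<le> B * D / l0" if D: "\<And>z. cmod (h (z - x) - h (z - x')) \<le> D" for x x' D
    proof -
      have D0: "D \<ge> 0" using D[of 0] norm_ge_zero order_trans by blast
      have "u x - u x' = of_real (1 / L v) * (conv2 h v x - conv2 h v x')" by (simp add: u_def algebra_simps)
      also have "cmod \<dots> = cmod (conv2 h v x - conv2 h v x') / L v" using Lv by (simp add: norm_divide)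
      also have "\<dots> \<le> B * D / L v"
        using Lv by (intro divide_right_mono conv2_modulus h cv B normalized_posdef_norm_le v D) auto
      also have "\<dots> \<le> B * D / l0" using v l0 B D0 by (intro divide_left_mono) auto
      finally show ?thesis .
    qed
    ultimately have "u \<in> KK" by (auto simp: KK_def normalized_posdef_def)
    moreover have Lu: "L u = Re (conv2 h (conv2 h v) 0) / L v"
    proof -
      have "conv2 h u 0 = of_real (1 / L v) * conv2 h (conv2 h v) 0" unfolding u_def by (rule L_scale[OF ct])
      then show ?thesis by (simp add: L_def[of u])
    qed
    moreover have "L v \<le> L u"
    proof -
      have "(cmod (conv2 h v 0))\<^sup>2 \<le> Re (conv2 h (conv2 h v) 0)"
        using conv2_cauchy_schwarz[OF h cv(1,2), of 0 0] cv(3) by simp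
      then have "(L v)\<^sup>2 \<le> Re (conv2 h (conv2 h v) 0)"
        using Lv unfolding L_pos[OF v(1)] by simp
      then show ?thesis unfolding Lu using Lv by (simp add: field_simps power2_eq_square)
    qed
    ultimately show ?thesis by blast
  qed
  obtain u0 where u0: "u0 \<in> KK" "L u0 \<ge> l0" using improve[OF v0] l0_def by auto
  obtain m where m: "m \<in> KK" "\<And>v. v \<in> KK \<Longrightarrow> L v \<le> L m"
    using continuous_attains_sup[OF cKK _ cL] u0 by blast
  define l where "l = L m"
  have l: "l \<ge> l0" using m(2)[OF u0(1)] u0 by (simp add: l_def)
  have lmax: "L v \<le> l" if "normalized_posdef v" for v
  proof (cases "L v \<ge> l0")
    case True then show ?thesis using improve[OF that] m(2) by (force simp: l_def)
  qed (use l in simp)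
  have eig: "conv2 h v x = l * v x" if v: "normalized_posdef v" "L v = l" for v :: "'g \<Rightarrow> complex" and x
  proof -
    have cv: "continuous_on UNIV v" "posdef v" "v 0 = 1" using v by (auto simp: normalized_posdef_def)
    obtain u where u: "u \<in> KK" "L u = Re (conv2 h (conv2 h v) 0) / l" using improve[OF v(1)] v l by auto
    \<comment> \<open>The normalised image of \<open>v\<close> competes in \<open>KK\<close>, so its
      value is at most \<open>l\<close>. Inserted in the Cauchy-Schwarz bound, this leaves
      \<open>l^2 - 2 l^2 + l^2 = 0\<close>.\<close>
    have "Re (conv2 h (conv2 h v) 0) \<le> l\<^sup>2"
      using m(2)[OF u(1)] u(2) l l0 by (simp add: l_def field_simps power2_eq_square)
    moreover have "(cmod (conv2 h v x - l * v x))\<^sup>2 \<le> Re (conv2 h (conv2 h v) 0) - 2 * l * l + l\<^sup>2"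
      using conv2_cauchy_schwarz[OF h cv(1,2), of x l] cv(3) v(2) by (simp add: L_def)
    ultimately have "(cmod (conv2 h v x - l * v x))\<^sup>2 \<le> 0" by (simp add: power2_eq_square)
    then show ?thesis by simp
  qed
  have face: "{v. normalized_posdef v \<and> L v = l} = {v \<in> KK. L v = l}"
  proof (intro equalityI subsetI)
    fix v assume "v \<in> {v. normalized_posdef v \<and> L v = l}"
    then have v: "normalized_posdef v" "L v = l" by auto
    then have cv: "continuous_on UNIV v" by (auto simp: normalized_posdef_def)
    have "cmod (v x - v x') \<le> B * D / l0" if D: "\<And>z. cmod (h (z - x) - h (z - x')) \<le> D" for x x' D
    proof -
      have D0: "D \<ge> 0" using D[of 0] norm_ge_zero order_trans by blast
      have "cmod (conv2 h v x - conv2 h v x') \<le> B * D"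
        by (intro conv2_modulus h cv B normalized_posdef_norm_le v D)
      also have "conv2 h v x - conv2 h v x' = of_real l * (v x - v x')"
        using eig[OF v] by (simp add: algebra_simps)
      finally have "l * cmod (v x - v x') \<le> B * D" using l l0 by (simp add: norm_mult)
      moreover have "l0 * cmod (v x - v x') \<le> l * cmod (v x - v x')" using l by (intro mult_right_mono) auto
      ultimately show ?thesis using l0 by (simp add: field_simps)
    qed
    then show "v \<in> {v \<in> KK. L v = l}" using v by (auto simp: KK_def normalized_posdef_def)
  qed (use KKnpd in auto)
  have "closedin (top_of_set KK) (KK \<inter> L -` {l})"
    by (intro continuous_closedin_preimage cL) auto
  then have "compact (KK \<inter> L -` {l})" using cKK closedin_compact by blast
  moreover have "KK \<inter> L -` {l} = {v. normalized_posdef v \<and> L v = l}" unfolding face by auto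
  ultimately have "compact {v. normalized_posdef v \<and> L v = l}" by simp
  moreover have "equicont {v. normalized_posdef v \<and> L v = l}" unfolding face by (rule equicont_subset[OF eq]) auto
  moreover have "m \<in> {v. normalized_posdef v \<and> L v = l}" unfolding face using m by (simp add: l_def)
  ultimately show ?thesis
    by (intro that[of l, folded L_def]) (use l l0 lmax eig in \<open>auto\<close>)
qed

text \<open>Strict convexity of the squared norm: the defect in the convexity inequality is exactly
  \<open>t * (1 - t)\<close> times the mean of the squared modulus of \<open>a - b\<close>.\<close>

lemma mean_square_convex:
  fixes a b :: "'g \<Rightarrow> complex" and t :: real
  assumes a: "continuous_on UNIV a" and b: "continuous_on UNIV b" and t: "0 < t" "t < 1"
    and le: "Re (mean (\<lambda>x. of_real ((cmod (a x))\<^sup>2))) \<le> m" "Re (mean (\<lambda>x. of_real ((cmod (b x))\<^sup>2))) \<le> m"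
    and ge: "m \<le> Re (mean (\<lambda>x. of_real ((cmod (t * a x + (1 - t) * b x))\<^sup>2)))"
  shows "a x = b x"
proof (rule ccontr)
  assume ne: "a x \<noteq> b x"
  define N where "N f = (\<lambda>x. complex_of_real ((cmod (f x))\<^sup>2))" for f :: "'g \<Rightarrow> complex"
  have cN: "continuous_on UNIV (N f)" if "continuous_on UNIV f" for f
    unfolding N_def by (intro continuous_intros that)
  define c where "c = (\<lambda>x. t * a x + (1 - t) * b x)"
  define d where "d = (\<lambda>x. a x - b x)"
  have cc: "continuous_on UNIV c" and cd: "continuous_on UNIV d"
    unfolding c_def d_def by (intro continuous_intros a b)+
  have "(cmod (t * z + (1 - t) * w))\<^sup>2 + t * (1 - t) * (cmod (z - w))\<^sup>2 = t * (cmod z)\<^sup>2 + (1 - t) * (cmod w)\<^sup>2" for z w :: complex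
    unfolding cmod_power2 by (simp add: power2_eq_square algebra_simps)
  then have "N c x + of_real (t * (1 - t)) * N d x = of_real t * N a x + of_real (1 - t) * N b x" for x
    unfolding N_def c_def d_def of_real_mult[symmetric] of_real_add[symmetric] by presburger
  then have "mean (\<lambda>x. N c x + of_real (t * (1 - t)) * N d x) = mean (\<lambda>x. of_real t * N a x + of_real (1 - t) * N b x)"
    by presburger
  then have "mean (N c) + of_real (t * (1 - t)) * mean (N d) = of_real t * mean (N a) + of_real (1 - t) * mean (N b)"
    using cN[OF a] cN[OF b] cN[OF cc] cN[OF cd]
    by (simp only: mean_add mean_cmult continuous_on_mult_left)
  then have "Re (mean (N c)) + t * (1 - t) * Re (mean (N d)) = t * Re (mean (N a)) + (1 - t) * Re (mean (N b))"
    by (simp add: complex_eq_iff)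
  also have "\<dots> \<le> t * m + (1 - t) * m"
    using le t unfolding N_def by (intro add_mono mult_left_mono) auto
  also have "\<dots> = m" by (simp add: algebra_simps)
  also have "\<dots> \<le> Re (mean (N c))" using ge by (simp add: N_def c_def)
  finally have "t * (1 - t) * Re (mean (N d)) \<le> 0" by simp
  moreover have "Re (mean (N d)) > 0"
    by (rule mean_pos[OF cN[OF cd], of x]) (use ne in \<open>auto simp: N_def d_def\<close>)
  ultimately show False using t by (simp add: mult_le_0_iff)
qed

text \<open>A point of \<open>F\<close> maximising the strictly convex functional \<open>mean |v|\<^sup>2\<close> is extreme, and the
  decomposition of \<open>v\<close> into the positive definite functions \<open>2 v \<plusminus> (c v(\<cdot> + y) + cnj c v(\<cdot> - y))\<close>
  then forces multiplicativity.\<close>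
lemma face_contains_character:
  fixes F :: "('g \<Rightarrow> complex) set"
  assumes F: "\<And>v. v \<in> F \<Longrightarrow> normalized_posdef v" "F \<noteq> {}" "compact F" "equicont F"
    and face: "\<And>u w t. normalized_posdef u \<Longrightarrow> normalized_posdef w \<Longrightarrow> 0 < t \<Longrightarrow> t < 1 \<Longrightarrow> (\<lambda>x. of_real t * u x + (1 - of_real t) * w x) \<in> F \<Longrightarrow> u \<in> F \<and> w \<in> F"
  obtains v where "v \<in> F" "is_character v"
proof -
  define S where "S v = Re (mean (\<lambda>x. complex_of_real ((cmod (v x))\<^sup>2)))" for v :: "'g \<Rightarrow> complex"
  have cF: "continuous_on UNIV v" if "v \<in> F" for v using F(1)[OF that] by (simp add: normalized_posdef_def)
  have "continuous_on F S"
  proof (rule continuous_on_equicont[OF F(4), of 2])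
    fix u v and e :: real assume uv: "u \<in> F" "v \<in> F" "\<And>x. cmod (u x - v x) \<le> e"
    have c: "continuous_on UNIV (\<lambda>x. complex_of_real ((cmod (u x))\<^sup>2))" "continuous_on UNIV (\<lambda>x. complex_of_real ((cmod (v x))\<^sup>2))"
      by (intro continuous_intros cF uv)+
    have "cmod (mean (\<lambda>x. complex_of_real ((cmod (u x))\<^sup>2) - complex_of_real ((cmod (v x))\<^sup>2))) \<le> 2 * e"
    proof (rule mean_norm_le)
      fix x
      have "cmod (complex_of_real ((cmod (u x))\<^sup>2) - complex_of_real ((cmod (v x))\<^sup>2)) = \<bar>cmod (u x) + cmod (v x)\<bar> * \<bar>cmod (u x) - cmod (v x)\<bar>"
        unfolding of_real_diff[symmetric] norm_of_real abs_mult[symmetric] by (simp add: power2_eq_square algebra_simps)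
      also have "\<dots> \<le> 2 * e"
        using normalized_posdef_norm_le[OF F(1)[OF uv(1)], of x] normalized_posdef_norm_le[OF F(1)[OF uv(2)], of x]
          norm_triangle_ineq3[of "u x" "v x"] uv(3)[of x]
        by (intro mult_mono) auto
      finally show "cmod (complex_of_real ((cmod (u x))\<^sup>2) - complex_of_real ((cmod (v x))\<^sup>2)) \<le> 2 * e" .
    qed (intro continuous_intros c)
    then show "\<bar>S u - S v\<bar> \<le> 2 * e"
      unfolding mean_diff[OF c] S_def using abs_Re_le_cmod order_trans by fastforce
  qed simp
  then obtain v where v: "v \<in> F" "\<And>u. u \<in> F \<Longrightarrow> S u \<le> S v"
    using continuous_attains_sup[OF F(3,2)] by blast
  have cv: "continuous_on UNIV v" "posdef v" "v 0 = 1" using F(1)[OF v(1)] by (auto simp: normalized_posdef_def)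
  have key: "c * v (x + y) + cnj c * v (x - y) = 2 * of_real (Re (c * v y)) * v x" if c: "cmod c = 1" for c x y
  proof -
    define D where "D = (\<lambda>x. c * v (x + y) + cnj c * v (x - y))"
    define r where "r = Re (c * v y)"
    have r: "\<bar>r\<bar> \<le> 1"
      using abs_Re_le_cmod[of "c * v y"] normalized_posdef_norm_le[OF F(1)[OF v(1)], of y] c by (simp add: r_def norm_mult)
    define u where "u s = (\<lambda>x. 2 * v x + of_real s * D x)" for s :: real
    have u_pd: "posdef (u s)" "continuous_on UNIV (u s)" "u s 0 = of_real (2 + 2 * s * r)" if s: "s = 1 \<or> s = -1" for s
    proof -
      have cc: "c * cnj c = 1" using c by (simp add: complex_norm_square[symmetric])
      \<comment> \<open>The square \<open>adj \<nu> * \<nu>\<close> of the two-atom measure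
        \<open>\<nu>\<close> with weight 1 at \<open>0\<close> and \<open>s * c\<close> at
        \<open>y\<close>; as \<open>s * c\<close> has modulus 1, the diagonal terms add up to
        \<open>2 * v\<close>.\<close>
      have "u s = act (adj [(1, 0), (of_real s * c, y)]) (act [(1, 0), (of_real s * c, y)] v)"
        using s cc by (auto simp: u_def D_def fun_eq_iff algebra_simps)
      then show "posdef (u s)" using posdef_act[OF cv(2)] by metis
      show "continuous_on UNIV (u s)" unfolding u_def D_def
        using continuous_translate(2)[OF cv(1), of y] continuous_translate(2)[OF cv(1), of "- y"] cv(1)
        by (intro continuous_intros) simp_all
      show "u s 0 = of_real (2 + 2 * s * r)"
        using cv(3) posdef_uminus[OF cv(2), of y] by (simp add: u_def D_def r_def complex_eq_iff)
    qed
    have "D x = 2 * of_real r * v x"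
    \<comment> \<open>For \<open>r\<close> of modulus 1, one of the two functions vanishes at
      \<open>0\<close> and hence everywhere, so normalising it is impossible but the claim is
      immediate.\<close>
    proof (cases "\<bar>r\<bar> = 1")
      case True
      define s where "s = - r"
      have s: "s = 1 \<or> s = -1" "s * r = -1" using True by (auto simp: s_def abs_if split: if_splits)
      have "u s 0 = 0" unfolding u_pd(3)[OF s(1)] of_real_eq_0_iff using s(2) by simp
      then have "u s x = 0" using posdef_norm_le[OF u_pd(1)[OF s(1)], of x] by simp
      then show ?thesis using s(1) by (auto simp: u_def s_def algebra_simps)
    next
      case False
      then have r': "-1 < r" "r < 1" using r by auto
      define n where "n s = (\<lambda>x. of_real (1 / (2 + 2 * s * r)) * u s x)" for s
      have pd_n: "normalized_posdef (n s)" if s: "s = 1 \<or> s = -1" for s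
      proof -
        have "2 + 2 * s * r > 0" using s r' by auto
        then have "of_real (2 + 2 * s * r) \<noteq> (0::complex)" by (simp only: of_real_eq_0_iff)
        then have "n s 0 = 1" unfolding n_def u_pd(3)[OF s] by (simp add: field_simps)
        moreover have "posdef (n s)" "continuous_on UNIV (n s)"
          unfolding n_def using u_pd[OF s] \<open>2 + 2 * s * r > 0\<close>
          by (intro posdef_scale continuous_intros; simp)+
        ultimately show ?thesis by (simp add: normalized_posdef_def)
      qed
      \<comment> \<open>The weight that turns the two normalised functions back into
        \<open>u 1 / 4\<close> and \<open>u (-1) / 4\<close>, whose sum is \<open>v\<close>.\<close>
      define t where "t = (1 + r) / 2"
      have t: "0 < t" "t < 1" using r' by (auto simp: t_def)
      have n_eq: "of_real t * n 1 x = u 1 x / 4" "(1 - of_real t) * n (-1) x = u (-1) x / 4" for x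
      proof -
        have r4: "t * (1 / (2 + 2 * 1 * r)) = 1 / 4" "(1 - t) * (1 / (2 + 2 * (-1) * r)) = 1 / 4"
          using r' by (auto simp: t_def field_simps)
        have "of_real t * n 1 x = of_real (t * (1 / (2 + 2 * 1 * r))) * u 1 x"
          "(1 - of_real t) * n (-1) x = of_real ((1 - t) * (1 / (2 + 2 * (-1) * r))) * u (-1) x"
          by (simp_all only: n_def of_real_mult of_real_diff of_real_1 mult.assoc)
        then show "of_real t * n 1 x = u 1 x / 4" "(1 - of_real t) * n (-1) x = u (-1) x / 4"
          unfolding r4 by simp_all
      qed
      have comb: "v = (\<lambda>x. of_real t * n 1 x + (1 - of_real t) * n (-1) x)"
        unfolding n_eq by (auto simp: u_def fun_eq_iff add_divide_distrib diff_divide_distrib)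
      then have nF: "n 1 \<in> F" "n (-1) \<in> F" using face[OF pd_n pd_n t] v(1) by auto
      have Sv: "S v = Re (mean (\<lambda>x. of_real ((cmod (of_real t * n 1 x + of_real (1 - t) * n (-1) x))\<^sup>2)))"
        using arg_cong[OF comb, of S] by (simp add: S_def)
      have eq: "n 1 x = n (-1) x"
        by (rule mean_square_convex[OF cF[OF nF(1)] cF[OF nF(2)] t, where m = "S v"])
          (use v(2)[OF nF(1)] v(2)[OF nF(2)] Sv in \<open>auto simp: S_def\<close>)
      have u12: "u 1 x = 4 * of_real t * n (-1) x" "u (-1) x = 4 * (1 - of_real t) * n (-1) x"
        using n_eq[of x] eq by (simp_all add: field_simps)
      \<comment> \<open>Once the normalised functions agree, \<open>u 1\<close> and
        \<open>u (-1)\<close> are in the ratio \<open>1 + r\<close> to \<open>1 - r\<close>; solving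
        for \<open>D x\<close> gives the claim.\<close>
      have "of_real (1 - r) * u 1 x = of_real (1 + r) * u (-1) x"
        unfolding u12 by (simp add: t_def field_simps)
      then show ?thesis by (simp add: u_def algebra_simps)
    qed
    then show ?thesis by (simp add: D_def r_def)
  qed
  have mult: "v (x + y) = v x * v y" for x y
  proof -
    \<comment> \<open>The choices \<open>c = 1\<close> and \<open>c = \<i>\<close> isolate the sum
      and the difference of \<open>v (x + y)\<close> and \<open>v (x - y)\<close>, with the real and
      the imaginary part of \<open>v y\<close> as factors.\<close>
    have 1: "v (x + y) + v (x - y) = 2 * of_real (Re (v y)) * v x" using key[of 1 x y] by simp
    have "\<i> * (v (x + y) - v (x - y)) = \<i> * (2 * \<i> * of_real (Im (v y)) * v x)"
      using key[of \<i> x y] by (simp add: algebra_simps)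
    then have 2: "v (x + y) - v (x - y) = 2 * \<i> * of_real (Im (v y)) * v x" by simp
    have "2 * v (x + y) = (v (x + y) + v (x - y)) + (v (x + y) - v (x - y))" by simp
    also have "\<dots> = 2 * (of_real (Re (v y)) + \<i> * of_real (Im (v y))) * v x" unfolding 1 2 by (simp add: algebra_simps)
    also have "of_real (Re (v y)) + \<i> * of_real (Im (v y)) = v y" by (rule complex_eq[symmetric])
    finally show ?thesis by simp
  qed
  have "cmod (v x) = 1" for x
  proof -
    have "cmod (v x) * cmod (v (- x)) = 1" using mult[of x "- x"] cv(3) by (simp flip: norm_mult)
    moreover have "cmod (v x) * cmod (v (- x)) \<le> cmod (v x) * 1"
      using normalized_posdef_norm_le[OF F(1)[OF v(1)]] by (intro mult_left_mono) auto
    ultimately show ?thesis using normalized_posdef_norm_le[OF F(1)[OF v(1)], of x] by simp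
  qed
  then have "is_character v" using cv(1) mult by (simp add: is_character_def)
  then show ?thesis using that v(1) by blast
qed

text \<open>The maximisers form a face because the functional is affine. For a character
  \<open>v\<close> in it, \<open>conv h v\<close> is \<open>v\<close> times the mean of
  \<open>h * v\<close>, so orthogonality would give eigenvalue 0 instead of
  \<open>l > 0\<close>.\<close>

theorem exists_nonorthogonal_character:
  fixes h :: "'g \<Rightarrow> complex"
  assumes h: "continuous_on UNIV h" and p: "h p \<noteq> 0"
  obtains v where "is_character v" "mean (\<lambda>x. h x * v x) \<noteq> 0"
proof -
  obtain l where l: "l > 0" "\<And>v. normalized_posdef v \<Longrightarrow> Re (conv2 h v 0) \<le> l"
    "{v. normalized_posdef v \<and> Re (conv2 h v 0) = l} \<noteq> {}"
    "compact {v. normalized_posdef v \<and> Re (conv2 h v 0) = l}" "equicont {v. normalized_posdef v \<and> Re (conv2 h v 0) = l}"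
    "\<And>v x. normalized_posdef v \<Longrightarrow> Re (conv2 h v 0) = l \<Longrightarrow> conv2 h v x = l * v x"
    by (rule conv2_top_face[OF h p]) (rule that)
  obtain v where v: "v \<in> {v. normalized_posdef v \<and> Re (conv2 h v 0) = l}" "is_character v"
  proof (rule face_contains_character[OF _ l(3,4,5)])
    fix u w :: "'g \<Rightarrow> complex" and t :: real
    assume a: "normalized_posdef u" "normalized_posdef w" "0 < t" "t < 1"
      "(\<lambda>x. of_real t * u x + (1 - of_real t) * w x) \<in> {v. normalized_posdef v \<and> Re (conv2 h v 0) = l}"
    have "t * Re (conv2 h u 0) + (1 - t) * Re (conv2 h w 0) = l"
      using a conv2_lincomb[OF h, of u w "of_real t" "1 - of_real t" 0] by (auto simp: normalized_posdef_def)
    then have "t * (l - Re (conv2 h u 0)) + (1 - t) * (l - Re (conv2 h w 0)) = 0" by (simp add: algebra_simps)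
    moreover have "t * (l - Re (conv2 h u 0)) \<ge> 0" "(1 - t) * (l - Re (conv2 h w 0)) \<ge> 0"
      using a l(2) by auto
    ultimately have "t * (l - Re (conv2 h u 0)) = 0" "(1 - t) * (l - Re (conv2 h w 0)) = 0" by linarith+
    then show "u \<in> {v. normalized_posdef v \<and> Re (conv2 h v 0) = l} \<and> w \<in> {v. normalized_posdef v \<and> Re (conv2 h v 0) = l}"
      using a by auto
  qed auto
  have cv: "continuous_on UNIV v" and mv: "v (x + y) = v x * v y" for x y
    using v(2) by (auto simp: is_character_def)
  have chv: "continuous_on UNIV (\<lambda>y. h y * v y)" by (intro continuous_intros h cv)
  have "mean (\<lambda>x. h x * v x) \<noteq> 0"
  proof
    assume m0: "mean (\<lambda>x. h x * v x) = 0"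
    have "conv h v x = 0" for x
      using mean_cmult[OF chv, of "v x"] m0 by (simp add: conv_def mv mult.left_commute)
    then have "conv2 h v 0 = 0" by (simp add: conv2_def coconv_def mean_const)
    then show False using v(1) l(1) by auto
  qed
  then show ?thesis using that v(2) by blast
qed

end

subsection \<open>The dual group\<close>

lemma dual_groupD:
  assumes "a \<in> dual_group"
  shows "continuous_on UNIV a" "cmod (a x) = 1" "a (x + y) = a x * a y"
    "a 0 = 1" "a (- x) = cnj (a x)" "a x \<noteq> 0" "inverse (a x) = cnj (a x)" "cnj (a x) * a x = 1"
proof -
  have a: "continuous_on UNIV a" "\<And>x. cmod (a x) = 1" "\<And>x y. a (x + y) = a x * a y"
    using assms by (auto simp: dual_group_def is_character_def)
  have nz: "a z \<noteq> 0" for z using a(2)[of z] by auto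
  have c: "cnj (a z) * a z = 1" for z
    using complex_norm_square[of "a z"] a(2)[of z] by (simp add: mult.commute)
  have z: "a 0 = 1" using a(3)[of 0 0] nz[of 0] by simp
  have "a (- x) * a x = 1" using a(3)[of "- x" x] z by simp
  then show "a (- x) = cnj (a x)" using c[of x] nz[of x] by (metis mult_right_cancel)
  show "inverse (a x) = cnj (a x)" using c[of x] nz[of x] by (simp add: field_simps)
  show "continuous_on UNIV a" "cmod (a x) = 1" "a (x + y) = a x * a y" "a 0 = 1" "a x \<noteq> 0" "cnj (a x) * a x = 1"
    by (fact a z nz c)+
qed

lemma dual_group_one: "(\<lambda>_. 1) \<in> dual_group"
  by (simp add: dual_group_def is_character_def)

lemma dual_group_mult: "a \<in> dual_group \<Longrightarrow> b \<in> dual_group \<Longrightarrow> (\<lambda>x. a x * b x) \<in> dual_group"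
  by (auto simp: dual_group_def is_character_def norm_mult mult_ac intro!: continuous_intros)

lemma dual_group_cnj: "a \<in> dual_group \<Longrightarrow> (\<lambda>x. cnj (a x)) \<in> dual_group"
  by (auto simp: dual_group_def is_character_def intro!: continuous_intros)

lemma gen_subgroup_subset_dual:
  assumes "S \<subseteq> dual_group" shows "gen_subgroup S \<subseteq> dual_group"
proof
  fix a assume "a \<in> gen_subgroup S"
  then show "a \<in> dual_group"
  proof induction
    case (gen_inv a)
    then have "(\<lambda>x. inverse (a x)) = (\<lambda>x. cnj (a x))" by (auto simp: dual_groupD)
    then show ?case using dual_group_cnj gen_inv by metis
  qed (use assms in \<open>auto intro: dual_group_one dual_group_mult\<close>)
qed

lemma dual_group_endo:
  assumes "endo_action \<rho>" "a \<in> dual_group" shows "a \<circ> \<rho> \<gamma> \<in> dual_group"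
proof -
  have "continuous_on UNIV (\<lambda>x. a (\<rho> \<gamma> x))"
    by (rule continuous_on_compose2[of UNIV a UNIV]) (use assms in \<open>auto simp: endo_action_def dual_groupD(1)\<close>)
  then show ?thesis using assms by (simp add: endo_action_def dual_group_def is_character_def o_def)
qed

text \<open>A trigonometric polynomial with values in \<open>[0, 1]\<close>, equal to 1 exactly
  where \<open>c x = q c\<close> for all \<open>c \<in> I\<close>. Powers of it concentrate there,
  while its means against characters stay algebraically accessible.\<close>

definition fejer :: "('g \<Rightarrow> complex) set \<Rightarrow> (('g \<Rightarrow> complex) \<Rightarrow> complex) \<Rightarrow> 'g \<Rightarrow> real" where
  "fejer I q x = (\<Prod>c\<in>I. (1 + Re (cnj (q c) * c x)) / 2)"

context
  fixes I :: "('g::topological_ab_group_add \<Rightarrow> complex) set" and q :: "('g \<Rightarrow> complex) \<Rightarrow> complex"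
  assumes I: "finite I" "I \<subseteq> dual_group" and q: "\<And>c. c \<in> I \<Longrightarrow> cmod (q c) = 1"
begin

lemma fejer_factor:
  assumes "c \<in> I"
  shows "0 \<le> (1 + Re (cnj (q c) * c x)) / 2" "(1 + Re (cnj (q c) * c x)) / 2 \<le> 1"
    "c x \<noteq> q c \<Longrightarrow> (1 + Re (cnj (q c) * c x)) / 2 < 1"
proof -
  define z where "z = cnj (q c) * c x"
  have z: "cmod z = 1" using assms I q dual_groupD(2)[of c x] by (auto simp: z_def norm_mult)
  then have "\<bar>Re z\<bar> \<le> 1" using abs_Re_le_cmod[of z] by simp
  then show "0 \<le> (1 + Re (cnj (q c) * c x)) / 2" "(1 + Re (cnj (q c) * c x)) / 2 \<le> 1"
    by (auto simp: z_def[symmetric])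
  show "(1 + Re (cnj (q c) * c x)) / 2 < 1" if ne: "c x \<noteq> q c"
  proof (rule ccontr)
    assume "\<not> ?thesis"
    then have "Re z = 1" using \<open>\<bar>Re z\<bar> \<le> 1\<close> by (simp add: z_def[symmetric])
    then have "z = 1" using z cmod_power2[of z] by (simp add: complex_eq_iff)
    moreover have "q c * z = c x"
      using complex_norm_square[of "q c"] q[OF assms] by (simp add: z_def mult.assoc[symmetric])
    ultimately show False using ne by simp
  qed
qed

lemma fejer_nonneg: "0 \<le> fejer I q x"
  unfolding fejer_def by (intro prod_nonneg fejer_factor)

lemma fejer_less_1:
  assumes "c \<in> I" "c x \<noteq> q c" shows "fejer I q x < 1"
proof -
  have "fejer I q x = (1 + Re (cnj (q c) * c x)) / 2 * (\<Prod>c\<in>I - {c}. (1 + Re (cnj (q c) * c x)) / 2)"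
    unfolding fejer_def by (rule prod.remove[OF I(1) assms(1)])
  also have "\<dots> \<le> (1 + Re (cnj (q c) * c x)) / 2 * 1"
    using fejer_factor assms(1) by (intro mult_left_mono prod_le_1) auto
  also have "\<dots> < 1" using fejer_factor(3)[OF assms] by simp
  finally show ?thesis .
qed

lemma continuous_fejer: "continuous_on UNIV (fejer I q)"
  unfolding fejer_def using I dual_groupD(1) by (intro continuous_intros) auto

end

lemma fejer_at_0: "I \<subseteq> dual_group \<Longrightarrow> fejer I (\<lambda>_. 1) 0 = 1"
  unfolding fejer_def by (intro prod.neutral) (auto simp: dual_groupD)

section \<open>Concentration of powers, and its consequences for the dual\<close>

context compact_ab_group
begin

lemma fejer_bound:
  fixes Z :: "'g set"
  assumes I: "finite I" "I \<subseteq> dual_group" and q: "\<And>c. c \<in> I \<Longrightarrow> cmod (q c) = 1"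
    and Z: "closed Z" "\<And>x. x \<in> Z \<Longrightarrow> \<exists>c\<in>I. c x \<noteq> q c"
  obtains t where "0 \<le> t" "t < 1" "\<And>x. x \<in> Z \<Longrightarrow> fejer I q x \<le> t"
proof (cases "Z = {}")
  case False
  have "compact Z" using compact_Int_closed[OF compact_UNIV Z(1)] by simp
  then obtain x where x: "x \<in> Z" "\<And>y. y \<in> Z \<Longrightarrow> fejer I q y \<le> fejer I q x"
    using continuous_attains_sup[OF _ False] continuous_on_subset[OF continuous_fejer[OF I, of q]] q by blast
  obtain c where c: "c \<in> I" "c x \<noteq> q c" using Z(2)[OF x(1)] by blast
  show ?thesis
  proof (rule that[of "fejer I q x"])
    show "0 \<le> fejer I q x" by (rule fejer_nonneg[OF I]) (rule q)
    show "fejer I q x < 1" by (rule fejer_less_1[OF I, where c = c]) (use q c in auto)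
  qed (rule x(2))
qed (use that[of 0] in auto)

text \<open>Near \<open>p\<close> the function exceeds some \<open>k > t\<close>, so the mean of its
  \<open>N\<close>-th power is at least \<open>m * k ^ N\<close> with \<open>m\<close> independent
  of \<open>N\<close>, and this outgrows \<open>C * t ^ N\<close>.\<close>

lemma mean_power_dominates:
  fixes f :: "'g \<Rightarrow> real"
  assumes f: "continuous_on UNIV f" "\<And>x. 0 \<le> f x" "f p = 1" and t: "0 \<le> t" "t < 1"
  obtains N where "C * t ^ N < Re (mean (\<lambda>x. of_real (f x ^ N)))"
proof -
  define k where "k = (1 + t) / 2"
  have k: "0 < k" "k < 1" "t < k" using t by (auto simp: k_def)
  define V where "V = f -` {k<..}"
  have "open V" unfolding V_def by (intro open_vimage f) auto
  moreover have "p \<in> V" using f(3) k by (simp add: V_def)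
  ultimately obtain m where m: "m > 0" "\<And>g c. continuous_on UNIV g \<Longrightarrow> (\<And>x. 0 \<le> Re (g x)) \<Longrightarrow> c \<ge> 0 \<Longrightarrow>
    (\<And>x. x \<in> V \<Longrightarrow> c \<le> Re (g x)) \<Longrightarrow> m * c \<le> Re (mean g)"
    using mean_lower_bound by blast
  have low: "m * k ^ N \<le> Re (mean (\<lambda>x. of_real (f x ^ N)))" for N
  proof (rule m(2))
    show "k ^ N \<le> Re (of_real (f x ^ N))" if "x \<in> V" for x
      using that k by (simp add: V_def power_mono del: of_real_power)
  qed (use f k in \<open>auto intro!: continuous_intros simp del: of_real_power\<close>)
  have "(\<lambda>N. C * (t / k) ^ N) \<longlonglongrightarrow> C * 0"
    using k t by (intro tendsto_intros LIMSEQ_realpow_zero) auto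
  then have "\<forall>\<^sub>F N in sequentially. C * (t / k) ^ N < m" using m(1) by (intro order_tendstoD) auto
  then obtain N where "C * (t / k) ^ N < m" by (auto simp: eventually_sequentially)
  then have "C * t ^ N < m * k ^ N" using k by (simp add: power_divide field_simps)
  then show ?thesis using low[of N] by (intro that[of N]) linarith
qed

text \<open>If \<open>\<phi>\<close> were evaluation at a point \<open>z\<close>, the translate
  \<open>\<lambda>y. f (y - z)\<close> would be such an \<open>f'\<close>. The relation keeps, on
  \<open>H\<close>, what can be said about translation by a point not yet known to exist.\<close>

definition twisted :: "('g \<Rightarrow> complex) set \<Rightarrow> (('g \<Rightarrow> complex) \<Rightarrow> complex) \<Rightarrow> ('g \<Rightarrow> complex) \<Rightarrow> ('g \<Rightarrow> complex) \<Rightarrow> bool" where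
  "twisted H \<phi> f f' \<longleftrightarrow> continuous_on UNIV f \<and> continuous_on UNIV f' \<and>
     (\<forall>a\<in>H. mean (\<lambda>x. f' x * a x) = \<phi> a * mean (\<lambda>x. f x * a x))"

lemma twistedD: "twisted H \<phi> f f' \<Longrightarrow> a \<in> H \<Longrightarrow> mean (\<lambda>x. f' x * a x) = \<phi> a * mean (\<lambda>x. f x * a x)"
  by (simp add: twisted_def)

text \<open>The factor is \<open>1/2 + c/4 + cnj c / 4\<close>, so multiplying by it combines the
  Fourier coefficients at \<open>a\<close>, \<open>c * a\<close> and \<open>cnj c * a\<close>. On
  the twisted side \<open>c\<close> carries \<open>cnj (\<phi> c)\<close>, which cancels the extra
  \<open>\<phi> c\<close> from multiplicativity.\<close>

lemma twisted_factor:
  fixes f f' :: "'g \<Rightarrow> complex"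
  assumes H: "H \<subseteq> dual_group" "\<And>a b. a \<in> H \<Longrightarrow> b \<in> H \<Longrightarrow> (\<lambda>x. a x * b x) \<in> H"
      "\<And>a. a \<in> H \<Longrightarrow> (\<lambda>x. cnj (a x)) \<in> H"
    and \<phi>: "\<And>a b. a \<in> H \<Longrightarrow> b \<in> H \<Longrightarrow> \<phi> (\<lambda>x. a x * b x) = \<phi> a * \<phi> b"
      "\<And>a. a \<in> H \<Longrightarrow> cmod (\<phi> a) = 1" "\<And>a. a \<in> H \<Longrightarrow> \<phi> (\<lambda>x. cnj (a x)) = cnj (\<phi> a)"
    and tw: "twisted H \<phi> f f'" and c: "c \<in> H"
  shows "twisted H \<phi> (\<lambda>x. f x * of_real ((1 + Re (c x)) / 2))
    (\<lambda>x. f' x * of_real ((1 + Re (cnj (\<phi> c) * c x)) / 2))"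
proof -
  have f: "continuous_on UNIV f" "continuous_on UNIV f'"
    and tw': "\<And>a. a \<in> H \<Longrightarrow> mean (\<lambda>x. f' x * a x) = \<phi> a * mean (\<lambda>x. f x * a x)"
    using tw by (auto simp: twisted_def)
  have cH: "continuous_on UNIV a" if "a \<in> H" for a using dual_groupD(1) H(1) that by blast
  have unit: "cnj (\<phi> c) * \<phi> c = 1"
    using complex_norm_square[of "\<phi> c"] \<phi>(2)[OF c] by (simp add: mult.commute)
  have half: "complex_of_real ((1 + Re z) / 2) = 1/2 + z / 4 + cnj z / 4" for z
    by (simp add: complex_eq_iff)
  have expand: "mean (\<lambda>x. g x * of_real ((1 + Re (s * c x)) / 2) * a x) =
      1/2 * mean (\<lambda>x. g x * a x) + s / 4 * mean (\<lambda>x. g x * (c x * a x)) + cnj s / 4 * mean (\<lambda>x. g x * (cnj (c x) * a x))"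
    if g: "continuous_on UNIV g" and a: "a \<in> H" for g a s
  proof -
    have k: "continuous_on UNIV (\<lambda>x. g x * a x)" "continuous_on UNIV (\<lambda>x. g x * (c x * a x))"
      "continuous_on UNIV (\<lambda>x. g x * (cnj (c x) * a x))"
      by (intro continuous_intros g cH a c)+
    have "(\<lambda>x. g x * of_real ((1 + Re (s * c x)) / 2) * a x) =
      (\<lambda>x. (1/2 * (g x * a x) + s / 4 * (g x * (c x * a x))) + cnj s / 4 * (g x * (cnj (c x) * a x)))"
      unfolding half by (auto simp: fun_eq_iff algebra_simps)
    then show ?thesis using k by (simp only: mean_add mean_cmult continuous_on_mult_left continuous_on_add)
  qed
  show ?thesis unfolding twisted_def
  proof (intro conjI ballI)
    fix a assume a: "a \<in> H"
    have "mean (\<lambda>x. f' x * of_real ((1 + Re (cnj (\<phi> c) * c x)) / 2) * a x) =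
      1/2 * (\<phi> a * mean (\<lambda>x. f x * a x)) + cnj (\<phi> c) / 4 * (\<phi> c * \<phi> a * mean (\<lambda>x. f x * (c x * a x)))
      + \<phi> c / 4 * (cnj (\<phi> c) * \<phi> a * mean (\<lambda>x. f x * (cnj (c x) * a x)))"
      unfolding expand[OF f(2) a] tw'[OF a] tw'[OF H(2)[OF c a]] tw'[OF H(2)[OF H(3)[OF c] a]]
        \<phi>(1)[OF c a] \<phi>(1)[OF H(3)[OF c] a] \<phi>(3)[OF c] by simp
    also have "\<dots> = 1/2 * (\<phi> a * mean (\<lambda>x. f x * a x)) + (cnj (\<phi> c) * \<phi> c) / 4 * (\<phi> a * mean (\<lambda>x. f x * (c x * a x)))
      + (cnj (\<phi> c) * \<phi> c) / 4 * (\<phi> a * mean (\<lambda>x. f x * (cnj (c x) * a x)))"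
      by (simp add: mult_ac)
    also have "\<dots> = \<phi> a * mean (\<lambda>x. f x * of_real ((1 + Re (1 * c x)) / 2) * a x)"
      unfolding expand[OF f(1) a] unit by (simp add: algebra_simps)
    finally show "mean (\<lambda>x. f' x * of_real ((1 + Re (cnj (\<phi> c) * c x)) / 2) * a x) =
      \<phi> a * mean (\<lambda>x. f x * of_real ((1 + Re (c x)) / 2) * a x)" by simp
  qed (intro continuous_intros f cH c; simp)+
qed

lemma twisted_fejer:
  fixes f f' :: "'g \<Rightarrow> complex"
  assumes H: "H \<subseteq> dual_group" "\<And>a b. a \<in> H \<Longrightarrow> b \<in> H \<Longrightarrow> (\<lambda>x. a x * b x) \<in> H"
      "\<And>a. a \<in> H \<Longrightarrow> (\<lambda>x. cnj (a x)) \<in> H"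
    and \<phi>: "\<And>a b. a \<in> H \<Longrightarrow> b \<in> H \<Longrightarrow> \<phi> (\<lambda>x. a x * b x) = \<phi> a * \<phi> b"
      "\<And>a. a \<in> H \<Longrightarrow> cmod (\<phi> a) = 1" "\<And>a. a \<in> H \<Longrightarrow> \<phi> (\<lambda>x. cnj (a x)) = cnj (\<phi> a)"
    and tw: "twisted H \<phi> f f'" and I: "finite I" "I \<subseteq> H"
  shows "twisted H \<phi> (\<lambda>x. f x * of_real (fejer I (\<lambda>_. 1) x ^ N)) (\<lambda>x. f' x * of_real (fejer I \<phi> x ^ N))"
proof -
  have one: "twisted H \<phi> (\<lambda>x. f x * of_real (fejer I (\<lambda>_. 1) x)) (\<lambda>x. f' x * of_real (fejer I \<phi> x))"
    if "twisted H \<phi> f f'" for f f'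
    using I that
  proof (induction I arbitrary: f f' rule: finite_induct)
    case (insert c I)
    then have "twisted H \<phi> (\<lambda>x. f x * of_real ((1 + Re (c x)) / 2)) (\<lambda>x. f' x * of_real ((1 + Re (cnj (\<phi> c) * c x)) / 2))"
      by (intro twisted_factor[OF H \<phi>]) auto
    then have "twisted H \<phi> (\<lambda>x. f x * of_real ((1 + Re (c x)) / 2) * of_real (fejer I (\<lambda>_. 1) x))
      (\<lambda>x. f' x * of_real ((1 + Re (cnj (\<phi> c) * c x)) / 2) * of_real (fejer I \<phi> x))"
      using insert by blast
    then show ?case using insert(1,2) by (simp add: fejer_def mult.assoc)
  qed (simp add: fejer_def)
  show ?thesis
  proof (induction N)
    case (Suc N)
    from one[OF this] show ?case by (simp add: mult_ac)
  qed (use tw in simp)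
qed

lemma mean_character:
  assumes "a \<in> dual_group" "a \<noteq> (\<lambda>_::'g. 1)" shows "mean a = 0"
proof -
  obtain y where y: "a y \<noteq> 1" using assms(2) by blast
  have "mean a = mean (\<lambda>x. a (x + y))" using mean_shift[OF dual_groupD(1)[OF assms(1)]] by simp
  also have "\<dots> = a y * mean a"
    using mean_cmult[OF dual_groupD(1)[OF assms(1)], of "a y"] dual_groupD(3)[OF assms(1)] by (simp add: mult.commute)
  finally show ?thesis using y by simp
qed

text \<open>By compactness finitely many characters \<open>I\<close> have to be matched at a time.
  If no point did so, the kernel \<open>fejer I \<phi>\<close> would stay below some
  \<open>t < 1\<close>; yet its powers have the same means as those of the untwisted kernel, which
  attains 1 at \<open>0\<close> and so decays more slowly.\<close>

theorem dual_hom_is_evaluation: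
  fixes \<phi> :: "('g \<Rightarrow> complex) \<Rightarrow> complex"
  assumes mult: "\<And>a b. a \<in> dual_group \<Longrightarrow> b \<in> dual_group \<Longrightarrow> \<phi> (\<lambda>x. a x * b x) = \<phi> a * \<phi> b"
    and unit: "\<And>a. a \<in> dual_group \<Longrightarrow> cmod (\<phi> a) = 1"
  obtains x where "\<And>a. a \<in> dual_group \<Longrightarrow> a x = \<phi> a"
proof -
  have \<phi>1: "\<phi> (\<lambda>_. 1) = 1"
    using mult[OF dual_group_one dual_group_one] unit[OF dual_group_one] by auto
  have \<phi>cnj: "\<phi> (\<lambda>x. cnj (a x)) = cnj (\<phi> a)" if a: "a \<in> dual_group" for a
  proof -
    have "\<phi> (\<lambda>x. cnj (a x)) * \<phi> a = 1"
      using mult[OF dual_group_cnj[OF a] a] \<phi>1 dual_groupD(8)[OF a] by simp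
    moreover have "cnj (\<phi> a) * \<phi> a = 1" using complex_norm_square[of "\<phi> a"] unit[OF a] by (simp add: mult.commute)
    moreover have "\<phi> a \<noteq> 0" using unit[OF a] by auto
    ultimately show ?thesis by (metis mult_right_cancel)
  qed
  have "UNIV \<inter> (\<Inter>a\<in>dual_group. {x. a x = \<phi> a}) \<noteq> {}"
  proof (rule compact_imp_fip_image[OF compact_UNIV])
    fix a :: "'g \<Rightarrow> complex" assume "a \<in> dual_group"
    then show "closed {x. a x = \<phi> a}" using dual_groupD(1) by (intro closed_Collect_eq) auto
  next
    fix I :: "('g \<Rightarrow> complex) set" assume I: "finite I" "I \<subseteq> dual_group"
    show "UNIV \<inter> (\<Inter>a\<in>I. {x. a x = \<phi> a}) \<noteq> {}"
    proof
      assume "UNIV \<inter> (\<Inter>a\<in>I. {x. a x = \<phi> a}) = {}"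
      then have "\<exists>c\<in>I. c x \<noteq> \<phi> c" for x by auto
      then obtain t where t: "0 \<le> t" "t < 1" "\<And>x. fejer I \<phi> x \<le> t"
        using fejer_bound[OF I, of \<phi> UNIV] unit I(2) by (metis UNIV_I closed_UNIV subsetD)
      have P: "continuous_on UNIV (fejer I (\<lambda>_. 1))" "\<And>x. 0 \<le> fejer I (\<lambda>_. 1) x"
        by (rule continuous_fejer[OF I] fejer_nonneg[OF I]; simp)+
      obtain N where N: "1 * t ^ N < Re (mean (\<lambda>x::'g. of_real (fejer I (\<lambda>_. 1) x ^ N)))"
        by (rule mean_power_dominates[OF P fejer_at_0[OF I(2)] t(1,2)])
      \<comment> \<open>The constant 1 has only one non-zero Fourier coefficient, at the trivial
        character, where \<open>\<phi>\<close> is 1.\<close>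
      have tw: "twisted dual_group \<phi> (\<lambda>_. 1) (\<lambda>_. 1)"
        unfolding twisted_def
      proof (intro conjI ballI)
        fix a :: "'g \<Rightarrow> complex" assume "a \<in> dual_group"
        then show "mean (\<lambda>x. 1 * a x) = \<phi> a * mean (\<lambda>x. 1 * a x)"
          using mean_character[of a] \<phi>1 by (cases "a = (\<lambda>_. 1)") auto
      qed auto
      have "twisted dual_group \<phi> (\<lambda>x. 1 * of_real (fejer I (\<lambda>_. 1) x ^ N)) (\<lambda>x. 1 * of_real (fejer I \<phi> x ^ N))"
        by (rule twisted_fejer[OF order_refl _ _ _ _ _ tw I])
          (fact dual_group_mult dual_group_cnj mult unit \<phi>cnj)+
      from twistedD[OF this dual_group_one]
      have "mean (\<lambda>x. of_real (fejer I \<phi> x ^ N)) = mean (\<lambda>x. of_real (fejer I (\<lambda>_. 1) x ^ N))"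
        by (simp add: \<phi>1)
      moreover have "cmod (mean (\<lambda>x. of_real (fejer I \<phi> x ^ N))) \<le> t ^ N"
      proof (rule mean_norm_le)
        have "continuous_on UNIV (fejer I \<phi>)" by (rule continuous_fejer[OF I]) (use unit I(2) in blast)
        then show "continuous_on UNIV (\<lambda>x. complex_of_real (fejer I \<phi> x ^ N))" by (intro continuous_intros)
        fix x
        have "0 \<le> fejer I \<phi> x" by (rule fejer_nonneg[OF I]) (use unit I(2) in blast)
        then show "cmod (complex_of_real (fejer I \<phi> x ^ N)) \<le> t ^ N"
          using t(3) unfolding norm_of_real by (simp add: power_mono)
      qed
      ultimately show False using N complex_Re_le_cmod[of "mean (\<lambda>x. of_real (fejer I (\<lambda>_. 1) x ^ N))"] by simp
    qed
  qed
  then show ?thesis using that by blast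
qed

text \<open>If a character \<open>c\<close> lay outside \<open>H\<close>, it would be orthogonal to all powers of a product of
  factors \<open>(1 + Re a) / 2\<close> with \<open>a \<in> H\<close>; but these powers concentrate where \<open>Re c > 1/2\<close>.\<close>
theorem separating_subgroup_eq_dual:
  fixes H :: "('g \<Rightarrow> complex) set"
  assumes H: "H \<subseteq> dual_group" "(\<lambda>_. 1) \<in> H" "\<And>a b. a \<in> H \<Longrightarrow> b \<in> H \<Longrightarrow> (\<lambda>x. a x * b x) \<in> H"
      "\<And>a. a \<in> H \<Longrightarrow> (\<lambda>x. cnj (a x)) \<in> H"
    and sep: "\<And>x. x \<noteq> 0 \<Longrightarrow> \<exists>a\<in>H. a x \<noteq> 1"
  shows "H = dual_group"
proof (intro equalityI H(1) subsetI, rule ccontr)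
  fix c :: "'g \<Rightarrow> complex" assume c: "c \<in> dual_group" "c \<notin> H"
  have cc: "continuous_on UNIV c" by (rule dual_groupD(1)[OF c(1)])
  define Z where "Z = {x. Re (c x) \<le> 1 / 2}"
  have clZ: "closed Z" unfolding Z_def by (intro closed_Collect_le continuous_intros cc)
  have "compact Z" using compact_Int_closed[OF compact_UNIV clZ] by simp
  moreover have "open {x. a x \<noteq> 1}" if "a \<in> H" for a
    using that H(1) dual_groupD(1) by (intro open_Collect_neq continuous_intros) auto
  moreover have "Z \<subseteq> (\<Union>a\<in>H. {x. a x \<noteq> 1})"
  proof
    fix x assume "x \<in> Z"
    then have "x \<noteq> 0" using dual_groupD(4)[OF c(1)] by (auto simp: Z_def)
    then show "x \<in> (\<Union>a\<in>H. {x. a x \<noteq> 1})" using sep by auto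
  qed
  ultimately obtain I where I: "I \<subseteq> H" "finite I" "Z \<subseteq> (\<Union>a\<in>I. {x. a x \<noteq> 1})"
    by (meson compactE_image)
  have Id: "finite I" "I \<subseteq> dual_group" using I H(1) by auto
  define P where "P = fejer I (\<lambda>_. 1)"
  have P: "continuous_on UNIV P" "\<And>x. 0 \<le> P x" "P 0 = 1"
    unfolding P_def by (rule continuous_fejer[OF Id] fejer_nonneg[OF Id] fejer_at_0[OF Id(2)]; simp)+
  obtain t where t: "0 \<le> t" "t < 1" "\<And>x. x \<in> Z \<Longrightarrow> P x \<le> t"
    unfolding P_def by (rule fejer_bound[OF Id _ clZ, of "\<lambda>_. 1"]) (use I(3) in auto)
  \<comment> \<open>The factor 4: the real part of \<open>(c - 1/2) * P ^ N\<close> is at least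
    \<open>- 2 * t ^ N\<close> everywhere, while its mean is minus half the mean of
    \<open>P ^ N\<close>.\<close>
  obtain N where N: "4 * t ^ N < Re (mean (\<lambda>x. of_real (P x ^ N)))"
    using mean_power_dominates[OF P t(1,2)] by blast
  \<comment> \<open>Orthogonality of \<open>c\<close> to all of \<open>H\<close>, phrased as a twist
    of the zero function; multiplying by powers of the kernel keeps the left function zero.\<close>
  have tw: "twisted H (\<lambda>_. 1) (\<lambda>_. 0) c" unfolding twisted_def
  proof (intro conjI ballI cc)
    fix a assume a: "a \<in> H"
    have ad: "a \<in> dual_group" using a H(1) by blast
    have "(\<lambda>x. c x * a x) \<noteq> (\<lambda>_. 1)"
    proof
      assume "(\<lambda>x. c x * a x) = (\<lambda>_. 1)"
      then have "c x * a x = cnj (a x) * a x" for x using dual_groupD(8)[OF ad] by (metis (no_types))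
      then have "c = (\<lambda>x. cnj (a x))" using dual_groupD(6)[OF ad] by (simp add: fun_eq_iff)
      then show False using H(4)[OF a] c(2) by simp
    qed
    then show "mean (\<lambda>x. c x * a x) = 1 * mean (\<lambda>x. 0 * a x)"
      using mean_character[OF dual_group_mult[OF c(1) ad]] by (simp add: mean_const)
  qed auto
  have "twisted H (\<lambda>_. 1) (\<lambda>x. 0 * of_real (P x ^ N)) (\<lambda>x. c x * of_real (P x ^ N))"
    unfolding P_def by (rule twisted_fejer[OF H(1) _ _ _ _ _ tw I(2,1)]) (use H(3,4) in auto)
  from twistedD[OF this H(2)] have m0: "mean (\<lambda>x. c x * of_real (P x ^ N)) = 0"
    by (simp add: mean_const)
  have k: "continuous_on UNIV (\<lambda>x. c x * of_real (P x ^ N))" "continuous_on UNIV (\<lambda>x. complex_of_real (P x ^ N))"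
    by (intro continuous_intros cc P)+
  have "- (2 * t ^ N) \<le> Re (mean (\<lambda>x. c x * of_real (P x ^ N) - 1/2 * of_real (P x ^ N)))"
  proof (rule mean_ge)
    fix x
    have "Re (c x * of_real (P x ^ N) - 1/2 * of_real (P x ^ N)) = (Re (c x) - 1/2) * P x ^ N"
      by (simp add: algebra_simps flip: of_real_power)
    also have "\<dots> \<ge> - (2 * t ^ N)"
    proof (cases "x \<in> Z")
      case True
      have "P x ^ N \<le> t ^ N" using True t(3) P(2) by (intro power_mono) auto
      moreover have "Re (c x) - 1/2 \<ge> -2" using abs_Re_le_cmod[of "c x"] dual_groupD(2)[OF c(1), of x] by simp
      moreover from this have "-2 * P x ^ N \<le> (Re (c x) - 1/2) * P x ^ N"
        using P(2) by (intro mult_right_mono) auto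
      ultimately show ?thesis by simp
    next
      case False
      then have "0 \<le> (Re (c x) - 1/2) * P x ^ N" using P(2) by (auto simp: Z_def)
      moreover have "0 \<le> t ^ N" using t by simp
      ultimately show ?thesis by linarith
    qed
    finally show "- (2 * t ^ N) \<le> Re (c x * of_real (P x ^ N) - 1/2 * of_real (P x ^ N))" .
  qed (intro continuous_intros cc P)
  also have "\<dots> = - (1/2 * Re (mean (\<lambda>x. of_real (P x ^ N))))"
    unfolding mean_diff[OF k(1) continuous_on_mult_left[OF k(2)]] mean_cmult[OF k(2)] m0 by simp
  finally show False using N by simp
qed

text \<open>Urysohn gives \<open>f\<close> with different values at \<open>0\<close> and
  \<open>x\<close>, so \<open>h\<close>, the translate of \<open>f\<close> by \<open>x\<close> minus
  \<open>f\<close>, is not zero. A character equal to 1 at \<open>x\<close> is orthogonal to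
  \<open>h\<close> by invariance of the mean.\<close>

theorem characters_separate_points:
  fixes x :: 'g
  assumes "metrizable_space (euclidean :: 'g topology)" "x \<noteq> 0"
  obtains a where "a \<in> dual_group" "a x \<noteq> 1"
proof -
  have "completely_regular_space (euclidean :: 'g topology)"
    using assms(1) by (rule metrizable_imp_completely_regular_space)
  moreover have "closedin (euclidean :: 'g topology) {0}"
    using closedin_t1_singleton[OF metrizable_imp_t1_space[OF assms(1)], of 0] by simp
  ultimately obtain f :: "'g \<Rightarrow> real" where f: "continuous_map euclidean (top_of_set {0..1}) f" "f x = 0" "f ` {0} \<subseteq> {1}"
    using assms(2) unfolding completely_regular_space_def by (metis Diff_iff UNIV_I singletonD topspace_euclidean)
  have cf: "continuous_on UNIV f" using f(1) by (simp add: continuous_map_in_subtopology)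
  define h where "h y = complex_of_real (f (y + x) - f y)" for y
  have h: "continuous_on UNIV h" unfolding h_def
    by (intro continuous_intros cf continuous_on_compose2[OF cf]) auto
  have "h 0 \<noteq> 0" using f by (simp add: h_def)
  from exists_nonorthogonal_character[OF h this] obtain a where a: "is_character a" "mean (\<lambda>y. h y * a y) \<noteq> 0" .
  have ad: "a \<in> dual_group" using a(1) by (simp add: dual_group_def)
  have "a x \<noteq> 1"
  proof
    assume ax: "a x = 1"
    have k1: "continuous_on UNIV (\<lambda>y. complex_of_real (f y) * a y)"
      by (intro continuous_intros cf dual_groupD(1) ad)
    have k2: "continuous_on UNIV (\<lambda>y. complex_of_real (f (y + x)) * a (y + x))"
      by (rule continuous_on_compose2[OF k1]) (auto intro!: continuous_intros)
    have "(\<lambda>y. h y * a y) = (\<lambda>y. of_real (f (y + x)) * a (y + x) - of_real (f y) * a y)"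
      using ax dual_groupD(3)[OF ad] by (auto simp: h_def algebra_simps)
    then have "mean (\<lambda>y. h y * a y) = 0"
      using mean_diff[OF k2 k1] mean_shift[OF k1, of x] by simp
    then show False using a(2) by simp
  qed
  then show ?thesis using that ad by blast
qed

text \<open>Separation plus compactness of the complement of \<open>U\<close>: finitely many
  conditions of the form \<open>cmod (c x - 1) > 1/(n+1)\<close> already cover it, and
  \<open>e\<close> is taken no larger than any of these thresholds.\<close>

lemma neighbourhood_by_characters:
  fixes U :: "'g set"
  assumes met: "metrizable_space (euclidean :: 'g topology)" and U: "open U" "0 \<in> U"
  obtains F e where "finite F" "F \<subseteq> dual_group" "e > 0" "\<And>x. (\<And>c. c \<in> F \<Longrightarrow> cmod (c x - 1) < e) \<Longrightarrow> x \<in> U"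
proof -
  define W where "W = (\<lambda>(c, n). {x :: 'g. inverse (real (Suc n)) < cmod (c x - 1)})"
  have "compact (- U)" using compact_Int_closed[OF compact_UNIV, of "- U"] U(1) by (simp add: closed_open)
  moreover have "open (W p)" if "p \<in> dual_group \<times> UNIV" for p
    using that dual_groupD(1) by (auto simp: W_def intro!: open_Collect_less continuous_intros)
  moreover have "- U \<subseteq> (\<Union>p\<in>dual_group \<times> UNIV. W p)"
  proof
    fix x assume "x \<in> - U"
    then have "x \<noteq> 0" using U(2) by auto
    then obtain c where c: "c \<in> dual_group" "c x \<noteq> 1" using characters_separate_points[OF met] by blast
    then obtain n where "inverse (real (Suc n)) < cmod (c x - 1)"
      using reals_Archimedean[of "cmod (c x - 1)"] by auto
    then show "x \<in> (\<Union>p\<in>dual_group \<times> UNIV. W p)" using c by (force simp: W_def)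
  qed
  ultimately obtain D where D: "D \<subseteq> dual_group \<times> UNIV" "finite D" "- U \<subseteq> (\<Union>p\<in>D. W p)"
    by (meson compactE_image)
  define F where "F = fst ` D"
  define e where "e = inverse (real (Suc (Max (insert 0 (snd ` D)))))"
  show ?thesis
  proof (rule that[of F e])
    fix x assume F: "\<And>c. c \<in> F \<Longrightarrow> cmod (c x - 1) < e"
    show "x \<in> U"
    proof (rule ccontr)
      assume "x \<notin> U"
      then obtain c n where cn: "(c, n) \<in> D" "inverse (real (Suc n)) < cmod (c x - 1)"
        using D(3) by (auto simp: W_def)
      have "n \<le> Max (insert 0 (snd ` D))" using cn(1) D(2) by (intro Max_ge) force+
      then have "e \<le> inverse (real (Suc n))" unfolding e_def by (intro le_imp_inverse_le) auto
      moreover have "c \<in> F" using cn(1) by (force simp: F_def)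
      ultimately show False using F cn(2) by fastforce
    qed
  qed (use D in \<open>auto simp: F_def e_def\<close>)
qed

end

subsection \<open>Expansive actions\<close>

lemma endo_actionD:
  assumes "endo_action \<rho>"
  shows "\<rho> \<gamma> (x + y) = \<rho> \<gamma> x + \<rho> \<gamma> y" "\<rho> \<gamma> 0 = 0" "\<rho> \<gamma> (\<rho> \<delta> x) = \<rho> (\<gamma> * \<delta>) x" "\<rho> 1 x = x"
proof -
  show a: "\<rho> \<gamma> (x + y) = \<rho> \<gamma> x + \<rho> \<gamma> y" for x y using assms by (simp add: endo_action_def)
  show "\<rho> \<gamma> 0 = 0" using a[of 0 0] by simp
  show "\<rho> \<gamma> (\<rho> \<delta> x) = \<rho> (\<gamma> * \<delta>) x" "\<rho> 1 x = x" using assms by (simp_all add: endo_action_def)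
qed

lemma orbit_subset_dual:
  "endo_action \<rho> \<Longrightarrow> F \<subseteq> dual_group \<Longrightarrow> {ch \<circ> \<rho> \<gamma> | ch \<gamma>. ch \<in> F} \<subseteq> dual_group"
  using dual_group_endo by blast

lemma cmod_cis_diff_le: "cmod (cis s - 1) \<le> \<bar>s\<bar>"
proof -
  have "(cmod (cis s - 1))\<^sup>2 = 2 - 2 * cos s"
    unfolding cmod_power2 using sin_cos_squared_add[of s] by (simp add: power2_eq_square algebra_simps)
  also have "\<dots> = (2 * sin (s / 2))\<^sup>2"
    using cos_double_sin[of "s / 2"] by (simp add: power2_eq_square)
  finally have "(cmod (cis s - 1))\<^sup>2 = (2 * sin (s / 2))\<^sup>2" .
  then have "cmod (cis s - 1) = 2 * \<bar>sin (s / 2)\<bar>"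
    by (metis abs_mult abs_norm_cancel abs_numeral power2_eq_iff_nonneg abs_ge_zero power2_abs)
  also have "\<dots> \<le> \<bar>s\<bar>" using abs_sin_x_le_abs_x[of "s / 2"] by simp
  finally show ?thesis .
qed

text \<open>Within distance 1 of 1 the real part is positive, so both arguments are below
  \<open>pi / 2\<close> in modulus and their sum does not wrap around.\<close>

lemma Arg_mult_near_1:
  assumes "cmod (z - 1) < 1" "cmod (w - 1) < 1"
  shows "Arg (z * w) = Arg z + Arg w"
proof -
  have *: "\<bar>Arg u\<bar> < pi / 2 \<and> u \<noteq> 0" if "cmod (u - 1) < 1" for u
  proof -
    have "\<bar>Re (u - 1)\<bar> < 1" using abs_Re_le_cmod[of "u - 1"] that by linarith
    then have "Re u > 0" by auto
    then show ?thesis using Re_Ln_pos_lt_imp Arg_eq_Im_Ln[of u] by fastforce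
  qed
  show ?thesis using *[OF assms(1)] *[OF assms(2)] by (intro Arg_times) auto
qed

section \<open>Necessity of the two conditions, then their sufficiency\<close>

context compact_ab_group
begin

lemma expansive_imp_finitely_generated:
  fixes \<rho> :: "'m::monoid_mult \<Rightarrow> 'g \<Rightarrow> 'g"
  assumes met: "metrizable_space (euclidean :: 'g topology)" and \<rho>: "endo_action \<rho>" and "expansive \<rho>"
  shows "\<exists>F. finite F \<and> F \<subseteq> dual_group \<and> gen_subgroup {ch \<circ> \<rho> \<gamma> | ch \<gamma>. ch \<in> F} = dual_group"
proof -
  obtain U where U: "open U" "0 \<in> U" "(\<Inter>\<gamma>. \<rho> \<gamma> -` U) = {0}"
    using assms(3) unfolding expansive_def by blast
  obtain F e where F: "finite F" "F \<subseteq> dual_group" "e > 0" "\<And>x. (\<And>c. c \<in> F \<Longrightarrow> cmod (c x - 1) < e) \<Longrightarrow> x \<in> U"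
    using neighbourhood_by_characters[OF met U(1,2)] by blast
  define S where "S = {ch \<circ> \<rho> \<gamma> | ch \<gamma>. ch \<in> F}"
  have S: "gen_subgroup S \<subseteq> dual_group"
    unfolding S_def by (intro gen_subgroup_subset_dual orbit_subset_dual \<rho> F)
  have "gen_subgroup S = dual_group"
  proof (rule separating_subgroup_eq_dual[OF S gen_one gen_mult])
    fix a assume a: "a \<in> gen_subgroup S"
    then have "(\<lambda>x. cnj (a x)) = (\<lambda>x. inverse (a x))" using S dual_groupD(7) by (metis subsetD)
    then show "(\<lambda>x. cnj (a x)) \<in> gen_subgroup S" using gen_inv[OF a] by simp
  next
    fix x :: 'g assume "x \<noteq> 0"
    then obtain \<gamma> where "\<rho> \<gamma> x \<notin> U" using U(3) by blast
    then obtain c where c: "c \<in> F" "\<not> cmod (c (\<rho> \<gamma> x) - 1) < e" using F(4) by blast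
    then have "(c \<circ> \<rho> \<gamma>) x \<noteq> 1" using F(3) by auto
    moreover have "c \<circ> \<rho> \<gamma> \<in> gen_subgroup S" using c(1) by (intro gen_base) (auto simp: S_def)
    ultimately show "\<exists>a\<in>gen_subgroup S. a x \<noteq> 1" by blast
  qed auto
  then show ?thesis using F unfolding S_def by blast
qed

lemma expansive_imp_unbounded:
  fixes \<rho> :: "'m::monoid_mult \<Rightarrow> 'g \<Rightarrow> 'g"
  assumes met: "metrizable_space (euclidean :: 'g topology)" and \<rho>: "endo_action \<rho>" and "expansive \<rho>"
    and p: "p \<in> LG" "p \<noteq> (\<lambda>_. 0)"
  shows "\<not> bounded_in_LG {rho_e \<rho> \<gamma> p | \<gamma>. True}"
proof
  assume bd: "bounded_in_LG {rho_e \<rho> \<gamma> p | \<gamma>. True}"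
  obtain U where U: "open U" "0 \<in> U" "(\<Inter>\<gamma>. \<rho> \<gamma> -` U) = {0}"
    using assms(3) unfolding expansive_def by blast
  obtain F e where F: "finite F" "F \<subseteq> dual_group" "e > 0" "\<And>x. (\<And>c. c \<in> F \<Longrightarrow> cmod (c x - 1) < e) \<Longrightarrow> x \<in> U"
    using neighbourhood_by_characters[OF met U(1,2)] by blast
  have padd: "p (\<lambda>x. a x * b x) = p a + p b" if "a \<in> dual_group" "b \<in> dual_group" for a b
    using p(1) that by (simp add: LG_def)
  obtain c1 where c1: "c1 \<in> dual_group" "p c1 \<noteq> 0" using p by (auto simp: LG_def fun_eq_iff)
  have "\<forall>c\<in>F. \<exists>B. \<forall>\<gamma>. \<bar>p (c \<circ> \<rho> \<gamma>)\<bar> \<le> B"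
  proof
    fix c assume "c \<in> F"
    then have c: "c \<in> dual_group" using F(2) by blast
    then obtain B where "\<And>q. q \<in> {rho_e \<rho> \<gamma> p | \<gamma>. True} \<Longrightarrow> \<bar>q c\<bar> \<le> B"
      using bd unfolding bounded_in_LG_def by blast
    then have "\<bar>rho_e \<rho> \<gamma> p c\<bar> \<le> B" for \<gamma> by blast
    then show "\<exists>B. \<forall>\<gamma>. \<bar>p (c \<circ> \<rho> \<gamma>)\<bar> \<le> B" using c by (auto simp: rho_e_def)
  qed
  then obtain B where B: "\<And>c \<gamma>. c \<in> F \<Longrightarrow> \<bar>p (c \<circ> \<rho> \<gamma>)\<bar> \<le> B c" by metis
  define M where "M = 1 + (\<Sum>c\<in>F. \<bar>B c\<bar>)"
  have M: "M > 0" unfolding M_def by (simp add: add_pos_nonneg sum_nonneg)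
  have BM: "\<bar>p (c \<circ> \<rho> \<gamma>)\<bar> < M" if c: "c \<in> F" for c \<gamma>
  proof -
    have "\<bar>B c\<bar> \<le> (\<Sum>c\<in>F. \<bar>B c\<bar>)" using F(1) c by (intro member_le_sum) auto
    then show ?thesis using B[OF c, of \<gamma>] unfolding M_def by linarith
  qed
  \<comment> \<open>The first bound keeps the orbit of the point with coordinates
    \<open>cis (t * p a)\<close> inside \<open>U\<close>; the second keeps \<open>t * p c1\<close>
    between 0 and \<open>pi\<close> in modulus, so that this point is not \<open>0\<close>.\<close>
  define t where "t = min (e / M) (1 / \<bar>p c1\<bar>)"
  have t: "t > 0" "t * M \<le> e" "t * \<bar>p c1\<bar> \<le> 1"
    using F(3) M c1(2) by (auto simp: t_def min_def field_simps)
  obtain x where x: "\<And>a. a \<in> dual_group \<Longrightarrow> a x = cis (t * p a)"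
    using dual_hom_is_evaluation[of "\<lambda>a. cis (t * p a)"] by (auto simp: padd cis_mult distrib_left)
  have "x \<in> (\<Inter>\<gamma>. \<rho> \<gamma> -` U)"
  proof (intro INT_I vimageI2 F(4))
    fix \<gamma> c assume c: "c \<in> F"
    have "c (\<rho> \<gamma> x) = cis (t * p (c \<circ> \<rho> \<gamma>))"
      using x[OF dual_group_endo[OF \<rho>, of c \<gamma>]] c F(2) by auto
    moreover have "\<bar>t * p (c \<circ> \<rho> \<gamma>)\<bar> < t * M" using BM[OF c] t(1) by (simp add: abs_mult)
    ultimately show "cmod (c (\<rho> \<gamma> x) - 1) < e"
      using cmod_cis_diff_le[of "t * p (c \<circ> \<rho> \<gamma>)"] t(2) by (simp only:)
  qed
  then have "x = 0" using U(3) by blast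
  then have c: "cis (t * p c1) = 1" using x[OF c1(1)] dual_groupD(4)[OF c1(1)] by simp
  have "sin \<bar>t * p c1\<bar> > 0"
    using t c1(2) pi_gt3 by (intro sin_gt_zero) (auto simp: abs_mult)
  then show False using c by (auto simp: complex_eq_iff abs_if split: if_splits)
qed

text \<open>A sequence of points \<open>y k\<close> whose orbits stay within \<open>1/k\<close> of \<open>0\<close> is rescaled, using the normalisers
  \<open>a k\<close>, to real functions \<open>Arg (c (y k)) / a k\<close> on the dual; a cluster point of these is a non-zero
  homomorphism to the reals with bounded orbit.\<close>
lemma bounded_orbit_from_sequence:
  fixes \<rho> :: "'m::monoid_mult \<Rightarrow> 'g \<Rightarrow> 'g" and y :: "nat \<Rightarrow> 'g" and a :: "nat \<Rightarrow> real"
  assumes \<rho>: "endo_action \<rho>" and F: "finite F" "F \<subseteq> dual_group"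
    and gen: "gen_subgroup {ch \<circ> \<rho> \<gamma> | ch \<gamma>. ch \<in> F} = dual_group"
    and a: "\<And>k. a k > 0"
    and near: "\<And>k c \<gamma>. c \<in> F \<Longrightarrow> cmod (c (\<rho> \<gamma> (y k)) - 1) < inverse (real (Suc k))"
    and bd: "\<And>k c \<gamma>. c \<in> F \<Longrightarrow> \<bar>Arg (c (\<rho> \<gamma> (y k)))\<bar> \<le> 2 * a k"
    and norm: "\<And>k. a k \<le> (\<Sum>c\<in>F. \<bar>Arg (c (y k))\<bar>)"
  obtains p where "p \<in> LG" "p \<noteq> (\<lambda>_. 0)" "bounded_in_LG {rho_e \<rho> \<gamma> p | \<gamma>. True}"
proof -
  \<comment> \<open>Two estimates travel together through the generation of the dual: closeness to 1
    makes \<open>Arg\<close> additive, and the bound by \<open>a k\<close> controls the rescaled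
    functions. They hold only for large \<open>k\<close> depending on \<open>c\<close>, but
    uniformly in \<open>\<gamma>\<close>.\<close>
  define nice where "nice c C \<longleftrightarrow> C \<ge> 0 \<and> (\<forall>\<^sub>F k in sequentially. \<forall>\<gamma>.
    \<bar>Arg (c (\<rho> \<gamma> (y k)))\<bar> \<le> C * a k \<and> cmod (c (\<rho> \<gamma> (y k)) - 1) \<le> C * inverse (real (Suc k)))" for c C
  have ev1: "\<forall>\<^sub>F k in sequentially. C * inverse (real (Suc k)) < 1" for C
  proof -
    have "(\<lambda>k. C * inverse (real (Suc k))) \<longlonglongrightarrow> C * 0"
      by (intro tendsto_intros LIMSEQ_inverse_real_of_nat)
    then show ?thesis by (intro order_tendstoD) auto
  qed
  have add: "\<forall>\<^sub>F k in sequentially. \<forall>\<gamma>. Arg (c (\<rho> \<gamma> (y k)) * d (\<rho> \<gamma> (y k))) = Arg (c (\<rho> \<gamma> (y k))) + Arg (d (\<rho> \<gamma> (y k)))"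
    if "nice c C" "nice d D" for c C d D
    using that[unfolded nice_def, THEN conjunct2] ev1[of C] ev1[of D]
    by eventually_elim (meson Arg_mult_near_1 le_less_trans)
  have nice_ex: "\<exists>C. nice c C" if "c \<in> dual_group" for c
    using that unfolding gen[symmetric]
  proof induction
    case gen_one
    show ?case by (intro exI[of _ 0]) (simp add: nice_def)
  next
    case (gen_base s)
    then obtain c \<delta> where c: "c \<in> F" "s = c \<circ> \<rho> \<delta>" by blast
    have "cmod (s (\<rho> \<gamma> (y k)) - 1) \<le> 2 * inverse (real (Suc k))" "\<bar>Arg (s (\<rho> \<gamma> (y k)))\<bar> \<le> 2 * a k" for \<gamma> k
    proof -
      \<comment> \<open>Uniformity in \<open>\<gamma>\<close> absorbs the shift by
        \<open>\<delta>\<close>, so orbit elements of \<open>F\<close> inherit the constant 2 from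
        \<open>F\<close> itself.\<close>
      have eq: "s (\<rho> \<gamma> (y k)) = c (\<rho> (\<delta> * \<gamma>) (y k))" by (simp add: c(2) endo_actionD[OF \<rho>])
      show "\<bar>Arg (s (\<rho> \<gamma> (y k)))\<bar> \<le> 2 * a k" unfolding eq by (rule bd[OF c(1)])
      have "0 < inverse (real (Suc k))" by simp
      then show "cmod (s (\<rho> \<gamma> (y k)) - 1) \<le> 2 * inverse (real (Suc k))"
        unfolding eq using near[OF c(1), of "\<delta> * \<gamma>" k] by linarith
    qed
    then show ?case by (intro exI[of _ 2]) (simp add: nice_def)
  next
    case (gen_mult c d)
    then obtain C D where CD: "nice c C" "nice d D" by blast
    have cd: "c \<in> dual_group" "d \<in> dual_group" using gen_mult gen by auto
    have "\<forall>\<^sub>F k in sequentially. \<forall>\<gamma>. \<bar>Arg (c (\<rho> \<gamma> (y k)) * d (\<rho> \<gamma> (y k)))\<bar> \<le> (C + D) * a k \<and>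
      cmod (c (\<rho> \<gamma> (y k)) * d (\<rho> \<gamma> (y k)) - 1) \<le> (C + D) * inverse (real (Suc k))"
      using CD[unfolded nice_def, THEN conjunct2] add[OF CD]
    proof eventually_elim
      case (elim k)
      show ?case
      proof (intro allI conjI)
        fix \<gamma>
        define u where "u = c (\<rho> \<gamma> (y k))"
        define w where "w = d (\<rho> \<gamma> (y k))"
        have uw: "\<bar>Arg u\<bar> \<le> C * a k" "cmod (u - 1) \<le> C * inverse (real (Suc k))"
          "\<bar>Arg w\<bar> \<le> D * a k" "cmod (w - 1) \<le> D * inverse (real (Suc k))" "Arg (u * w) = Arg u + Arg w"
          using elim by (simp_all add: u_def w_def)
        then show "\<bar>Arg (c (\<rho> \<gamma> (y k)) * d (\<rho> \<gamma> (y k)))\<bar> \<le> (C + D) * a k"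
          unfolding u_def[symmetric] w_def[symmetric] by (simp add: distrib_right)
        have "u * w - 1 = u * (w - 1) + (u - 1)" by (simp add: algebra_simps)
        also have "cmod \<dots> \<le> cmod (u * (w - 1)) + cmod (u - 1)" by (rule norm_triangle_ineq)
        also have "cmod (u * (w - 1)) = cmod (w - 1)" using dual_groupD(2)[OF cd(1)] by (simp add: norm_mult u_def)
        finally show "cmod (c (\<rho> \<gamma> (y k)) * d (\<rho> \<gamma> (y k)) - 1) \<le> (C + D) * inverse (real (Suc k))"
          unfolding u_def[symmetric] w_def[symmetric] distrib_right using uw by linarith
      qed
    qed
    then show ?case using CD by (intro exI[of _ "C + D"]) (simp add: nice_def)
  next
    case (gen_inv c)
    then obtain C where C: "nice c C" by blast
    have c: "c \<in> dual_group" using gen_inv gen by auto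
    have "\<bar>Arg (inverse (c z))\<bar> = \<bar>Arg (c z)\<bar>" "cmod (inverse (c z) - 1) = cmod (c z - 1)" for z
    proof -
      show "\<bar>Arg (inverse (c z))\<bar> = \<bar>Arg (c z)\<bar>" by (simp add: Arg_inverse)
      have "cmod (cnj (c z - 1)) = cmod (c z - 1)" by (rule complex_mod_cnj)
      then show "cmod (inverse (c z) - 1) = cmod (c z - 1)" by (simp add: dual_groupD(7)[OF c])
    qed
    then show ?case using C by (intro exI[of _ C]) (simp add: nice_def)
  qed
  define C where "C c = (if c \<in> dual_group then SOME C. nice c C else 0)" for c
  have C: "nice c (C c)" if "c \<in> dual_group" for c
    using someI_ex[OF nice_ex[OF that]] that by (simp add: C_def)
  have C0: "C c \<ge> 0" for c using C[of c] by (cases "c \<in> dual_group") (auto simp: nice_def C_def)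
  define P where "P k c = (if c \<in> dual_group then Arg (c (y k)) / a k else 0)" for k c
  \<comment> \<open>The bound by \<open>C c\<close> holds from an index depending on
    \<open>c\<close>; truncation puts every term in the compact box \<open>K\<close> without
    changing any coordinate eventually.\<close>
  define Q where "Q k c = (if \<bar>P k c\<bar> \<le> C c then P k c else 0)" for k c
  define K where "K = {f. \<forall>c. f c \<in> {- C c..C c}}"
  have "compact K" unfolding K_def by (intro compact_product) simp
  moreover have "Q k \<in> K" for k using C0 by (auto simp: K_def Q_def abs_le_iff)
  ultimately obtain p where p: "p \<in> K" "inf (nhds p) (filtermap Q sequentially) \<noteq> bot"
    unfolding compact_filter by (metis (mono_tags, lifting) always_eventually eventually_filtermap filtermap_bot_iff sequentially_bot)
  \<comment> \<open>A non-trivial filter finer than \<open>sequentially\<close> along which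
    \<open>Q\<close> converges to the cluster point; it takes the place of a subsequence.\<close>
  define G where "G = inf (filtercomap Q (nhds p)) sequentially"
  have G: "G \<noteq> bot"
  proof
    assume "G = bot"
    then have "eventually (\<lambda>_. False) G" by simp
    then obtain A B where AB: "eventually A (nhds p)" "eventually B sequentially" "\<And>k. A (Q k) \<Longrightarrow> B k \<Longrightarrow> False"
      unfolding G_def eventually_inf eventually_filtercomap by metis
    have "eventually (\<lambda>f. \<not> A f) (filtermap Q sequentially)"
      unfolding eventually_filtermap using AB(2) by eventually_elim (use AB(3) in blast)
    then have "eventually (\<lambda>_. False) (inf (nhds p) (filtermap Q sequentially))"
      unfolding eventually_inf using AB(1) by blast
    then show False using p(2) by (simp add: trivial_limit_def)
  qed
  have evG: "eventually A G" if "eventually A sequentially" for A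
    using that unfolding G_def by (rule filter_leD[OF inf_le2])
  have "filterlim Q (nhds p) G"
    unfolding G_def by (intro filterlim_mono[OF filterlim_filtercomap]) auto
  then have limQ: "((\<lambda>k. Q k c) \<longlongrightarrow> p c) G" for c
    using continuous_on_tendsto_compose[OF continuous_on_product_coordinates[of c], of Q p G] by simp
  have limP: "((\<lambda>k. P k c) \<longlongrightarrow> p c) G" for c
  proof (rule Lim_transform_eventually[OF limQ])
    show "\<forall>\<^sub>F k in G. Q k c = P k c"
    proof (cases "c \<in> dual_group")
      case True
      have "\<forall>\<^sub>F k in sequentially. Q k c = P k c"
        using C[OF True, unfolded nice_def, THEN conjunct2]
      proof eventually_elim
        case (elim k)
        then have "\<bar>Arg (c (\<rho> 1 (y k)))\<bar> \<le> C c * a k" by blast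
        then have "\<bar>P k c\<bar> \<le> C c" using True a[of k] by (simp add: P_def endo_actionD[OF \<rho>] field_simps)
        then show ?case by (simp add: Q_def)
      qed
      then show ?thesis by (rule evG)
    qed (use C0 in \<open>simp add: P_def Q_def\<close>)
  qed
  have "p (\<lambda>x. c x * d x) = p c + p d" if cd: "c \<in> dual_group" "d \<in> dual_group" for c d
  proof (rule tendsto_unique[OF G limP])
    have "\<forall>\<^sub>F k in sequentially. P k c + P k d = P k (\<lambda>x. c x * d x)"
      using add[OF C[OF cd(1)] C[OF cd(2)]]
    proof eventually_elim
      case (elim k)
      then have "Arg (c (\<rho> 1 (y k)) * d (\<rho> 1 (y k))) = Arg (c (\<rho> 1 (y k))) + Arg (d (\<rho> 1 (y k)))" by blast
      then show ?case using cd dual_group_mult[OF cd] by (simp add: P_def endo_actionD[OF \<rho>] add_divide_distrib)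
    qed
    then show "((\<lambda>k. P k (\<lambda>x. c x * d x)) \<longlongrightarrow> p c + p d) G"
      by (intro Lim_transform_eventually[OF tendsto_add[OF limP limP]] evG)
  qed
  moreover have "p c = 0" if "c \<notin> dual_group" for c
    using tendsto_unique[OF G limP[of c], of 0] that by (simp add: P_def)
  ultimately have pLG: "p \<in> LG" by (simp add: LG_def)
  \<comment> \<open>The normalisation by \<open>a k\<close> survives the limit because the sum over
    \<open>F\<close> is finite; this is what rules out \<open>p = 0\<close>.\<close>
  have "1 \<le> (\<Sum>c\<in>F. \<bar>p c\<bar>)"
  proof (rule tendsto_lowerbound[OF _ _ G])
    show "((\<lambda>k. \<Sum>c\<in>F. \<bar>P k c\<bar>) \<longlongrightarrow> (\<Sum>c\<in>F. \<bar>p c\<bar>)) G" by (intro tendsto_intros limP)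
    have "1 \<le> (\<Sum>c\<in>F. \<bar>P k c\<bar>)" for k
    proof -
      have "(\<Sum>c\<in>F. \<bar>P k c\<bar>) = (\<Sum>c\<in>F. \<bar>Arg (c (y k))\<bar> / a k)"
        using F(2) a[of k] by (intro sum.cong) (auto simp: P_def)
      then show ?thesis using norm[of k] a[of k] by (simp add: sum_divide_distrib[symmetric])
    qed
    then show "\<forall>\<^sub>F k in G. 1 \<le> (\<Sum>c\<in>F. \<bar>P k c\<bar>)" by simp
  qed
  then have "p \<noteq> (\<lambda>_. 0)" by auto
  moreover have "bounded_in_LG {rho_e \<rho> \<gamma> p | \<gamma>. True}"
    unfolding bounded_in_LG_def
  proof
    fix c :: "'g \<Rightarrow> complex" assume c: "c \<in> dual_group"
    have "\<bar>p (c \<circ> \<rho> \<gamma>)\<bar> \<le> C c" for \<gamma>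
    proof (rule tendsto_upperbound[OF _ _ G])
      show "((\<lambda>k. \<bar>P k (c \<circ> \<rho> \<gamma>)\<bar>) \<longlongrightarrow> \<bar>p (c \<circ> \<rho> \<gamma>)\<bar>) G" by (intro tendsto_intros limP)
      have "\<forall>\<^sub>F k in sequentially. \<bar>P k (c \<circ> \<rho> \<gamma>)\<bar> \<le> C c"
        using C[OF c, unfolded nice_def, THEN conjunct2]
      proof eventually_elim
        case (elim k)
        then have "\<bar>Arg (c (\<rho> \<gamma> (y k)))\<bar> \<le> C c * a k" by blast
        then show ?case using a[of k] dual_group_endo[OF \<rho> c, of \<gamma>] by (simp add: P_def field_simps)
      qed
      then show "\<forall>\<^sub>F k in G. \<bar>P k (c \<circ> \<rho> \<gamma>)\<bar> \<le> C c" by (rule evG)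
    qed
    then show "\<exists>B. \<forall>q\<in>{rho_e \<rho> \<gamma> p | \<gamma>. True}. \<bar>q c\<bar> \<le> B" using c by (intro exI[of _ "C c"]) (auto simp: rho_e_def)
  qed
  ultimately show ?thesis using that pLG by blast
qed

text \<open>A non-zero point \<open>x\<close> with small orbit need not have large arguments itself.
  Moving along the orbit to \<open>\<rho> \<gamma>1 x\<close>, where the supremum of the arguments
  is attained up to a factor 2, gives a point whose own arguments dominate those of its entire
  orbit.\<close>

lemma not_expansive_imp_bounded_orbit:
  fixes \<rho> :: "'m::monoid_mult \<Rightarrow> 'g \<Rightarrow> 'g"
  assumes met: "metrizable_space (euclidean :: 'g topology)" and \<rho>: "endo_action \<rho>"
    and F: "finite F" "F \<subseteq> dual_group" and gen: "gen_subgroup {ch \<circ> \<rho> \<gamma> | ch \<gamma>. ch \<in> F} = dual_group"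
    and ne: "\<not> expansive \<rho>"
  obtains p where "p \<in> LG" "p \<noteq> (\<lambda>_. 0)" "bounded_in_LG {rho_e \<rho> \<gamma> p | \<gamma>. True}"
proof -
  have "\<exists>y a. a > 0 \<and> (\<forall>c\<in>F. \<forall>\<gamma>. cmod (c (\<rho> \<gamma> y) - 1) < e \<and> \<bar>Arg (c (\<rho> \<gamma> y))\<bar> \<le> 2 * a) \<and>
      a \<le> (\<Sum>c\<in>F. \<bar>Arg (c y)\<bar>)" if e: "e > 0" for e
  proof -
    define U where "U = (\<Inter>c\<in>F. {x. cmod (c x - 1) < e})"
    have "open {x. cmod (c x - 1) < e}" if "c \<in> F" for c
      using that F(2) dual_groupD(1) by (intro open_Collect_less continuous_intros) auto
    then have "open U" unfolding U_def using F(1) by auto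
    moreover have U0: "0 \<in> U" using F(2) e dual_groupD(4) by (force simp: U_def)
    ultimately have "(\<Inter>\<gamma>. \<rho> \<gamma> -` U) \<noteq> {0}" using ne unfolding expansive_def by blast
    moreover have "0 \<in> (\<Inter>\<gamma>. \<rho> \<gamma> -` U)" using U0 by (simp add: endo_actionD[OF \<rho>])
    ultimately obtain x where x: "x \<noteq> 0" "\<And>\<gamma>. \<rho> \<gamma> x \<in> U" by auto
    define A where "A = (\<lambda>(c, \<gamma>). \<bar>Arg (c (\<rho> \<gamma> x))\<bar>) ` (F \<times> UNIV)"
    have bA: "bdd_above A"
    proof (rule bdd_aboveI[of _ pi])
      fix r assume "r \<in> A"
      then obtain z where "r = \<bar>Arg z\<bar>" by (auto simp: A_def)
      then show "r \<le> pi" using Arg_bounded[of z] by auto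
    qed
    \<comment> \<open>Guarantees a positive supremum: if all orbit elements of \<open>F\<close> were
      trivial at \<open>x\<close>, so would be the whole dual, which separates \<open>x\<close> from
      \<open>0\<close>.\<close>
    have "\<exists>c\<in>F. \<exists>\<gamma>. c (\<rho> \<gamma> x) \<noteq> 1"
    proof (rule ccontr)
      assume "\<not> ?thesis"
      then have triv: "\<And>c \<gamma>. c \<in> F \<Longrightarrow> c (\<rho> \<gamma> x) = 1" by blast
      have "d x = 1" if "d \<in> gen_subgroup {ch \<circ> \<rho> \<gamma> | ch \<gamma>. ch \<in> F}" for d
        using that by induction (auto simp: triv)
      then show False using characters_separate_points[OF met x(1)] gen by metis
    qed
    then obtain c0 \<gamma>0 where c0: "c0 \<in> F" "c0 (\<rho> \<gamma>0 x) \<noteq> 1" by blast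
    have "Arg (c0 (\<rho> \<gamma>0 x)) \<noteq> 0"
    proof
      assume "Arg (c0 (\<rho> \<gamma>0 x)) = 0"
      then have "c0 (\<rho> \<gamma>0 x) = of_real (cmod (c0 (\<rho> \<gamma>0 x)))"
        by (metis Arg_eq_0 complex_is_Real_iff cmod_eq_Re abs_of_nonneg of_real_Re)
      then show False using c0 F(2) dual_groupD(2)[of c0] by auto
    qed
    then have r0: "\<bar>Arg (c0 (\<rho> \<gamma>0 x))\<bar> > 0" "\<bar>Arg (c0 (\<rho> \<gamma>0 x))\<bar> \<in> A" using c0(1) by (auto simp: A_def)
    then have s: "Sup A > 0" using cSup_upper[OF r0(2) bA] by linarith
    \<comment> \<open>The supremum over the orbit need not be attained; half of it is exceeded,
      whence the factor 2 in the bound on the arguments.\<close>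
    then have "Sup A / 2 < Sup A" by simp
    then obtain r where r: "r \<in> A" "Sup A / 2 < r" using less_cSup_iff[of A "Sup A / 2"] bA r0(2) by blast
    then obtain c1 \<gamma>1 where c1: "c1 \<in> F" "r = \<bar>Arg (c1 (\<rho> \<gamma>1 x))\<bar>" by (auto simp: A_def)
    show ?thesis
    proof (intro exI[of _ "\<rho> \<gamma>1 x"] exI[of _ r] conjI ballI allI)
      show "r > 0" using r s by linarith
      fix c \<gamma> assume c: "c \<in> F"
      show "cmod (c (\<rho> \<gamma> (\<rho> \<gamma>1 x)) - 1) < e"
        using x(2)[of "\<gamma> * \<gamma>1"] c by (auto simp: U_def endo_actionD[OF \<rho>])
      have "\<bar>Arg (c (\<rho> (\<gamma> * \<gamma>1) x))\<bar> \<in> A" using c by (force simp: A_def)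
      from cSup_upper[OF this bA] show "\<bar>Arg (c (\<rho> \<gamma> (\<rho> \<gamma>1 x)))\<bar> \<le> 2 * r"
        using r(2) by (simp add: endo_actionD[OF \<rho>])
    next
      show "r \<le> (\<Sum>c\<in>F. \<bar>Arg (c (\<rho> \<gamma>1 x))\<bar>)"
        unfolding c1(2) using F(1) c1(1) by (intro member_le_sum) auto
    qed
  qed
  then have "\<exists>y a. a > 0 \<and> (\<forall>c\<in>F. \<forall>\<gamma>. cmod (c (\<rho> \<gamma> y) - 1) < inverse (real (Suc k)) \<and> \<bar>Arg (c (\<rho> \<gamma> y))\<bar> \<le> 2 * a) \<and>
      a \<le> (\<Sum>c\<in>F. \<bar>Arg (c y)\<bar>)" for k by simp
  then obtain y a where ya: "\<And>k. a k > 0 \<and> (\<forall>c\<in>F. \<forall>\<gamma>. cmod (c (\<rho> \<gamma> (y k)) - 1) < inverse (real (Suc k))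
      \<and> \<bar>Arg (c (\<rho> \<gamma> (y k)))\<bar> \<le> 2 * a k) \<and> a k \<le> (\<Sum>c\<in>F. \<bar>Arg (c (y k))\<bar>)"
    by metis
  show ?thesis
    by (rule bounded_orbit_from_sequence[OF \<rho> F gen, of a y]) (use ya that in blast)+
qed

end

theorem theoremB:
  fixes \<rho> :: "'m::monoid_mult \<Rightarrow> 'g::topological_ab_group_add \<Rightarrow> 'g"
  assumes "solenoid TYPE('g)"
    and "endo_action \<rho>"
  shows "expansive \<rho> \<longleftrightarrow>
    ((\<exists>F. finite F \<and> F \<subseteq> dual_group \<and>
          gen_subgroup {ch \<circ> \<rho> \<gamma> | ch \<gamma>. ch \<in> F} = dual_group)
     \<and> (\<forall>p\<in>LG. p \<noteq> (\<lambda>_. 0) \<longrightarrow> \<not> bounded_in_LG {rho_e \<rho> \<gamma> p | \<gamma>. True}))"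
proof -
  interpret compact_ab_group "TYPE('g)"
    using assms(1) by unfold_locales (simp add: solenoid_def)
  have met: "metrizable_space (euclidean :: 'g topology)" using assms(1) by (simp add: solenoid_def)
  show ?thesis
  proof (intro iffI conjI)
    assume ex: "expansive \<rho>"
    show "\<exists>F. finite F \<and> F \<subseteq> dual_group \<and> gen_subgroup {ch \<circ> \<rho> \<gamma> | ch \<gamma>. ch \<in> F} = dual_group"
      by (rule expansive_imp_finitely_generated[OF met assms(2) ex])
    show "\<forall>p\<in>LG. p \<noteq> (\<lambda>_. 0) \<longrightarrow> \<not> bounded_in_LG {rho_e \<rho> \<gamma> p | \<gamma>. True}"
      using expansive_imp_unbounded[OF met assms(2) ex] by blast
  next
    assume a: "(\<exists>F. finite F \<and> F \<subseteq> dual_group \<and> gen_subgroup {ch \<circ> \<rho> \<gamma> | ch \<gamma>. ch \<in> F} = dual_group)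
      \<and> (\<forall>p\<in>LG. p \<noteq> (\<lambda>_. 0) \<longrightarrow> \<not> bounded_in_LG {rho_e \<rho> \<gamma> p | \<gamma>. True})"
    then obtain F where F: "finite F" "F \<subseteq> dual_group" "gen_subgroup {ch \<circ> \<rho> \<gamma> | ch \<gamma>. ch \<in> F} = dual_group"
      by blast
    show "expansive \<rho>"
    proof (rule ccontr)
      assume "\<not> expansive \<rho>"
      from not_expansive_imp_bounded_orbit[OF met assms(2) F this] a show False by blast
    qed
  qed
qed

end
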